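(* Let $\mathscr{A}$ be a ring with $\mathbb{C}[z]\subseteq \mathscr{A}\subseteq \mathscr{H}_{\rm fin}$, and suppose that $\{f\in \mathscr{A} : f \text{ is holonomic}\}=\mathbb{C}[z]$. Then the set $\mathbb{Z}\subseteq \mathscr{A}$ (the integer constant functions) is positive existentially definable in $\mathscr{A}$ over the language $\mathscr{L}_z=\{0,1,z,+,\times,=\}$. In particular, the positive existential theory of $\mathscr{A}$ over $\mathscr{L}_z$ is undecidable (i.e., there is no algorithm deciding whether an arbitrary system of polynomial equations with coefficients in $\mathbb{Z}[z]$ has a solution in $\mathscr{A}$).
   Context: $\mathscr{H}$ denotes the ring of complex entire functions in one variable $z$. An entire function $f$ has finite order if there is a constant $A\ge 0$ such that $\log\max\{|f(z)|:|z|\le r\}=O_f(r^A)$ for all $r>1$; $\mathscr{H}_{\rm fin}$ is the ring of entire functions of finite order. A formal power series $F\in\mathbb{C}[[z]]$ is holonomic if there exist an integer $k\ge1$ and polynomials $P_0,\dots,P_k\in\mathbb{C}[z]$ with $P_k\neq0$ such that $P_kF^{(k)}+\dots+P_1F^{(1)}+P_0F=0$; a function holomorphic near $z=0$ is holonomic if its power series expansion at $0$ is. A ring $\mathscr{A}\supseteq\mathbb{C}[z]$ is regarded as an $\mathscr{L}_z$-structure, with the constant symbol $z$ interpreted as the identity function. A subset is positive existentially definable if it is defined by a formula of the form $\exists y_1\dots\exists y_m\,\phi$ where $\phi$ is a finite conjunction (and disjunction) of polynomial equations over $\mathscr{L}_z$. *)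

theory Defs
  imports
    "HOL-Complex_Analysis.Complex_Analysis"
    "HOL-Library.Function_Algebras"
    "HOL-Library.Nat_Bijection"
begin

section \<open>Rings of entire functions\<close>

text \<open>
  Functions are added and multiplied pointwise; the polynomial ring \<open>\<complex>[z]\<close> is the set
  \<open>range poly\<close> of complex polynomial functions.
\<close>

type_synonym cfun = "complex \<Rightarrow> complex"

definition is_subring :: "'a::ring_1 set \<Rightarrow> bool" where
  "is_subring A \<longleftrightarrow>
     0 \<in> A \<and> 1 \<in> A \<and> (\<forall>f\<in>A. - f \<in> A) \<and> (\<forall>f\<in>A. \<forall>g\<in>A. f + g \<in> A) \<and> (\<forall>f\<in>A. \<forall>g\<in>A. f * g \<in> A)"

text \<open>
  For \<open>f = 0\<close> the convention \<open>ln 0 = 0\<close> makes the bound true, so the zero function has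
  finite order. The supremum is over a compact set, so it is the maximum for continuous \<open>f\<close>.
\<close>

definition finite_order :: "cfun \<Rightarrow> bool" where
  "finite_order f \<longleftrightarrow>
     (\<exists>a\<ge>0. \<exists>C. \<forall>r>1. \<bar>ln (SUP z\<in>cball 0 r. cmod (f z))\<bar> \<le> C * r powr a)"

definition H_fin :: "cfun set" where
  "H_fin = {f. f holomorphic_on UNIV \<and> finite_order f}"

definition holonomic_fps :: "complex fps \<Rightarrow> bool" where
  "holonomic_fps F \<longleftrightarrow>
     (\<exists>k\<ge>1. \<exists>P :: nat \<Rightarrow> complex poly.
        P k \<noteq> 0 \<and> (\<Sum>i\<le>k. fps_of_poly (P i) * (fps_deriv ^^ i) F) = 0)"

definition holonomic :: "cfun \<Rightarrow> bool" where
  "holonomic f \<longleftrightarrow> holonomic_fps (fps_expansion f 0)"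

definition int_constants :: "cfun set" where
  "int_constants = range (\<lambda>n::int. \<lambda>_. of_int n)"


section \<open>Positive existential formulas over \<open>{0, 1, z, +, \<times>, =}\<close>\<close>

datatype lz_term = TZero | TOne | TZ | TVar nat | TAdd lz_term lz_term | TMul lz_term lz_term

datatype lz_matrix = Eq lz_term lz_term | And lz_matrix lz_matrix | Or lz_matrix lz_matrix

text \<open>\<open>Exists [i\<^sub>1, \<dots>, i\<^sub>m] \<phi>\<close> is \<open>\<exists>y\<^bsub>i\<^sub>1\<^esub> \<dots> \<exists>y\<^bsub>i\<^sub>m\<^esub>. \<phi>\<close>.\<close>

datatype pe_formula = Exists "nat list" lz_matrix

fun eval_term :: "(nat \<Rightarrow> cfun) \<Rightarrow> lz_term \<Rightarrow> cfun" where
  "eval_term v TZero = 0"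
| "eval_term v TOne = 1"
| "eval_term v TZ = (\<lambda>z. z)"
| "eval_term v (TVar i) = v i"
| "eval_term v (TAdd s t) = eval_term v s + eval_term v t"
| "eval_term v (TMul s t) = eval_term v s * eval_term v t"

fun holds_matrix :: "(nat \<Rightarrow> cfun) \<Rightarrow> lz_matrix \<Rightarrow> bool" where
  "holds_matrix v (Eq s t) \<longleftrightarrow> eval_term v s = eval_term v t"
| "holds_matrix v (And p q) \<longleftrightarrow> holds_matrix v p \<and> holds_matrix v q"
| "holds_matrix v (Or p q) \<longleftrightarrow> holds_matrix v p \<or> holds_matrix v q"

fun holds :: "cfun set \<Rightarrow> (nat \<Rightarrow> cfun) \<Rightarrow> pe_formula \<Rightarrow> bool" where
  "holds A v (Exists is p) \<longleftrightarrow>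
     (\<exists>w. (\<forall>i\<in>set is. w i \<in> A) \<and> (\<forall>i. i \<notin> set is \<longrightarrow> w i = v i) \<and> holds_matrix w p)"

fun vars_term :: "lz_term \<Rightarrow> nat set" where
  "vars_term TZero = {}"
| "vars_term TOne = {}"
| "vars_term TZ = {}"
| "vars_term (TVar i) = {i}"
| "vars_term (TAdd s t) = vars_term s \<union> vars_term t"
| "vars_term (TMul s t) = vars_term s \<union> vars_term t"

fun vars_matrix :: "lz_matrix \<Rightarrow> nat set" where
  "vars_matrix (Eq s t) = vars_term s \<union> vars_term t"
| "vars_matrix (And p q) = vars_matrix p \<union> vars_matrix q"
| "vars_matrix (Or p q) = vars_matrix p \<union> vars_matrix q"

fun free_vars :: "pe_formula \<Rightarrow> nat set" where
  "free_vars (Exists is p) = vars_matrix p - set is"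

text \<open>
  Definability is without parameters. At most \<open>y\<^sub>0\<close> is free in \<open>F\<close>, so only the value \<open>f\<close> of
  \<open>y\<^sub>0\<close> matters in the constant assignment below.
\<close>

definition pos_ex_definable :: "cfun set \<Rightarrow> cfun set \<Rightarrow> bool" where
  "pos_ex_definable A S \<longleftrightarrow> (\<exists>F. free_vars F \<subseteq> {0} \<and> S = {f \<in> A. holds A (\<lambda>_. f) F})"

definition pe_sentences :: "pe_formula set" where
  "pe_sentences = {F. free_vars F = {}}"

definition pe_theory :: "cfun set \<Rightarrow> pe_formula set" where
  "pe_theory A = {F \<in> pe_sentences. holds A (\<lambda>_. 0) F}"


section \<open>Systems of polynomial equations with coefficients in \<open>\<int>[z]\<close>\<close>

text \<open>
  A pair \<open>(c, [e\<^sub>0, \<dots>, e\<^sub>n])\<close> stands for the monomial \<open>c(z) y\<^sub>0\<^bsup>e\<^sub>0\<^esup> \<cdots> y\<^sub>n\<^bsup>e\<^sub>n\<^esup>\<close>, a list of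
  such pairs for the sum of its monomials, and a list of polynomials for the system of equations
  setting all of them to zero.
\<close>

type_synonym zpoly = "(int poly \<times> nat list) list"

definition eval_monomial :: "(nat \<Rightarrow> cfun) \<Rightarrow> int poly \<times> nat list \<Rightarrow> cfun" where
  "eval_monomial v = (\<lambda>(c, e) z. poly (map_poly of_int c) z * (\<Prod>i<length e. v i z ^ (e ! i)))"

definition eval_zpoly :: "(nat \<Rightarrow> cfun) \<Rightarrow> zpoly \<Rightarrow> cfun" where
  "eval_zpoly v p = (\<Sum>m\<leftarrow>p. eval_monomial v m)"

definition solvable_systems :: "cfun set \<Rightarrow> zpoly list set" where
  "solvable_systems A = {S. \<exists>v. (\<forall>i. v i \<in> A) \<and> (\<forall>p\<in>set S. eval_zpoly v p = 0)}"


section \<open>Decidability\<close>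

text \<open>
  Algorithms are the partial recursive functions: \<open>rec_eval f xs y\<close> says that the function
  denoted by \<open>f\<close> is defined at \<open>xs\<close> with value \<open>y\<close>. The first argument is the recursion variable
  of \<open>PrimRec\<close> and the variable minimised by \<open>Mu\<close>.
\<close>

datatype recf =
  Zero | Succ | Proj nat | Comp recf "recf list" | PrimRec recf recf | Mu recf

inductive rec_eval :: "recf \<Rightarrow> nat list \<Rightarrow> nat \<Rightarrow> bool" where
  zero: "rec_eval Zero xs 0"
| succ: "rec_eval Succ [x] (Suc x)"
| proj: "i < length xs \<Longrightarrow> rec_eval (Proj i) xs (xs ! i)"
| comp: "list_all2 (\<lambda>g y. rec_eval g xs y) gs ys \<Longrightarrow> rec_eval f ys y \<Longrightarrow>
    rec_eval (Comp f gs) xs y"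
| primrec_0: "rec_eval f xs y \<Longrightarrow> rec_eval (PrimRec f g) (0 # xs) y"
| primrec_Suc: "rec_eval (PrimRec f g) (n # xs) r \<Longrightarrow> rec_eval g (n # r # xs) y \<Longrightarrow>
    rec_eval (PrimRec f g) (Suc n # xs) y"
| mu: "rec_eval f (n # xs) 0 \<Longrightarrow> (\<forall>i<n. \<exists>m>0. rec_eval f (i # xs) m) \<Longrightarrow>
    rec_eval (Mu f) xs n"

inductive_cases rec_eval_elims:
  "rec_eval Zero xs y"
  "rec_eval Succ xs y"
  "rec_eval (Proj i) xs y"
  "rec_eval (Comp f gs) xs y"
  "rec_eval (PrimRec f g) (0 # xs) y"
  "rec_eval (PrimRec f g) (Suc n # xs) y"
  "rec_eval (Mu f) xs y"

lemma rec_eval_deterministic: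
  "rec_eval f xs y \<Longrightarrow> rec_eval f xs y' \<Longrightarrow> y = y'"
proof (induction arbitrary: y' rule: rec_eval.induct)
  case (zero xs)
  then show ?case by (blast elim: rec_eval_elims(1))
next
  case (succ x)
  then show ?case by (blast elim: rec_eval_elims(2))
next
  case (proj i xs)
  then show ?case by (blast elim: rec_eval_elims(3))
next
  case (comp xs gs ys f y)
  from comp.prems obtain ys'
    where ys': "list_all2 (\<lambda>g y. rec_eval g xs y) gs ys'" "rec_eval f ys' y'"
    by (blast elim: rec_eval_elims(4))
  have "ys = ys'"
    using comp.IH(1) ys'(1) by (simp add: list_all2_conv_all_nth list_eq_iff_nth_eq)
  then show ?case using comp.IH(2) ys'(2) by blast
next
  case (primrec_0 f xs y g)
  then show ?case by (blast elim: rec_eval_elims(5))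
next
  case (primrec_Suc f g n xs r y)
  then show ?case by (blast elim: rec_eval_elims(6))
next
  case (mu f n xs)
  from mu.prems have *: "rec_eval f (y' # xs) 0" "\<forall>i<y'. \<exists>m>0. rec_eval f (i # xs) m"
    by (blast elim: rec_eval_elims(7))+
  show ?case
    using mu.IH * by (metis less_not_refl linorder_neqE_nat)
qed

text \<open>
  The problem of deciding, for instances \<open>x \<in> I\<close>, whether \<open>x \<in> Y\<close>, where instances are presented
  to the algorithm as numbers through \<open>code\<close>. Nothing is required on numbers that are not codes
  of instances.
\<close>

definition decidable :: "('a \<Rightarrow> nat) \<Rightarrow> 'a set \<Rightarrow> 'a set \<Rightarrow> bool" where
  "decidable code I Y \<longleftrightarrow> (\<exists>f. \<forall>x\<in>I. rec_eval f [code x] (if x \<in> Y then 1 else 0))"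

fun term_code :: "lz_term \<Rightarrow> nat" where
  "term_code TZero = prod_encode (0, 0)"
| "term_code TOne = prod_encode (1, 0)"
| "term_code TZ = prod_encode (2, 0)"
| "term_code (TVar i) = prod_encode (3, i)"
| "term_code (TAdd s t) = prod_encode (4, prod_encode (term_code s, term_code t))"
| "term_code (TMul s t) = prod_encode (5, prod_encode (term_code s, term_code t))"

fun matrix_code :: "lz_matrix \<Rightarrow> nat" where
  "matrix_code (Eq s t) = prod_encode (0, prod_encode (term_code s, term_code t))"
| "matrix_code (And p q) = prod_encode (1, prod_encode (matrix_code p, matrix_code q))"
| "matrix_code (Or p q) = prod_encode (2, prod_encode (matrix_code p, matrix_code q))"

fun formula_code :: "pe_formula \<Rightarrow> nat" where
  "formula_code (Exists is p) = prod_encode (list_encode is, matrix_code p)"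

definition monomial_code :: "int poly \<times> nat list \<Rightarrow> nat" where
  "monomial_code = (\<lambda>(c, e). prod_encode (list_encode (map int_encode (coeffs c)), list_encode e))"

definition system_code :: "zpoly list \<Rightarrow> nat" where
  "system_code S = list_encode (map (\<lambda>p. list_encode (map monomial_code p)) S)"

lemma term_code_inject: "term_code s = term_code t \<Longrightarrow> s = t"
  by (induction s arbitrary: t; case_tac t) simp_all

lemma matrix_code_inject: "matrix_code p = matrix_code q \<Longrightarrow> p = q"
  by (induction p arbitrary: q; case_tac q) (simp_all add: term_code_inject)

lemma inj_formula_code: "inj formula_code"
proof (rule injI)
  fix F G assume "formula_code F = formula_code G"
  then show "F = G"
    by (cases F; cases G) (auto simp: list_encode_eq dest: matrix_code_inject)
qed

lemma inj_system_code: "inj system_code"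
proof -
  have "inj monomial_code"
    by (auto intro!: injI
        simp: monomial_code_def coeffs_eq_iff list_encode_eq inj_map_eq_map[OF inj_int_encode])
  then have "inj (\<lambda>p. list_encode (map monomial_code p))"
    by (auto intro!: injI simp: list_encode_eq inj_map_eq_map)
  then show ?thesis
    by (auto intro!: injI simp: system_code_def list_encode_eq inj_map_eq_map)
qed

end

theory Submission
  imports Defs "HOL-Number_Theory.Cong"
begin

text \<open>
  Definability of \<open>\<int>\<close>. By little Picard, \<open>f\<^sup>3 + g\<^sup>3 = 1\<close> forces \<open>f\<close> to be constant. For a
  solution of \<open>X\<^sup>2 - (z\<^sup>2 - 1) Y\<^sup>2 = 1\<close> the function \<open>U(s) = X(cosh s) + sinh s Y(cosh s)\<close> has no
  zeros and its logarithmic derivative is \<open>q(cosh s)\<close> with \<open>q\<close> entire. Finite order bounds \<open>log |U|\<close>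
  by a power of \<open>exp |Re s|\<close>, so that \<open>q\<close> is a polynomial by Borel--Caratheodory. Then \<open>X\<close> solves a
  linear differential equation of order two, hence is a polynomial, \<open>q\<close> is an integer \<open>n\<close>,
  \<open>U(s) = exp (n s)\<close>, and \<open>Y(1) = n\<close> when \<open>X(1) = 1\<close>.

  Undecidability. Evaluating at \<open>z = (b + 1/b) / 2\<close>, that is, reducing modulo \<open>z - (b + 1/b) / 2\<close>,
  the solutions above define exponentiation \<open>b\<^sup>n\<close>. Therefore only the Davis--Putnam--Robinson part of
  the theorem on Diophantine sets is needed: graphs of partial recursive functions have Davis normal
  form \<open>\<exists>y. \<forall>k\<le>y. \<exists>u. F = G\<close> with polynomials \<open>F\<close> and \<open>G\<close>, and the bounded quantifier can be
  eliminated with exponentials. A decision procedure \<open>D\<close> would be contradicted by the formula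
  expressing that \<open>D\<close> rejects the formula with number \<open>n\<close> at the argument \<open>n\<close>, taken at its own number.
\<close>

section \<open>Relations of Davis normal form\<close>

text \<open>Pell's equation has transcendental solutions of finite order: for any complex
  \<open>c\<close>, \<open>U(s) = exp (c * sinh s)\<close> comes from
  \<open>X(z) = cosh (c * sqrt (z * z - 1))\<close>, which has \<open>X(1) = 1\<close> and
  \<open>Y(1) = c\<close>. Such solutions would let every complex number pass the test for integers.
  They satisfy linear differential equations with polynomial coefficients, and this is why the
  hypothesis speaks of holonomic functions. The substitution \<open>z = cosh s\<close> makes the
  square root of \<open>z * z - 1\<close> the entire function \<open>sinh s\<close>, and
  \<open>s \<mapsto> - s\<close> exchanges its two branches. Hence Pell's equation reads
  \<open>U(s) * U(- s) = 1\<close>, which excludes zeros and turns upper bounds for \<open>U\<close>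
  into lower ones. A solution pair only sees the value of \<open>f\<close> at the point 1, so that
  \<open>f\<close> must be made constant by a separate equation. Positive existential formulas offer
  no universal quantifier. Unbounded search and primitive recursion do need bounded ones; the normal
  form collects them into a single one, so that one elimination is enough.\<close>

inductive polyfun :: "((nat \<Rightarrow> nat) \<Rightarrow> nat) \<Rightarrow> bool" where
  polyfun_var: "polyfun (\<lambda>v. v i)"
| polyfun_const: "polyfun (\<lambda>v. c)"
| polyfun_add: "polyfun F \<Longrightarrow> polyfun G \<Longrightarrow> polyfun (\<lambda>v. F v + G v)"
| polyfun_mult: "polyfun F \<Longrightarrow> polyfun G \<Longrightarrow> polyfun (\<lambda>v. F v * G v)"

lemma polyfun_subst: "polyfun F \<Longrightarrow> (\<And>i. polyfun (S i)) \<Longrightarrow> polyfun (\<lambda>v. F (\<lambda>i. S i v))"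
  by (induction rule: polyfun.induct) (auto intro: polyfun.intros)

lemma polyfun_Suc: "polyfun F \<Longrightarrow> polyfun (\<lambda>v. Suc (F v))"
  using polyfun_add[OF _ polyfun_const[of 1], of F] by simp

lemma polyfun_if: "(P \<Longrightarrow> polyfun F) \<Longrightarrow> (\<not> P \<Longrightarrow> polyfun G) \<Longrightarrow> polyfun (\<lambda>v. if P then F v else G v)"
  by (cases P) auto

lemmas polyfun_rules = polyfun_var polyfun_const polyfun_add polyfun_mult polyfun_Suc polyfun_if

lemma polyfun_shift: "polyfun F \<Longrightarrow> polyfun (\<lambda>v. F (\<lambda>i. v (Suc i)))"
  using polyfun_subst[of F "\<lambda>i v. v (Suc i)"] polyfun_var by blast

lemma polyfun_mono: "polyfun F \<Longrightarrow> (\<And>i. x i \<le> y i) \<Longrightarrow> F x \<le> F y"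
  by (induction rule: polyfun.induct) (auto intro: add_mono mult_mono)

lemma polyfun_cong: "polyfun F \<Longrightarrow> (\<And>i. [x i = y i] (mod m)) \<Longrightarrow> [F x = F y] (mod m)"
  by (induction rule: polyfun.induct) (auto intro: cong_add cong_mult)

definition glue :: "nat \<Rightarrow> (nat \<Rightarrow> 'a) \<Rightarrow> (nat \<Rightarrow> 'a) \<Rightarrow> nat \<Rightarrow> 'a" where
  "glue m u v = (\<lambda>i. if i < m then u i else v (i - m))"

lemma glue_0 [simp]: "glue 0 u v = v"
  by (simp add: glue_def)

text \<open>Witnesses come first and parameters after them, so quantifying the parameter with index
  0 appends it to the block of witnesses as number \<open>m\<close>.\<close>

lemma glue_Suc: "glue m u (case_nat (u m) v) = glue (Suc m) u v"
  by (auto simp: glue_def fun_eq_iff less_Suc_eq split: nat.splits)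
     (metis Suc_diff_Suc linorder_neqE_nat nat.inject old.nat.exhaust)

section \<open>Diophantine relations\<close>

definition diophantine :: "((nat \<Rightarrow> nat) \<Rightarrow> bool) \<Rightarrow> bool" where
  "diophantine R \<longleftrightarrow> (\<exists>m F G. polyfun F \<and> polyfun G \<and>
     (\<forall>v. R v \<longleftrightarrow> (\<exists>u. F (glue m u v) = G (glue m u v))))"

lemma diophantine_eq: "polyfun F \<Longrightarrow> polyfun G \<Longrightarrow> diophantine (\<lambda>v. F v = G v)"
  unfolding diophantine_def by (rule exI[of _ 0]) auto

lemma diophantine_subst:
  assumes "diophantine R" "\<And>i. polyfun (S i)"
  shows "diophantine (\<lambda>v. R (\<lambda>i. S i v))"
proof -
  obtain m F G where FG: "polyfun F" "polyfun G"
    and R: "\<And>v. R v \<longleftrightarrow> (\<exists>u. F (glue m u v) = G (glue m u v))"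
    using assms(1) unfolding diophantine_def by metis
  define T where "T = (\<lambda>i x. if i < m then x i else S (i - m) (\<lambda>j. x (j + m)))"
  have T: "polyfun (T i)" for i
    unfolding T_def by (intro polyfun_if polyfun_var) (rule polyfun_subst[OF assms(2)],
        rule polyfun_var)
  have e: "(\<lambda>i. T i (glue m u v)) = glue m u (\<lambda>i. S i v)" for u v
    by (auto simp: T_def glue_def)
  have "polyfun (\<lambda>x. F (\<lambda>i. T i x))" "polyfun (\<lambda>x. G (\<lambda>i. T i x))"
    using polyfun_subst[OF FG(1), of T, OF T] polyfun_subst[OF FG(2), of T, OF T] by auto
  then show ?thesis unfolding diophantine_def R
    by (intro exI[of _ m] exI[of _ "\<lambda>x. F (\<lambda>i. T i x)"] exI[of _ "\<lambda>x. G (\<lambda>i. T i x)"])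
       (auto simp: e)
qed

lemma diophantine_ex:
  assumes "diophantine (\<lambda>v. P (v 0) (\<lambda>i. v (Suc i)))"
  shows "diophantine (\<lambda>v. \<exists>x. P x v)"
proof -
  obtain m F G where FG: "polyfun F" "polyfun G"
    and R: "\<And>v. P (v 0) (\<lambda>i. v (Suc i)) \<longleftrightarrow> (\<exists>u. F (glue m u v) = G (glue m u v))"
    using assms unfolding diophantine_def by metis
  have "P x v \<longleftrightarrow> (\<exists>u. F (glue m u (case_nat x v)) = G (glue m u (case_nat x v)))" for x v
    using R[of "case_nat x v"] by simp
  moreover have "(\<exists>x u. F (glue m u (case_nat x v)) = G (glue m u (case_nat x v)))
    \<longleftrightarrow> (\<exists>u. F (glue (Suc m) u v) = G (glue (Suc m) u v))" for v
  proof
    assume "\<exists>x u. F (glue m u (case_nat x v)) = G (glue m u (case_nat x v))"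
    then obtain x u where "F (glue m u (case_nat x v)) = G (glue m u (case_nat x v))" by blast
    moreover have "glue m u (case_nat x v) = glue (Suc m) (u(m := x)) v"
      by (subst glue_Suc[symmetric]) (auto simp: glue_def)
    ultimately show "\<exists>u. F (glue (Suc m) u v) = G (glue (Suc m) u v)" by metis
  qed (metis glue_Suc)
  ultimately show ?thesis unfolding diophantine_def using FG by metis
qed

text \<open>Conjunction and disjunction share this proof, because both commute with existential
  quantifiers over independent witnesses. The joint block has \<open>m + m'\<close> witnesses, and
  \<open>T\<close> and \<open>T'\<close> select the two parts.\<close>

lemma diophantine_combine:
  assumes "diophantine R1" "diophantine R2" "\<And>F G F' G'. polyfun F \<Longrightarrow> polyfun G \<Longrightarrow> polyfun F'
      \<Longrightarrow> polyfun G' \<Longrightarrow>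
     \<exists>H K. polyfun H \<and> polyfun K \<and> (\<forall>x. H x = K x \<longleftrightarrow> op (F x = G x) (F' x = G' x))"
    and op: "\<And>(A :: (nat \<Rightarrow> nat) \<Rightarrow> bool) (B :: (nat \<Rightarrow> nat) \<Rightarrow> bool).
       op (\<exists>x. A x) (\<exists>x. B x) \<longleftrightarrow> (\<exists>x y. op (A x) (B y))"
  shows "diophantine (\<lambda>v. op (R1 v) (R2 v))"
proof -
  obtain m F G where FG: "polyfun F" "polyfun G"
    and R: "\<And>v. R1 v \<longleftrightarrow> (\<exists>u. F (glue m u v) = G (glue m u v))"
    using assms(1) unfolding diophantine_def by metis
  obtain m' F' G' where FG': "polyfun F'" "polyfun G'"
    and R': "\<And>v. R2 v \<longleftrightarrow> (\<exists>u. F' (glue m' u v) = G' (glue m' u v))"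
    using assms(2) unfolding diophantine_def by metis
  define T where "T = (\<lambda>i (x::nat\<Rightarrow>nat). if i < m then x i else x (i + m'))"
  define T' where "T' = (\<lambda>i (x::nat\<Rightarrow>nat). x (i + m))"
  have T: "polyfun (T i)" "polyfun (T' i)" for i
    unfolding T_def T'_def by (intro polyfun_if polyfun_var)+
  have e: "(\<lambda>i. T i (glue (m+m') u v)) = glue m u v" for u v
    by (auto simp: T_def glue_def)
  have e': "(\<lambda>i. T' i (glue (m+m') u v)) = glue m' (\<lambda>i. u (i+m)) v" for u v
    by (auto simp: T'_def glue_def)
  obtain H K where HK: "polyfun H" "polyfun K" "\<And>x. H x = K x \<longleftrightarrow> op
     (F (\<lambda>i. T i x) = G (\<lambda>i. T i x)) (F' (\<lambda>i. T' i x) = G' (\<lambda>i. T' i x))"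
    using assms(3)[OF polyfun_subst[OF FG(1), of T, OF T(1)] polyfun_subst[OF FG(2), of T, OF T(1)]
      polyfun_subst[OF FG'(1), of T', OF T(2)] polyfun_subst[OF FG'(2), of T', OF T(2)]] by blast
  have "op (R1 v) (R2 v) \<longleftrightarrow> (\<exists>u. H (glue (m+m') u v) = K (glue (m+m') u v))" for v
  proof -
    have "op (R1 v) (R2 v) \<longleftrightarrow> (\<exists>u u'. op (F (glue m u v) = G (glue m u v))
        (F' (glue m' u' v) = G' (glue m' u' v)))"
      unfolding R R'
      using op[of "\<lambda>u. F (glue m u v) = G (glue m u v)"
          "\<lambda>u. F' (glue m' u v) = G' (glue m' u v)"] by simp
    also have "\<dots> \<longleftrightarrow> (\<exists>u. op (F (glue m u v) = G (glue m u v))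
        (F' (glue m' (\<lambda>i. u (i+m)) v) = G' (glue m' (\<lambda>i. u (i+m)) v)))" (is "_ \<longleftrightarrow> ?R")
    proof
      assume "\<exists>u u'. op (F (glue m u v) = G (glue m u v))
        (F' (glue m' u' v) = G' (glue m' u' v))"
      then obtain u u' where u: "op (F (glue m u v) = G (glue m u v))
        (F' (glue m' u' v) = G' (glue m' u' v))" by blast
      define w where "w = glue m u u'"
      have "glue m u v = glue m w v" "(\<lambda>i. w (i + m)) = u'"
        by (auto simp: w_def glue_def)
      with u have "op (F (glue m w v) = G (glue m w v))
        (F' (glue m' (\<lambda>i. w (i+m)) v) = G' (glue m' (\<lambda>i. w (i+m)) v))" by simp
      then show ?R by blast
    qed blast
    finally show ?thesis by (simp add: HK(3) e e')
  qed
  with HK show ?thesis unfolding diophantine_def by blast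
qed

lemma sum_squares_eq_nat: "(s::nat) * s + t * t = 2 * s * t \<longleftrightarrow> s = t"
proof
  assume "s * s + t * t = 2 * s * t"
  then have "int (s * s + t * t) = int (2 * s * t)" by simp
  then have "int s * int s + int t * int t = 2 * int s * int t" by simp
  then have "(int s - int t)\<^sup>2 = 0" by (simp add: power2_eq_square algebra_simps)
  then show "s = t" by simp
qed simp

lemma diophantine_conj:
  assumes "diophantine R1" "diophantine R2"
  shows "diophantine (\<lambda>v. R1 v \<and> R2 v)"
proof (rule diophantine_combine[OF assms])
  fix F G F' G' assume polyfun: "polyfun F" "polyfun G" "polyfun F'" "polyfun G'"
  have am: "2 * s * t \<le> s * s + t * t" for s t :: nat
  proof -
    have "0 \<le> (int s - int t)\<^sup>2" by simp
    then have "2 * int s * int t \<le> int s * int s + int t * int t"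
      by (simp add: power2_eq_square algebra_simps)
    then have "int (2 * s * t) \<le> int (s * s + t * t)" by simp
    then show ?thesis by (simp only: of_nat_le_iff)
  qed
  \<comment> \<open>\<open>(a - b)\<^sup>2 + (c - d)\<^sup>2 = 0\<close> with the negative terms
    moved to the other side, because \<open>polyfun\<close> has no subtraction.\<close>
  have "a * a + b * b + (c * c + d * d) = 2 * a * b + 2 * c * d \<longleftrightarrow> a = b \<and> c = d" for a b c d :: nat
  proof
    assume "a * a + b * b + (c * c + d * d) = 2 * a * b + 2 * c * d"
    then have "a * a + b * b = 2 * a * b" "c * c + d * d = 2 * c * d"
      using am[of a b] am[of c d] by linarith+
    then show "a = b \<and> c = d" by (simp only: sum_squares_eq_nat)
  qed auto
  note eq = this
  show "\<exists>H K. polyfun H \<and> polyfun K \<and> (\<forall>x. H x = K x \<longleftrightarrow> (F x = G x \<and> F' x = G' x))"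
    by (rule exI[of _ "\<lambda>x. F x * F x + G x * G x + (F' x * F' x + G' x * G' x)"],
        rule exI[of _ "\<lambda>x. 2 * F x * G x + 2 * F' x * G' x"]) (intro conjI allI polyfun_rules polyfun eq)
qed auto

lemma diophantine_disj:
  assumes "diophantine R1" "diophantine R2"
  shows "diophantine (\<lambda>v. R1 v \<or> R2 v)"
proof (rule diophantine_combine[OF assms])
  fix F G F' G' assume polyfun: "polyfun F" "polyfun G" "polyfun F'" "polyfun G'"
  \<comment> \<open>\<open>(a - b) * (c - d) = 0\<close>, again with the negative terms moved to the
    other side.\<close>
  have "a * c + b * d = a * d + b * c \<longleftrightarrow> a = b \<or> c = d" for a b c d :: nat
  proof -
    have "a * c + b * d = a * d + b * c \<longleftrightarrow> int a * int c + int b * int d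
        = int a * int d + int b * int c"
      unfolding of_nat_mult[symmetric] of_nat_add[symmetric] of_nat_eq_iff ..
    also have "\<dots> \<longleftrightarrow> (int a - int b) * (int c - int d) = 0" by (simp add: algebra_simps)
    finally show ?thesis by simp
  qed
  note eq = this
  show "\<exists>H K. polyfun H \<and> polyfun K \<and> (\<forall>x. H x = K x \<longleftrightarrow> (F x = G x \<or> F' x = G' x))"
    by (rule exI[of _ "\<lambda>x. F x * F' x + G x * G' x"],
        rule exI[of _ "\<lambda>x. F x * G' x + G x * F' x"]) (intro conjI allI polyfun_rules polyfun eq)
qed auto

lemma diophantine_le: "polyfun F \<Longrightarrow> polyfun G \<Longrightarrow> diophantine (\<lambda>v. F v \<le> G v)"
  unfolding le_iff_add
  by (intro diophantine_ex diophantine_eq polyfun_add polyfun_var) (erule polyfun_shift)+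

lemma diophantine_less: "polyfun F \<Longrightarrow> polyfun G \<Longrightarrow> diophantine (\<lambda>v. F v < G v)"
  unfolding less_eq_Suc_le by (intro diophantine_le polyfun_Suc)

lemma diophantine_pair:
  assumes "polyfun F" "polyfun G" "polyfun H"
  shows "diophantine (\<lambda>v. F v = prod_encode (G v, H v))"
proof -
  \<comment> \<open>Doubling clears the division by 2 in the triangular number.\<close>
  have "a = prod_encode (b, c) \<longleftrightarrow> 2 * a = (b+c) * Suc (b+c) + 2 * b" for a b c
    by (auto simp: prod_encode_def triangle_def)
  then show ?thesis using assms by (auto intro!: diophantine_eq polyfun_rules)
qed

lemma diophantine_mod:
  assumes "polyfun F" "polyfun G" "polyfun H"
  shows "diophantine (\<lambda>v. F v = G v mod Suc (H v))"
proof -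
  have "a = b mod Suc c \<longleftrightarrow> (\<exists>q. b = q * Suc c + a \<and> a \<le> c)" for a b c :: nat
  proof (intro iffI)
    assume "a = b mod Suc c"
    then show "\<exists>q. b = q * Suc c + a \<and> a \<le> c"
      using div_mult_mod_eq[of b "Suc c"] mod_less_divisor[of "Suc c" b]
      by (intro exI[of _ "b div Suc c"]) linarith
  next
    assume "\<exists>q. b = q * Suc c + a \<and> a \<le> c"
    then show "a = b mod Suc c" using mod_mult_self3[of _ "Suc c" a]
        by (metis le_imp_less_Suc mod_less)
  qed
  then show ?thesis using assms
    by (simp only:) (intro diophantine_ex diophantine_conj diophantine_eq diophantine_le polyfun_rules; erule polyfun_shift)
qed

section \<open>Finite sequences and Goedel's beta function\<close>

definition beta :: "nat \<Rightarrow> nat \<Rightarrow> nat \<Rightarrow> nat" where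
  "beta c d i = c mod Suc (Suc i * d)"

lemma diophantine_beta:
  "polyfun F \<Longrightarrow> polyfun G \<Longrightarrow> polyfun H \<Longrightarrow> polyfun K \<Longrightarrow> diophantine (\<lambda>v. F v = beta (G v) (H v) (K v))"
  unfolding beta_def by (intro diophantine_mod polyfun_rules)

text \<open>Take \<open>d = s!\<close> with \<open>s\<close> at least \<open>n\<close> and at least
  all values. A common prime of two moduli divides \<open>(j - i) * d\<close>, hence
  \<open>d\<close> because \<open>j - i\<close> divides \<open>s!\<close>, hence 1. So the Chinese
  remainder theorem applies, and the moduli are large enough for the remainders to be the values
  themselves.\<close>

lemma beta_exists: "\<exists>c d. \<forall>i<n. beta c d i = y i"
proof -
  define s where "s = n + Max (insert 0 (y ` {..<n}))"
  define d where "d = (fact s :: nat)"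
  have y: "y i \<le> s" if "i < n" for i
  proof -
    have "y i \<le> Max (insert 0 (y ` {..<n}))" using that by (intro Max_ge) auto
    then show ?thesis by (simp add: s_def)
  qed
  have cop: "coprime (Suc (Suc i * d)) (Suc (Suc j * d))" if "i < n" "j < n" "i \<noteq> j" for i j
  proof -
    have *: "coprime (Suc (Suc i * d)) (Suc (Suc j * d))" if ij: "i < j" "j < n" for i j
    proof (rule ccontr)
      assume "\<not> ?thesis"
      then obtain p where p: "prime p" "p dvd Suc (Suc i * d)" "p dvd Suc (Suc j * d)"
        unfolding coprime_iff_gcd_eq_1 using prime_factor_nat by (metis gcd_nat.bounded_iff)
      have "Suc (Suc j * d) - Suc (Suc i * d) = (j - i) * d"
        by (simp add: diff_mult_distrib)
      then have "p dvd (j - i) * d" using p by (metis dvd_diff_nat)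
      then have "p dvd (j - i) \<or> p dvd d" using p by (simp add: prime_dvd_mult_iff)
      moreover have "j - i dvd d" unfolding d_def
        using ij by (intro dvd_fact) (auto simp: s_def)
      ultimately have "p dvd d" by (meson dvd_trans)
      then have "p dvd Suc i * d" by simp
      with p(2) have "p dvd 1"
        using dvd_add_right_iff[of p "Suc i * d" 1] by simp
      with p(1) show False by simp
    qed
    from that(3) consider "i < j" | "j < i" by linarith
    then show ?thesis using *[of i j] *[of j i] that by cases (simp_all add: coprime_commute)
  qed
  obtain c where c: "\<forall>i\<in>{..<n}. [c = y i] (mod Suc (Suc i * d))"
    using chinese_remainder_nat[of "{..<n}" "\<lambda>i. Suc (Suc i * d)" y] cop
    by (meson finite_lessThan lessThan_iff)
  have "beta c d i = y i" if "i < n" for i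
  proof -
    have "y i \<le> d" using y[OF that] fact_ge_self[of s] by (auto simp: d_def)
    then have "y i < Suc (Suc i * d)" by simp
    moreover have "c mod Suc (Suc i * d) = y i mod Suc (Suc i * d)"
      using bspec[OF c, of i] that unfolding cong_def by blast
    ultimately show ?thesis by (simp add: beta_def)
  qed
  then show ?thesis by blast
qed

section \<open>Closure properties of Davis normal form\<close>

definition davis :: "((nat \<Rightarrow> nat) \<Rightarrow> bool) \<Rightarrow> bool" where
  "davis R \<longleftrightarrow> (\<exists>Q. diophantine Q \<and> (\<forall>v. R v \<longleftrightarrow> (\<exists>y. \<forall>k\<le>y. Q (case_nat y (case_nat k v)))))"

lemma davis_I:
  "diophantine Q \<Longrightarrow> (\<And>v. R v \<longleftrightarrow> (\<exists>y. \<forall>k\<le>y. Q (case_nat y (case_nat k v)))) \<Longrightarrow> davis R"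
  unfolding davis_def by blast

lemma davis_E:
  assumes "davis R"
  obtains Q where "diophantine Q" "\<And>v. R v \<longleftrightarrow> (\<exists>y. \<forall>k\<le>y. Q (case_nat y (case_nat k v)))"
  using assms unfolding davis_def by blast

lemma davis_diophantine:
  assumes "diophantine R" shows "davis R"
  by (rule davis_I[OF diophantine_subst[OF assms, of "\<lambda>i v. v (Suc (Suc i))", OF polyfun_var]]) auto

lemma davis_subst:
  assumes "davis R" "\<And>i. polyfun (S i)"
  shows "davis (\<lambda>v. R (\<lambda>i. S i v))"
proof -
  obtain Q where Q: "diophantine Q" "\<And>v. R v \<longleftrightarrow> (\<exists>y. \<forall>k\<le>y. Q (case_nat y (case_nat k v)))"
    using assms by (auto elim: davis_E)
  define T where "T = (\<lambda>i x. if i < 2 then x i else S (i - 2) (\<lambda>j. x (j + 2)))"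
  have "polyfun (T i)" for i
    unfolding T_def by (intro polyfun_if polyfun_var) (rule polyfun_subst[OF assms(2)],
        rule polyfun_var)
  moreover have "(\<lambda>i. T i (case_nat y (case_nat k v))) = case_nat y (case_nat k (\<lambda>i. S i v))"
      for y k v
    by (auto simp: T_def fun_eq_iff numeral_2_eq_2 split: nat.splits)
  ultimately show ?thesis
    by (intro davis_I[OF diophantine_subst[OF Q(1), of T]]) (auto simp: Q(2))
qed

text \<open>The new \<open>y\<close> is the pair of the two old ones. A pair is at least as large as
  its components, so the common bounded quantifier reaches far enough; where it goes too far, the
  guards \<open>y1 < k\<close> and \<open>y2 < k\<close> make the claim trivial.\<close>

lemma davis_conj:
  assumes "davis R1" "davis R2"
  shows "davis (\<lambda>v. R1 v \<and> R2 v)"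
proof -
  obtain Q1 where Q1: "diophantine Q1" "\<And>v. R1 v \<longleftrightarrow> (\<exists>y. \<forall>k\<le>y. Q1 (case_nat y (case_nat k v)))"
    using assms by (auto elim: davis_E)
  obtain Q2 where Q2: "diophantine Q2" "\<And>v. R2 v \<longleftrightarrow> (\<exists>y. \<forall>k\<le>y. Q2 (case_nat y (case_nat k v)))"
    using assms by (auto elim: davis_E)
  let ?Q = "\<lambda>w. \<exists>y1 y2. w 0 = prod_encode (y1, y2)
      \<and> (y1 < w 1 \<or> Q1 (\<lambda>i. if i = 0 then y1 else w i))
      \<and> (y2 < w 1 \<or> Q2 (\<lambda>i. if i = 0 then y2 else w i))"
  have D: "diophantine ?Q"
    by (intro diophantine_ex diophantine_conj diophantine_disj diophantine_pair diophantine_less diophantine_subst[OF Q1(1)] diophantine_subst[OF Q2(1)]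
        polyfun_rules)
  have s: "(\<lambda>i. if i = 0 then y1 else case i of 0 \<Rightarrow> y | Suc j \<Rightarrow> f j) = case_nat y1 f"
    for y1 y :: nat and f
    by (auto split: nat.splits)
  show ?thesis
  proof (rule davis_I[OF D])
    fix v
    show "(R1 v \<and> R2 v) \<longleftrightarrow> (\<exists>y. \<forall>k\<le>y. ?Q (case_nat y (case_nat k v)))"
    proof
      assume "R1 v \<and> R2 v"
      then obtain y1 y2 where "\<forall>k\<le>y1. Q1 (case_nat y1 (case_nat k v))"
        "\<forall>k\<le>y2. Q2 (case_nat y2 (case_nat k v))" unfolding Q1 Q2 by blast
      then have "y1 < k \<or> Q1 (case_nat y1 (case_nat k v))"
        "y2 < k \<or> Q2 (case_nat y2 (case_nat k v))" for k by (meson not_le)+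
      then have "\<forall>k\<le>prod_encode (y1,y2). ?Q (case_nat (prod_encode (y1,y2)) (case_nat k v))"
        unfolding s by (intro allI impI) (rule exI[of _ y1], rule exI[of _ y2], simp)
      then show "\<exists>y. \<forall>k\<le>y. ?Q (case_nat y (case_nat k v))" by blast
    next
      assume "\<exists>y. \<forall>k\<le>y. ?Q (case_nat y (case_nat k v))"
      then obtain y where y: "\<forall>k\<le>y. ?Q (case_nat y (case_nat k v))" by blast
      obtain y1 y2 where e: "y = prod_encode (y1, y2)" by (metis prod_decode_inverse surj_pair)
      have "Q1 (case_nat y1 (case_nat k v))" if "k \<le> y1" for k
        using y[rule_format, of k] that le_prod_encode_1[of y1 y2] unfolding s
        by (auto simp: e)
      moreover have "Q2 (case_nat y2 (case_nat k v))" if "k \<le> y2" for k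
        using y[rule_format, of k] that le_prod_encode_2[of y2 y1] unfolding s
        by (auto simp: e)
      ultimately show "R1 v \<and> R2 v" unfolding Q1 Q2 by blast
    qed
  qed
qed

text \<open>The witness \<open>x\<close> is moved past the bounded quantifier by storing it in
  \<open>y\<close>, which all \<open>k\<close> share.\<close>

lemma davis_ex:
  assumes "davis (\<lambda>v. P (v 0) (\<lambda>i. v (Suc i)))"
  shows "davis (\<lambda>v. \<exists>x. P x v)"
proof -
  obtain Q where Q: "diophantine Q"
    "\<And>v. P (v 0) (\<lambda>i. v (Suc i)) \<longleftrightarrow> (\<exists>y. \<forall>k\<le>y. Q (case_nat y (case_nat k v)))"
    using assms by (auto elim: davis_E)
  have P: "P x v \<longleftrightarrow> (\<exists>y. \<forall>k\<le>y. Q (case_nat y (case_nat k (case_nat x v))))" for x v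
    using Q(2)[of "case_nat x v"] by simp
  let ?Q = "\<lambda>w. \<exists>x y. w 0 = prod_encode (x, y)
      \<and> (y < w 1 \<or> Q (\<lambda>i. if i = 0 then y else if i = 1 then w 1 else if i
      = 2 then x else w (i - 1)))"
  have D: "diophantine ?Q"
    by (intro diophantine_ex diophantine_conj diophantine_disj diophantine_pair diophantine_less diophantine_subst[OF Q(1)] polyfun_rules)
  have s: "(\<lambda>i. if i = 0 then y else if i
      = 1 then (case 1 of 0 \<Rightarrow> z | Suc j \<Rightarrow> case j of 0 \<Rightarrow> k | Suc j \<Rightarrow> v j)
     else if i = 2 then x else case i - 1 of 0 \<Rightarrow> z | Suc j \<Rightarrow> case j of 0 \<Rightarrow> k | Suc j \<Rightarrow> v j)
     = case_nat y (case_nat k (case_nat x v))" for x y z k :: nat and v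
    by (auto split: nat.splits simp: fun_eq_iff)
  show ?thesis
  proof (rule davis_I[OF D])
    fix v
    show "(\<exists>x. P x v) \<longleftrightarrow> (\<exists>y. \<forall>k\<le>y. ?Q (case_nat y (case_nat k v)))"
    proof
      assume "\<exists>x. P x v"
      then obtain x y where "\<forall>k\<le>y. Q (case_nat y (case_nat k (case_nat x v)))"
        unfolding P by blast
      then have "y < k \<or> Q (case_nat y (case_nat k (case_nat x v)))" for k by (meson not_le)
      then have "\<forall>k\<le>prod_encode (x,y). ?Q (case_nat (prod_encode (x,y)) (case_nat k v))"
        unfolding s by (intro allI impI) (rule exI[of _ x], rule exI[of _ y], simp)
      then show "\<exists>y. \<forall>k\<le>y. ?Q (case_nat y (case_nat k v))" by blast
    next
      assume "\<exists>y. \<forall>k\<le>y. ?Q (case_nat y (case_nat k v))"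
      then obtain Y where Y: "\<forall>k\<le>Y. ?Q (case_nat Y (case_nat k v))" by blast
      obtain x y where e: "Y = prod_encode (x, y)" by (metis prod_decode_inverse surj_pair)
      have "Q (case_nat y (case_nat k (case_nat x v)))" if "k \<le> y" for k
        using Y[rule_format, of k] that le_prod_encode_2[of y x] unfolding s
        by (auto simp: e)
      then show "\<exists>x. P x v" unfolding P by blast
    qed
  qed
qed

lemma euclid_unique:
  fixes m :: nat
  assumes "k < m" "k' < m" "i * m + k = i' * m + k'"
  shows "i = i' \<and> k = k'"
proof -
  have "(i * m + k) div m = i" "(i' * m + k') div m = i'" using assms(1,2) by simp_all
  with assms(3) have "i = i'" by metis
  with assms(3) show ?thesis by simp
qed

text \<open>The bounds \<open>y i\<close> chosen for the various \<open>i\<close> are collected in a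
  beta code \<open>(c, d)\<close> with a common bound \<open>M\<close>. The two bounded quantifiers
  over \<open>i\<close> and \<open>k \<le> M\<close> are then merged into one over
  \<open>j = i * Suc M + k\<close>, from which \<open>i\<close> and \<open>k\<close> are recovered
  by division with remainder.\<close>

lemma davis_ball:
  assumes "davis (\<lambda>v. P (v 0) (\<lambda>i. v (Suc i)))" and N: "polyfun N"
  shows "davis (\<lambda>v. \<forall>i<N v. P i v)"
proof -
  obtain Q where Q: "diophantine Q"
    "\<And>v. P (v 0) (\<lambda>i. v (Suc i)) \<longleftrightarrow> (\<exists>y. \<forall>k\<le>y. Q (case_nat y (case_nat k v)))"
    using assms by (auto elim: davis_E)
  have P: "P x v \<longleftrightarrow> (\<exists>y. \<forall>k\<le>y. Q (case_nat y (case_nat k (case_nat x v))))" for x v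
    using Q(2)[of "case_nat x v"] by simp
  define B where "B = (\<lambda>c d M i k y (w::nat\<Rightarrow>nat). y = beta c d i \<and> k \<le> M \<and> y \<le> M \<and> (y < k \<or>
        Q (\<lambda>j. if j = 0 then y else if j = 1 then k else if j = 2 then i else w (j - 1))))"
  let ?Q = "\<lambda>w. \<exists>c d M L e f. w 0 = prod_encode (c, e) \<and> e = prod_encode (d, f)
      \<and> f = prod_encode (M, L) \<and> L = N (\<lambda>i. w (Suc (Suc i))) * Suc M
      \<and> (L \<le> w 1 \<or> (\<exists>i k y. w 1 = i * Suc M + k \<and> B c d M i k y w))"
  have D: "diophantine ?Q"
    unfolding B_def
    by (intro diophantine_ex diophantine_conj diophantine_disj diophantine_eq diophantine_pair diophantine_less diophantine_le diophantine_beta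
        diophantine_subst[OF Q(1)] polyfun_subst[OF N] polyfun_rules)
  have B: "B c d M i k y (case_nat z (case_nat j v)) \<longleftrightarrow> y = beta c d i \<and> k \<le> M \<and> y \<le> M \<and>
      (k \<le> y \<longrightarrow> Q (case_nat y (case_nat k (case_nat i v))))" for c d M i k y z j v
  proof -
    have "(\<lambda>n. if n = 0 then y else if n = 1 then k else if n = 2 then i
        else case n - 1 of 0 \<Rightarrow> z | Suc n \<Rightarrow> case n of 0 \<Rightarrow> j | Suc n \<Rightarrow> v n)
      = case_nat y (case_nat k (case_nat i v))"
      by (auto split: nat.splits simp: fun_eq_iff)
    then show ?thesis unfolding B_def by auto
  qed
  show ?thesis
  proof (rule davis_I[OF D])
    fix v
    have "(\<forall>i<N v. P i v) \<longleftrightarrow> (\<exists>y. \<forall>j\<le>y. \<exists>c d M L e f. y = prod_encode (c, e)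
        \<and> e = prod_encode (d, f) \<and> f = prod_encode (M, L) \<and> L = N v * Suc M
        \<and> (L \<le> j \<or> (\<exists>i k y'. j = i * Suc M + k \<and> B c d M i k y' (case_nat y (case_nat j v)))))"
    proof
      assume "\<forall>i<N v. P i v"
      then have "\<forall>i. \<exists>y. i < N v \<longrightarrow> (\<forall>k\<le>y. Q (case_nat y (case_nat k (case_nat i v))))"
        unfolding P by blast
      then obtain y where y: "\<And>i k. i < N v \<Longrightarrow> k \<le> y i
          \<Longrightarrow> Q (case_nat (y i) (case_nat k (case_nat i v)))"
        by metis
      obtain c d where cd: "\<And>i. i < N v \<Longrightarrow> beta c d i = y i" using beta_exists by blast
      define M where "M = Max (insert 0 (y ` {..<N v}))"
      have M: "y i \<le> M" if "i < N v" for i using that by (auto simp: M_def)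
      define L where "L = N v * Suc M"
      define f where "f = prod_encode (M, L)"
      define e where "e = prod_encode (d, f)"
      define Y where "Y = prod_encode (c, e)"
      have "L \<le> j \<or> (\<exists>i k y. j = i * Suc M + k \<and> B c d M i k y (case_nat Y (case_nat j v)))" for j
      proof (cases "L \<le> j")
        case False
        define i where "i = j div Suc M"
        define k where "k = j mod Suc M"
        have i: "i < N v" unfolding i_def using False
          by (intro less_mult_imp_div_less) (simp add: L_def)
        have k: "k \<le> M" unfolding k_def using mod_less_divisor[of "Suc M" j] by simp
        have "j = i * Suc M + k" by (simp only: i_def k_def div_mult_mod_eq)
        moreover have "B c d M i k (y i) (case_nat Y (case_nat j v))"
          unfolding B using i k M y cd by auto
        ultimately show ?thesis by blast
      qed auto
      note BQ = this
      show "\<exists>y. \<forall>j\<le>y. \<exists>c d M L e f. y = prod_encode (c, e)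
        \<and> e = prod_encode (d, f) \<and> f = prod_encode (M, L) \<and> L = N v * Suc M
        \<and> (L \<le> j \<or> (\<exists>i k y'. j = i * Suc M + k \<and> B c d M i k y' (case_nat y (case_nat j v))))"
      proof (rule exI[of _ Y], intro allI impI)
        fix j
        show "\<exists>c d M L e f. Y = prod_encode (c, e)
        \<and> e = prod_encode (d, f) \<and> f = prod_encode (M, L) \<and> L = N v * Suc M
        \<and> (L \<le> j \<or> (\<exists>i k y'. j = i * Suc M + k \<and> B c d M i k y' (case_nat Y (case_nat j v))))"
          by (rule exI[of _ c], rule exI[of _ d], rule exI[of _ M], rule exI[of _ L],
            rule exI[of _ e], rule exI[of _ f]) (intro conjI Y_def e_def f_def L_def BQ)
      qed
    next
      assume "\<exists>y. \<forall>j\<le>y. \<exists>c d M L e f. y = prod_encode (c, e)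
        \<and> e = prod_encode (d, f) \<and> f = prod_encode (M, L) \<and> L = N v * Suc M
        \<and> (L \<le> j \<or> (\<exists>i k y'. j = i * Suc M + k \<and> B c d M i k y' (case_nat y (case_nat j v))))"
      then obtain Y where Y: "\<And>j. j \<le> Y \<Longrightarrow> \<exists>c d M L e f. Y = prod_encode (c, e)
        \<and> e = prod_encode (d, f) \<and> f = prod_encode (M, L) \<and> L = N v * Suc M
        \<and> (L \<le> j \<or> (\<exists>i k y'. j = i * Suc M + k \<and> B c d M i k y' (case_nat Y (case_nat j v))))"
        by blast
      obtain c d M L e f where e: "Y = prod_encode (c, e)" "e = prod_encode (d, f)"
        "f = prod_encode (M, L)" "L = N v * Suc M"
        using Y[of 0] by blast
      \<comment> \<open>\<open>L\<close> is stored in \<open>Y\<close> for this inequality: all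
        \<open>j < L\<close> are within the range of the quantifier up to \<open>Y\<close>.\<close>
      have "L \<le> Y" unfolding e(1,2,3)
        by (meson le_prod_encode_2 order_trans)
      have Y': "j < L \<Longrightarrow> \<exists>i k y. j = i * Suc M + k \<and> B c d M i k y (case_nat Y (case_nat j v))" for j
      proof -
        assume j: "j < L"
        \<comment> \<open>The parameters are chosen anew for each \<open>j\<close>, but they are
          decoded from the same \<open>Y\<close>, so injectivity of pairing identifies them.\<close>
        obtain c' d' M' L' e' f' where e': "Y = prod_encode (c', e')" "e' = prod_encode (d', f')"
          "f' = prod_encode (M', L')"
          "L' \<le> j \<or> (\<exists>i k y. j = i * Suc M' + k \<and> B c' d' M' i k y (case_nat Y (case_nat j v)))"
          using Y[of j, OF less_imp_le[OF less_le_trans[OF j \<open>L \<le> Y\<close>]]] by blast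
        have "c' = c" "d' = d" "M' = M" "L' = L" using e'(1-3) unfolding e(1,2,3) by simp_all
        with e'(4) j show ?thesis by (metis leD)
      qed
      show "\<forall>i<N v. P i v"
      proof (intro allI impI)
        fix i assume i: "i < N v"
        have Bi: "B c d M i k (beta c d i) (case_nat Y (case_nat j v))" if "k \<le> M" "j
            = i * Suc M + k" for k j
        proof -
          have "Suc i * Suc M \<le> L" unfolding e using i by (intro mult_le_mono1) auto
          then have "j < L" using that by simp
          then obtain i' k' y' where 1: "j = i' * Suc M + k'"
              "B c d M i' k' y' (case_nat Y (case_nat j v))"
            using Y' by blast
          then have k': "k' \<le> M" "y' = beta c d i'" unfolding B by auto
          have "i = i' \<and> k = k'"
            using euclid_unique[of k "Suc M" k' i i'] that 1(1) k'(1) by simp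
          then show ?thesis using 1(2) k' by simp
        qed
        have "Q (case_nat (beta c d i) (case_nat k (case_nat i v)))" if "k \<le> beta c d i" for k
        proof -
          have "beta c d i \<le> M" using Bi[OF le0 refl] unfolding B by blast
          with that have "k \<le> M" by (rule order_trans)
          then show ?thesis using Bi[OF _ refl, of k] that unfolding B by blast
        qed
        then show "P i v" unfolding P by (intro exI allI impI)
      qed
    qed
    then show "(\<forall>i<N v. P i v) \<longleftrightarrow> (\<exists>y. \<forall>k\<le>y. ?Q (case_nat y (case_nat k v)))"
      by (simp only: nat.case One_nat_def)
  qed
qed

lemmas davis_eq = davis_diophantine[OF diophantine_eq] and davis_less
    = davis_diophantine[OF diophantine_less]
  and davis_pair = davis_diophantine[OF diophantine_pair] and davis_beta
      = davis_diophantine[OF diophantine_beta]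

section \<open>Graphs of partial recursive functions\<close>

text \<open>An argument list is not a number, so the graph is a separate relation for each arity
  \<open>m\<close>; the value has index 0.\<close>

definition davis_graph :: "recf \<Rightarrow> bool" where
  "davis_graph f \<longleftrightarrow> (\<forall>m. davis (\<lambda>v. rec_eval f (map v [1..<Suc m]) (v 0)))"

lemma davis_graph_polyfun:
  assumes f: "davis_graph f" and T: "polyfun T" and Ts: "\<And>t. t \<in> set Ts \<Longrightarrow> polyfun t"
  shows "davis (\<lambda>v. rec_eval f (map (\<lambda>t. t v) Ts) (T v))"
proof -
  define S where "S = (\<lambda>i. if i
      = 0 then T else if i - 1 < length Ts then Ts ! (i - 1) else (\<lambda>v. 0))"
  have "polyfun (S i)" for i
    unfolding S_def using T Ts by (auto simp: polyfun_const)
  moreover have "map (\<lambda>i. S i v) [1..<Suc (length Ts)] = map (\<lambda>t. t v) Ts" for v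
    by (rule nth_equalityI) (auto simp: S_def simp del: upt_Suc)
  moreover have "S 0 v = T v" for v by (simp add: S_def)
  moreover have "davis (\<lambda>v. rec_eval f (map v [1..<Suc (length Ts)]) (v 0))"
    using f unfolding davis_graph_def by blast
  ultimately show ?thesis
    using davis_subst[of "\<lambda>v. rec_eval f (map v [1..<Suc (length Ts)]) (v 0)" S] by simp
qed

text \<open>Generalised for induction on \<open>gs\<close>: \<open>Ts\<close> accumulates the
  intermediate values already introduced as variables, while the arguments \<open>Xs\<close> are
  shifted past each new variable.\<close>

lemma davis_graph_comp_aux:
  assumes f: "davis_graph f" and gs: "\<And>g. g \<in> set gs \<Longrightarrow> davis_graph g"
    and T: "polyfun T" and Ts: "\<And>t. t \<in> set Ts \<Longrightarrow> polyfun t" and Xs: "\<And>t. t \<in> set Xs \<Longrightarrow> polyfun t"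
  shows "davis (\<lambda>v. \<exists>ys. list_all2 (\<lambda>g y. rec_eval g (map (\<lambda>t. t v) Xs) y) gs ys \<and>
     rec_eval f (map (\<lambda>t. t v) Ts @ ys) (T v))"
  using gs T Ts Xs
proof (induction gs arbitrary: T Ts Xs)
  case Nil
  then show ?case using davis_graph_polyfun[OF f, of T Ts] by simp
next
  case (Cons g gs)
  define sh where "sh = (\<lambda>t (v::nat\<Rightarrow>nat). t (\<lambda>i. v (Suc i)) :: nat)"
  have sh: "polyfun (sh t)" if "polyfun t" for t unfolding sh_def using polyfun_shift[OF that] .
  have 1: "davis (\<lambda>v. rec_eval g (map (\<lambda>t. t v) (map sh Xs)) (v 0))"
    using Cons.prems sh by (intro davis_graph_polyfun polyfun_var) auto
  have 2: "davis (\<lambda>v. \<exists>ys. list_all2 (\<lambda>g y. rec_eval g (map (\<lambda>t. t v) (map sh Xs)) y) gs ys \<and>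
     rec_eval f (map (\<lambda>t. t v) (map sh Ts @ [\<lambda>v. v 0]) @ ys) (sh T v))"
    using Cons.prems sh by (intro Cons.IH) (auto intro: polyfun_var)
  have L: "(\<exists>y. R g y \<and> (\<exists>ys. list_all2 R gs ys \<and> B (y # ys))) \<longleftrightarrow>
     (\<exists>ys. list_all2 R (g # gs) ys \<and> B ys)"
    for R :: "recf \<Rightarrow> nat \<Rightarrow> bool" and B
    unfolding list_all2_Cons1 by blast
  have "davis (\<lambda>v. \<exists>y. rec_eval g (map (\<lambda>t. t v) Xs) y \<and>
    (\<exists>ys. list_all2 (\<lambda>g y. rec_eval g (map (\<lambda>t. t v) Xs) y) gs ys \<and>
     rec_eval f (map (\<lambda>t. t v) Ts @ y # ys) (T v)))"
    using davis_conj[OF 1 2] by (intro davis_ex) (simp add: sh_def comp_def)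
  then show ?case
    using L[of "\<lambda>g y. rec_eval g (map (\<lambda>t. t v) Xs) y"
    "\<lambda>ys. rec_eval f (map (\<lambda>t. t v) Ts @ ys) (T v)" for v]
    by simp
qed

lemma rec_eval_Comp: "rec_eval (Comp f gs) xs y \<longleftrightarrow>
   (\<exists>ys. list_all2 (\<lambda>g y. rec_eval g xs y) gs ys \<and> rec_eval f ys y)"
  by (auto elim: rec_eval_elims intro: rec_eval.comp)

text \<open>The recursion is replaced by its course of values, coded with \<open>beta\<close>. What
  remains is one bounded quantifier, over the single steps.\<close>

lemma rec_eval_PrimRec: "rec_eval (PrimRec f g) (n # xs) y \<longleftrightarrow>
   (\<exists>c d. rec_eval f xs (beta c d 0) \<and>
     (\<forall>i<n. rec_eval g (i # beta c d i # xs) (beta c d (Suc i))) \<and> y = beta c d n)"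
proof
  assume "rec_eval (PrimRec f g) (n # xs) y"
  then have "\<exists>h. rec_eval f xs (h 0) \<and> (\<forall>i<n. rec_eval g (i # h i # xs) (h (Suc i))) \<and> y = h n"
  proof (induction n arbitrary: y)
    case 0
    then show ?case by (intro exI[of _ "\<lambda>_. y"]) (auto elim: rec_eval_elims(5))
  next
    case (Suc n)
    from Suc.prems obtain r where r: "rec_eval (PrimRec f g) (n # xs) r" "rec_eval g (n # r # xs) y"
      by (auto elim: rec_eval_elims(6))
    from Suc.IH[OF r(1)] obtain h where "rec_eval f xs (h 0)"
      "\<forall>i<n. rec_eval g (i # h i # xs) (h (Suc i))" "r = h n" by blast
    with r(2) show ?case
      by (intro exI[of _ "h(Suc n := y)"]) (auto simp: less_Suc_eq)
  qed
  then obtain h where h: "rec_eval f xs (h 0)"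
    "\<forall>i<n. rec_eval g (i # h i # xs) (h (Suc i))" "y = h n" by blast
  obtain c d where "\<forall>i<Suc n. beta c d i = h i" using beta_exists by blast
  then show "\<exists>c d. rec_eval f xs (beta c d 0) \<and>
     (\<forall>i<n. rec_eval g (i # beta c d i # xs) (beta c d (Suc i))) \<and> y = beta c d n"
    using h by (intro exI[of _ c] exI[of _ d]) simp
next
  assume "\<exists>c d. rec_eval f xs (beta c d 0) \<and>
     (\<forall>i<n. rec_eval g (i # beta c d i # xs) (beta c d (Suc i))) \<and> y = beta c d n"
  then obtain c d where h: "rec_eval f xs (beta c d 0)"
    "\<forall>i<n. rec_eval g (i # beta c d i # xs) (beta c d (Suc i))" "y = beta c d n" by blast
  have "i \<le> n \<Longrightarrow> rec_eval (PrimRec f g) (i # xs) (beta c d i)" for i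
    by (induction i) (use h in \<open>auto intro: rec_eval.intros\<close>)
  with h show "rec_eval (PrimRec f g) (n # xs) y" by simp
qed

lemma rec_eval_PrimRec_Nil: "\<not> rec_eval (PrimRec f g) [] y"
  by (auto elim: rec_eval.cases)

lemma rec_eval_Mu: "rec_eval (Mu f) xs n \<longleftrightarrow>
   rec_eval f (n # xs) 0 \<and> (\<forall>i<n. \<exists>m. 0 < m \<and> rec_eval f (i # xs) m)"
  by (auto elim: rec_eval_elims(7) intro: rec_eval.mu)

lemma upt_1_Suc_Suc: "[1..<Suc (Suc m)] = 1 # map Suc [1..<Suc m]"
  by (simp add: upt_conv_Cons map_Suc_upt del: upt_Suc)

lemma davis_False: "davis (\<lambda>v. False)"
  using davis_eq[OF polyfun_const[of 0] polyfun_const[of 1]] by simp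

lemma davis_graph_all: "davis_graph f"
proof (induction f)
  case Zero
  have "rec_eval Zero xs y \<longleftrightarrow> y = 0" for xs y
    by (auto elim: rec_eval_elims intro: rec_eval.intros)
  then show ?case unfolding davis_graph_def by (simp add: davis_eq polyfun_var polyfun_const)
next
  case Succ
  have "rec_eval Succ xs y \<longleftrightarrow> (length xs = 1 \<and> y = Suc (xs ! 0))" for xs y
    by (cases xs) (auto elim: rec_eval_elims intro: rec_eval.intros)
  then have "davis (\<lambda>v. rec_eval Succ (map v [1..<Suc m]) (v 0))" for m
    by (cases "m = 1") (auto intro!: davis_eq polyfun_rules davis_False simp del: upt_Suc)
  then show ?case unfolding davis_graph_def by blast
next
  case (Proj i)
  have "rec_eval (Proj i) xs y \<longleftrightarrow> (i < length xs \<and> y = xs ! i)" for xs y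
    by (auto elim: rec_eval_elims intro: rec_eval.intros)
  then have "davis (\<lambda>v. rec_eval (Proj i) (map v [1..<Suc m]) (v 0))" for m
    by (cases "i < m") (auto intro!: davis_eq polyfun_rules davis_False simp del: upt_Suc)
  then show ?case unfolding davis_graph_def by blast
next
  case (Comp f gs)
  have "davis (\<lambda>v. rec_eval (Comp f gs) (map v [1..<Suc m]) (v 0))" for m
  proof -
    have "davis (\<lambda>v. \<exists>ys. list_all2 (\<lambda>g y. rec_eval g (map (\<lambda>t. t v) (map (\<lambda>i v. v i) [1..<Suc m])) y) gs ys \<and>
       rec_eval f (map (\<lambda>t. t v) [] @ ys) (v 0))"
      using Comp(2) by (intro davis_graph_comp_aux[OF Comp(1)] polyfun_var) (auto simp: polyfun_var)
    then show ?thesis by (simp add: rec_eval_Comp comp_def del: upt_Suc)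
  qed
  then show ?case unfolding davis_graph_def by blast
next
  case (PrimRec f g)
  have "davis (\<lambda>v. rec_eval (PrimRec f g) (map v [1..<Suc m]) (v 0))" for m
  proof (cases m)
    case 0
    then show ?thesis by (simp add: rec_eval_PrimRec_Nil davis_False)
  next
    case (Suc m')
    have f: "davis (\<lambda>v. rec_eval f (map (\<lambda>t. t v) (map (\<lambda>i v. v (a + i)) [1..<Suc m'])) (v k))"
        for a k
      using PrimRec(1) by (intro davis_graph_polyfun polyfun_var) (auto simp: polyfun_var)
    have g: "davis (\<lambda>v. rec_eval g (map (\<lambda>t. t v) ((\<lambda>v. v i) # (\<lambda>v. v j) # map (\<lambda>i v. v (a + i)) [1..<Suc m'])) (v k))"
      for a i j k
      using PrimRec(2) by (intro davis_graph_polyfun polyfun_var) (auto simp: polyfun_var)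
    have "davis (\<lambda>v. \<exists>c d. (\<exists>b. b = beta c d 0 \<and> rec_eval f (map (\<lambda>i. v (Suc i)) [1..<Suc m']) b) \<and>
     (\<forall>i<v 1. \<exists>b. b = beta c d i \<and> (\<exists>b'. b' = beta c d (Suc i) \<and>
        rec_eval g (i # b # map (\<lambda>i. v (Suc i)) [1..<Suc m']) b')) \<and> v 0 = beta c d (v 1))"
      \<comment> \<open>Positions after the quantifiers: below \<open>c, d, b\<close> the original
        variables are shifted by 3, below \<open>c, d, i, b, b'\<close> by 5, and the arguments
        start one place after the recursion variable.\<close>
      using f[of 4 0] g[of 2 1 6 0]
      by (intro davis_ex davis_conj davis_ball davis_beta polyfun_rules)
        (simp_all add: comp_def numeral_eq_Suc del: upt_Suc)
    then show ?thesis unfolding Suc upt_1_Suc_Suc list.map rec_eval_PrimRec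
      by (simp add: comp_def del: upt_Suc)
  qed
  then show ?case unfolding davis_graph_def by blast
next
  case (Mu f)
  have "davis (\<lambda>v. rec_eval (Mu f) (map v [1..<Suc m]) (v 0))" for m
  proof -
    have f: "davis (\<lambda>v. rec_eval f (map (\<lambda>t. t v) ((\<lambda>v. v j) # map (\<lambda>i v. v (a + i)) [1..<Suc m])) (T v))"
      if "polyfun T" for a j T
      using Mu that by (intro davis_graph_polyfun) (auto simp: polyfun_var)
    show ?thesis unfolding rec_eval_Mu
      using f[OF polyfun_const, of 0 0 0] f[OF polyfun_var, of 1 2 0]
      by (intro davis_conj davis_ball davis_ex davis_less polyfun_rules)
         (simp_all add: comp_def numeral_eq_Suc del: upt_Suc)
  qed
  then show ?case unfolding davis_graph_def by blast
qed

lemma davis_rec_eval: "polyfun F \<Longrightarrow> polyfun G \<Longrightarrow> davis (\<lambda>v. rec_eval f [F v] (G v))"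
  using davis_graph_polyfun[OF davis_graph_all, of G "[F]" f] by simp

section \<open>Elimination of the bounded quantifier\<close>

lemma prod_dvd_coprime:
  fixes q :: "nat \<Rightarrow> nat"
  assumes "finite I" "\<And>i. i \<in> I \<Longrightarrow> q i dvd x"
    "\<And>i j. i \<in> I \<Longrightarrow> j \<in> I \<Longrightarrow> i \<noteq> j \<Longrightarrow> coprime (q i) (q j)"
  shows "(\<Prod>i\<in>I. q i) dvd x"
  using assms
proof (induction I rule: finite_induct)
  case (insert i I)
  have "coprime (q i) (\<Prod>i\<in>I. q i)"
    using insert by (intro prod_coprime_right) auto
  then show ?case using insert by (simp add: divides_mult)
qed simp

lemma fact_choose: "fact b * (a choose b) = (\<Prod>i<b. a - i)" for a b :: nat
proof (induction b)
  case (Suc b)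
  have "Suc b * (a choose Suc b) = (a - b) * (a choose b)"
  proof (cases a)
    case (Suc n)
    then show ?thesis using Suc_times_binomial[of b n] binomial_absorb_comp[of a b] by simp
  qed simp
  then have "fact b * (Suc b * (a choose Suc b)) = fact b * ((a - b) * (a choose b))"
      by (simp only:)
  then have "fact (Suc b) * (a choose Suc b) = (a - b) * (fact b * (a choose b))"
    by (simp only: fact_Suc of_nat_id mult_ac)
  then show ?case by (simp add: Suc.IH mult.commute)
qed simp

text \<open>Each factor \<open>M - i\<close> of the falling factorial is \<open>Suc M - k\<close>
  with \<open>k = Suc i\<close>, and \<open>k\<close> can be taken out of it; the factors
  \<open>k\<close> cancel against \<open>fact n\<close>.\<close>

lemma choose_prod_quotients:
  assumes "\<And>k. 1 \<le> k \<Longrightarrow> k \<le> n \<Longrightarrow> k dvd Suc M"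
  shows "M choose n = (\<Prod>k\<in>{1..n}. Suc M div k - 1)"
proof -
  have "fact n * (M choose n) = (\<Prod>i<n. M - i)" by (rule fact_choose)
  also have "\<dots> = (\<Prod>k\<in>{1..n}. Suc M - k)"
    by (rule prod.reindex_bij_witness[of _ "\<lambda>k. k - 1" Suc]) auto
  also have "\<dots> = (\<Prod>k\<in>{1..n}. k * (Suc M div k - 1))"
    using assms by (intro prod.cong) (auto simp: diff_mult_distrib2)
  also have "\<dots> = fact n * (\<Prod>k\<in>{1..n}. Suc M div k - 1)"
    by (simp add: prod.distrib fact_prod)
  finally show ?thesis by simp
qed

text \<open>A prime divisor of the falling factorial divides some \<open>a - i\<close> with
  \<open>i < b\<close>. In this way a divisibility statement bounds the residue of an otherwise
  unbounded number.\<close>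

lemma prime_dvd_choose:
  fixes p a b :: nat
  assumes p: "prime p" "b < p" "p dvd (a choose b)"
  shows "a mod p < b"
proof (cases "a < b")
  case False
  have "p dvd fact b * (a choose b)" using p by simp
  then have "p dvd (\<Prod>i<b. a - i)" by (simp only: fact_choose)
  then obtain i where i: "i < b" "p dvd a - i"
    using p(1) by (auto simp: prime_dvd_prod_iff)
  then have "a mod p = i mod p" using False by (simp add: mod_eq_dvd_iff_nat)
  then show ?thesis using i p by simp
qed (use mod_less_eq_dividend le_less_trans in blast)

text \<open>The bounded quantifier is eliminated with the pairwise coprime moduli
  \<open>q\<^sub>k = (M + 1) / k - 1\<close>, whose product is a binomial coefficient and which satisfy
  \<open>M \<equiv> k - 1 (mod q\<^sub>k)\<close>.\<close>

lemma modulus_prime_large: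
  fixes p L k n T M :: nat
  assumes T: "fact T dvd Suc M" "n * L \<le> T" and k: "1 \<le> k" "k \<le> n"
    and p: "prime p" "p dvd Suc M div k - 1"
  shows "L < p"
proof (rule ccontr)
  assume "\<not> L < p"
  \<comment> \<open>A prime \<open>p \<le> L\<close> would give \<open>k * p\<close> dividing
    \<open>fact T\<close> and thus \<open>Suc M\<close>, so that \<open>p\<close> divides the two
    consecutive numbers \<open>Suc M div k - 1\<close> and \<open>Suc M div k\<close>.\<close>
  then have "k * p \<le> T" using T(2) k mult_le_mono[of k n p L] by simp
  then have "k * p dvd fact T" using k prime_ge_1_nat[OF p(1)] by (intro dvd_fact) auto
  then have "k * p dvd Suc M" using T(1) dvd_trans by blast
  then have "p dvd Suc M div k" using k by (metis dvd_mult_imp_div mult.commute)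
  moreover have "Suc M div k \<noteq> 0"
    using \<open>k * p dvd Suc M\<close> k by (metis Suc_neq_Zero dvd_mult_left dvd_div_eq_0_iff)
  then have "Suc M div k = Suc (Suc M div k - 1)" by simp
  ultimately have "p dvd 1" using p(2) by (metis dvd_add_right_iff plus_1_eq_Suc add.commute)
  with p(1) show False by simp
qed

lemma cong_modulus:
  assumes "k dvd Suc M" "1 \<le> k" shows "[M = k - 1] (mod (Suc M div k - 1))"
proof -
  obtain d where d: "Suc M = k * d" using assms(1) by auto
  then have "d > 0" by (cases d) auto
  have "Suc M div k - 1 = d - 1" using d assms(2) by simp
  moreover have "M = (k - 1) + (d - 1) * k"
    using d assms(2) \<open>d > 0\<close> by (cases d; cases k) (auto simp: algebra_simps)
  ultimately show ?thesis by (simp add: cong_def)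
qed

text \<open>By the Chinese remainder theorem, numbers \<open>a j\<close> code all the
  \<open>u k j\<close> as residues modulo \<open>Suc M div Suc k - 1\<close>, where \<open>M\<close>
  itself is congruent to \<open>k\<close>. Polynomials respect congruences, so the equations for all
  \<open>k\<close> become one congruence modulo the product. Conversely, modulo a prime factor
  \<open>p\<close> of one modulus, the binomial condition makes the residues of the
  \<open>a j\<close> smaller than \<open>b\<close>, and the size of \<open>T\<close> makes
  \<open>p\<close> larger than the values of \<open>F\<close> and \<open>G\<close> there; hence the
  congruence is an equation.\<close>

lemma bounded_quantifier_elim:
  fixes F G :: "(nat \<Rightarrow> nat) \<Rightarrow> nat" and m y :: nat and v :: "nat \<Rightarrow> nat"
  assumes polyfun: "polyfun F" "polyfun G"
  defines "x \<equiv> (\<lambda>u k v. glue m u (case_nat y (case_nat k v)))"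
  shows "(\<forall>k\<le>y. \<exists>u. F (x u k v) = G (x u k v)) \<longleftrightarrow>
    (\<exists>b T M a. Suc y * (F (x (\<lambda>_. b) y v) + G (x (\<lambda>_. b) y v) + b + Suc y + 3) \<le> T
       \<and> fact T dvd Suc M
       \<and> [F (x a M v) = G (x a M v)] (mod (M choose Suc y))
       \<and> (\<forall>j<m. (M choose Suc y) dvd (a j choose b)))"
    (is "?L \<longleftrightarrow> (\<exists>b T M a. ?R b T M a)")
proof
  have xmono: "F (x u k v) \<le> F (x u' k' v)" "G (x u k v) \<le> G (x u' k' v)"
    if "\<And>j. j < m \<Longrightarrow> u j \<le> u' j" "k \<le> k'" for u u' k k'
  proof -
    have "x u k v i \<le> x u' k' v i" for i
      using that by (auto simp: x_def glue_def split: nat.splits)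
    then show "F (x u k v) \<le> F (x u' k' v)" "G (x u k v) \<le> G (x u' k' v)"
      by (rule polyfun_mono[OF polyfun(1)], rule polyfun_mono[OF polyfun(2)])
  qed
  have xcong: "[F (x u k v) = F (x u' k' v)] (mod p)" "[G (x u k v) = G (x u' k' v)] (mod p)"
    if "\<And>j. j < m \<Longrightarrow> [u j = u' j] (mod p)" "[k = k'] (mod p)" for u u' k k' p
  proof -
    have "[x u k v i = x u' k' v i] (mod p)" for i
      using that by (auto simp: x_def glue_def split: nat.splits)
    then show "[F (x u k v) = F (x u' k' v)] (mod p)" "[G (x u k v) = G (x u' k' v)] (mod p)"
      by (rule polyfun_cong[OF polyfun(1)], rule polyfun_cong[OF polyfun(2)])
  qed
  {
    assume "\<exists>b T M a. ?R b T M a"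
    then obtain b T M a where R: "?R b T M a" by blast
    define L where "L = F (x (\<lambda>_. b) y v) + G (x (\<lambda>_. b) y v) + b + Suc y + 3"
    have T: "Suc y * L \<le> T" "fact T dvd Suc M" using R by (auto simp: L_def)
    have kd: "k * j dvd Suc M" if "1 \<le> k" "k \<le> Suc y" "1 \<le> j" "j \<le> L" for k j
    proof -
      have "k * j \<le> T" using T(1) that mult_le_mono[of k "Suc y" j L] by linarith
      then have "k * j dvd fact T" using that by (intro dvd_fact) auto
      then show ?thesis using T(2) dvd_trans by blast
    qed
    have N: "M choose Suc y = (\<Prod>k\<in>{1..Suc y}. Suc M div k - 1)"
      using kd[of _ 1] by (intro choose_prod_quotients) (auto simp: L_def)
    show ?L
    proof (intro allI impI)
      fix k assume k: "k \<le> y"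
      define q where "q = Suc M div Suc k - 1"
      have qN: "q dvd (M choose Suc y)"
        unfolding N q_def using k by (intro dvd_prodI) auto
      \<comment> \<open>The summand 3 in \<open>L\<close> serves to make \<open>q\<close> of the
        form \<open>3 * d - 1\<close>, hence different from 1 and divisible by a prime.\<close>
      obtain d where d: "Suc M = Suc k * 3 * d" using kd[of "Suc k" 3] k by (auto simp: L_def)
      then have "Suc M div Suc k = Suc k * (3 * d) div Suc k" by (simp only: mult.assoc)
      also have "\<dots> = 3 * d" by (rule nonzero_mult_div_cancel_left) simp
      finally have "Suc M div Suc k = 3 * d" .
      moreover have "d \<noteq> 0" using d by (cases "d = 0") simp_all
      ultimately have "q \<noteq> 1" unfolding q_def by (cases d) simp_all
      then obtain p where p: "prime p" "p dvd q" using prime_factor_nat by blast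
      have Lp: "L < p" using modulus_prime_large[OF T(2,1), of "Suc k" p] k p by (simp add: q_def)
      have pN: "p dvd (M choose Suc y)" using p(2) qN dvd_trans by blast
      define u where "u j = a j mod p" for j
      have ub: "u j \<le> b" if "j < m" for j
      proof -
        have "p dvd (a j choose b)" using R pN that dvd_trans by blast
        then show ?thesis using prime_dvd_choose[OF p(1), of b "a j"] Lp
          by (simp add: u_def L_def)
      qed
      have "[M = k] (mod q)"
        using cong_modulus[of "Suc k" M] kd[of "Suc k" 1] k by (simp add: q_def L_def)
      then have kM: "[k = M] (mod p)" using p(2) cong_dvd_modulus_nat cong_sym by blast
      have ua: "[u j = a j] (mod p)" for j by (simp add: u_def)
      have "[F (x u k v) = F (x a M v)] (mod p)" by (intro xcong ua kM)
      also have "[F (x a M v) = G (x a M v)] (mod p)" using R pN cong_dvd_modulus_nat by blast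
      also have "[G (x a M v) = G (x u k v)] (mod p)"
          by (intro xcong cong_sym[OF ua] cong_sym[OF kM])
      finally have "[F (x u k v) = G (x u k v)] (mod p)" .
      moreover have "F (x u k v) < p" "G (x u k v) < p"
        using xmono[of u "\<lambda>_. b" k y] ub k Lp by (auto simp: L_def)
      ultimately have "F (x u k v) = G (x u k v)" using cong_less_modulus_unique_nat by blast
      then show "\<exists>u. F (x u k v) = G (x u k v)" by blast
    qed
  }
  {
    assume ?L
    then obtain u where u: "\<And>k. k \<le> y \<Longrightarrow> F (x (u k) k v) = G (x (u k) k v)" by metis
    \<comment> \<open>The successor makes \<open>u k j < b\<close> strict, so that
      \<open>a j - u k j\<close> is one of the \<open>b\<close> factors of the falling factorial
      used below.\<close>
    define b where "b = Suc (\<Sum>k\<le>y. \<Sum>j<m. u k j)"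
    have ub: "u k j < b" if "k \<le> y" "j < m" for k j
    proof -
      have "u k j \<le> (\<Sum>j<m. u k j)" using that by (intro member_le_sum) auto
      also have "\<dots> \<le> (\<Sum>k\<le>y. \<Sum>j<m. u k j)"
        using that by (intro member_le_sum[of k "{..y}" "\<lambda>k. \<Sum>j<m. u k j"]) auto
      finally show ?thesis by (simp add: b_def)
    qed
    define L where "L = F (x (\<lambda>_. b) y v) + G (x (\<lambda>_. b) y v) + b + Suc y + 3"
    define T where "T = Suc y * L"
    define M where "M = (fact T :: nat) - 1"
    have M: "Suc M = fact T" by (simp add: M_def)
    define q where "q k = Suc M div k - 1" for k
    have kd: "k dvd Suc M" if "1 \<le> k" "k \<le> Suc y" for k
      unfolding M using that by (intro dvd_fact) (auto simp: T_def L_def)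
    have N: "M choose Suc y = (\<Prod>k\<in>{1..Suc y}. q k)"
      unfolding q_def using kd by (intro choose_prod_quotients)
    have large: "L < p" if "prime p" "p dvd q k" "1 \<le> k" "k \<le> Suc y" for p k
      using modulus_prime_large[of T M "Suc y" L k p] that by (simp add: M T_def q_def)
    have cop: "coprime (q i) (q j)" if ij: "i \<in> {1..Suc y}" "j \<in> {1..Suc y}" "i \<noteq> j" for i j
    proof (rule ccontr)
      assume "\<not> coprime (q i) (q j)"
      then obtain p where p: "prime p" "p dvd q i" "p dvd q j"
        unfolding coprime_iff_gcd_eq_1 using prime_factor_nat by (metis gcd_nat.bounded_iff)
      have "[M = i - 1] (mod p)" "[M = j - 1] (mod p)"
        using cong_modulus[OF kd, of i] cong_modulus[OF kd, of j] ij p(2,3) cong_dvd_modulus_nat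
        unfolding q_def by auto
      then have "[i - 1 = j - 1] (mod p)" using cong_sym cong_trans by blast
      moreover have "L < p" using large[OF p(1,2)] ij by simp
      then have "i - 1 < p" "j - 1 < p" using ij by (auto simp: L_def)
      ultimately have "i - 1 = j - 1" using cong_less_modulus_unique_nat by blast
      then show False using ij by auto
    qed
    have "\<exists>a. \<forall>k\<in>{1..Suc y}. [a = u (k - 1) j] (mod q k)" for j
      using cop by (intro chinese_remainder_nat) auto
    then obtain a where a: "\<And>j k. k \<in> {1..Suc y} \<Longrightarrow> [a j = u (k - 1) j] (mod q k)" by metis
    have "?R b T M a"
    proof (intro conjI allI impI)
      show "Suc y * (F (x (\<lambda>_. b) y v) + G (x (\<lambda>_. b) y v) + b + Suc y + 3) \<le> T"
        by (simp add: T_def L_def)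
      show "fact T dvd Suc M" by (simp add: M)
      have FG: "[F (x a M v) = G (x a M v)] (mod q k)" if k: "k \<in> {1..Suc y}" for k
      proof -
        have Mk: "[M = k - 1] (mod q k)" using cong_modulus[OF kd, of k] k by (simp add: q_def)
        have "[F (x a M v) = F (x (u (k - 1)) (k - 1) v)] (mod q k)"
          by (intro xcong a k Mk)
        also have "F (x (u (k - 1)) (k - 1) v) = G (x (u (k - 1)) (k - 1) v)" using k
            by (intro u) auto
        also have "[G (x (u (k - 1)) (k - 1) v) = G (x a M v)] (mod q k)"
          by (intro xcong cong_sym[OF a] cong_sym[OF Mk] k)
        finally show ?thesis .
      qed
      have "int (q k) dvd int (F (x a M v)) - int (G (x a M v))" if "k \<in> {1..Suc y}" for k
        using FG[OF that] by (simp add: cong_int_iff[symmetric] cong_iff_dvd_diff)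
      then have "q k dvd nat \<bar>int (F (x a M v)) - int (G (x a M v))\<bar>" if "k \<in> {1..Suc y}" for k
        using that by (simp add: nat_abs_dvd_iff dvd_nat_abs_iff)
      then have "(M choose Suc y) dvd nat \<bar>int (F (x a M v)) - int (G (x a M v))\<bar>"
        unfolding N using cop by (intro prod_dvd_coprime) auto
      then show "[F (x a M v) = G (x a M v)] (mod (M choose Suc y))"
        by (simp add: cong_int_iff[symmetric] cong_iff_dvd_diff dvd_nat_abs_iff)
      fix j assume j: "j < m"
      have "q k dvd (a j choose b)" if k: "k \<in> {1..Suc y}" for k
      proof (cases "a j < b")
        case False
        let ?u = "u (k - 1) j"
        have ul: "?u < b" using ub[of "k - 1" j] j k by auto
        have "[a j = ?u] (mod q k)" using a k by blast
        then have "q k dvd a j - ?u" using ul False by (simp add: cong_altdef_nat)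
        also have "\<dots> dvd (\<Prod>i<b. a j - i)" using ul by (intro dvd_prodI) auto
        also have "\<dots> = fact b * (a j choose b)" by (rule fact_choose[symmetric])
        finally have "q k dvd fact b * (a j choose b)" .
        \<comment> \<open>All primes dividing \<open>q k\<close> exceed \<open>L\<close>, which is
          at least \<open>b\<close>, so \<open>fact b\<close> can be cancelled.\<close>
        moreover have "coprime (q k) (fact b)"
        proof (rule ccontr)
          assume "\<not> coprime (q k) (fact b)"
          then obtain p where p: "prime p" "p dvd q k" "p dvd fact b"
            unfolding coprime_iff_gcd_eq_1 using prime_factor_nat by (metis gcd_nat.bounded_iff)
          then have "p \<le> b" by (simp add: prime_dvd_fact_iff)
          with large[OF p(1,2)] k show False by (simp add: L_def)
        qed
        ultimately show ?thesis by (simp add: coprime_dvd_mult_right_iff)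
      qed (simp add: binomial_eq_0)
      then show "(M choose Suc y) dvd (a j choose b)"
        unfolding N using cop by (intro prod_dvd_coprime) auto
    qed
    then show "\<exists>b T M a. ?R b T M a" by blast
  }
qed

section \<open>Binomial coefficients and factorials from powers\<close>

lemma base_digit:
  fixes c :: "nat \<Rightarrow> nat"
  assumes "\<And>i. c i < u"
  shows "((\<Sum>i<N. c i * u ^ i) div u ^ k) mod u = (if k < N then c k else 0)"
  using assms
proof (induction k arbitrary: c N)
  case 0
  show ?case
  proof (cases N)
    case (Suc N')
    have "(\<Sum>i<N. c i * u ^ i) = c 0 + u * (\<Sum>i<N'. c (Suc i) * u ^ i)"
      unfolding Suc sum.lessThan_Suc_shift by (simp add: sum_distrib_left mult_ac)
    then show ?thesis using 0[of 0] Suc by simp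
  qed simp
next
  case (Suc k)
  show ?case
  proof (cases N)
    case (Suc N')
    have "(\<Sum>i<N. c i * u ^ i) = c 0 + u * (\<Sum>i<N'. c (Suc i) * u ^ i)"
      unfolding Suc sum.lessThan_Suc_shift by (simp add: sum_distrib_left mult_ac)
    moreover have "(c 0 + u * S) div u = S" for S
      using Suc.prems[of 0] by simp
    ultimately have "(\<Sum>i<N. c i * u ^ i) div u ^ Suc k = (\<Sum>i<N'. c (Suc i) * u ^ i) div u ^ k"
      by (simp add: div_mult2_eq)
    then show ?thesis using Suc.IH[of "\<lambda>i. c (Suc i)" N'] Suc.prems Suc by simp
  qed simp
qed

text \<open>By the binomial theorem the coefficients are the base \<open>u\<close> digits of
  \<open>(u + 1) ^ n\<close>: they are at most \<open>2 ^ n\<close>, so there are no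
  carries.\<close>

lemma choose_digit:
  assumes "2 ^ n < u"
  shows "(Suc u ^ n div u ^ k) mod u = (n choose k)"
proof -
  have "Suc u ^ n = (u + 1) ^ n" by simp
  also have "\<dots> = (\<Sum>i<Suc n. (n choose i) * u ^ i)"
    unfolding binomial lessThan_Suc_atMost by simp
  finally have e: "Suc u ^ n = (\<Sum>i<Suc n. (n choose i) * u ^ i)" .
  have "(n choose i) < u" for i
    using assms binomial_le_pow2[of n i] by linarith
  from base_digit[of "\<lambda>i. n choose i" u "Suc n" k, OF this] show ?thesis
    unfolding e by (simp add: binomial_eq_0)
qed

text \<open>The exact quotient is \<open>fact n\<close> times the product of
  \<open>r / (r - i)\<close> over \<open>i < n\<close>. It tends to \<open>fact n\<close> from above
  as \<open>r\<close> grows, so for large \<open>r\<close> rounding down gives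
  \<open>fact n\<close>.\<close>

lemma fact_quotient:
  assumes r: "Suc n ^ (n + 3) \<le> r"
  shows "r ^ n div (r choose n) = fact n"
proof (cases n)
  case (Suc n')
  have n1: "1 \<le> n" by (simp add: Suc)
  \<comment> \<open>Divided by \<open>r ^ (j + 1)\<close>, a Bernoulli inequality: the product of
    \<open>1 - i / r\<close> over \<open>i < j\<close> is at least
    \<open>1 - n * j / r\<close>.\<close>
  have bound: "r ^ j * r \<le> (\<Prod>i<j. r - i) * r + n * j * r ^ j" if "j \<le> n" for j
    using that
  proof (induction j)
    case (Suc j)
    have le: "(\<Prod>i<j. r - i) \<le> r ^ j"
      using prod_mono[of "{..<j}" "\<lambda>i. r - i" "\<lambda>i. r"] by simp
    have "r \<le> (r - j) + n" using Suc.prems by simp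
    then have "(\<Prod>i<j. r - i) * r \<le> (\<Prod>i<j. r - i) * ((r - j) + n)" by (rule mult_le_mono2)
    also have "\<dots> \<le> (\<Prod>i<Suc j. r - i) + n * r ^ j"
      using mult_le_mono2[OF le, of n] by (simp add: algebra_simps)
    finally have "r ^ j * r \<le> (\<Prod>i<Suc j. r - i) + n * r ^ j + n * j * r ^ j"
      using Suc by linarith
    then have "r ^ j * r * r \<le> ((\<Prod>i<Suc j. r - i) + n * r ^ j + n * j * r ^ j) * r"
      by (rule mult_le_mono1)
    then show ?case by (simp add: algebra_simps)
  qed simp
  define C where "C = (r choose n)"
  have fC: "fact n * C = (\<Prod>i<n. r - i)" unfolding C_def by (rule fact_choose)
  have r0: "r > 0" using r by (metis gr0I le_zero_eq power_eq_0_iff nat.simps(3))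
  have "r ^ n * r \<le> (fact n * C + n * n * r ^ n') * r"
  proof -
    have "n * n * r ^ n = n * n * r ^ n' * r" by (simp add: Suc algebra_simps)
    with bound[OF order_refl] show ?thesis unfolding fC add_mult_distrib by (simp only:)
  qed
  then have 1: "r ^ n \<le> fact n * C + n * n * r ^ n'" using r0 by simp
  \<comment> \<open>The origin of the exponent \<open>n + 3\<close>: two factors
    \<open>Suc n\<close> exceed \<open>n * n\<close>, and the other \<open>n + 1\<close> of them are
    at least \<open>fact n + 1\<close>.\<close>
  have "n * n * (fact n + 1) < r"
  proof -
    have "(fact n :: nat) \<le> n ^ n" using fact_le_power[of n, where 'a = nat] by simp
    also have "\<dots> < Suc n ^ Suc n" using power_strict_mono[of n "Suc n" n] n1
      by (simp add: less_le_trans)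
    finally have "(fact n :: nat) + 1 \<le> Suc n ^ Suc n" by simp
    then have "n * n * (fact n + 1) \<le> n * n * Suc n ^ Suc n" by (rule mult_le_mono2)
    also have "\<dots> < Suc n * Suc n * Suc n ^ Suc n"
      by (intro mult_strict_right_mono mult_strict_mono) auto
    also have "\<dots> = Suc n ^ (n + 3)" by (simp only: power_add power_Suc power3_eq_cube mult_ac)
    finally show ?thesis using r by linarith
  qed
  have 2: "n * n * r ^ n' < C"
  proof (rule ccontr)
    assume "\<not> n * n * r ^ n' < C"
    then have "fact n * C \<le> fact n * (n * n * r ^ n')" by (intro mult_le_mono2) simp
    with 1 have "r * r ^ n' \<le> (n * n * (fact n + 1)) * r ^ n'" by (simp add: Suc algebra_simps)
    then have "r \<le> n * n * (fact n + 1)" using r0 by simp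
    with \<open>n * n * (fact n + 1) < r\<close> show False by linarith
  qed
  have 3: "fact n * C \<le> r ^ n" using binomial_fact_pow[of r n] by (simp add: C_def mult.commute)
  from 1 2 have "r ^ n < fact n * C + C" by linarith
  with 3 show ?thesis unfolding C_def[symmetric]
    by (intro div_nat_eqI) (simp_all add: mult.commute)
qed simp

section \<open>Pell's equation over entire functions of finite order\<close>

lemma cosh_surj: "\<exists>s. cosh s = (z :: complex)"
proof -
  define r where "r = csqrt (z\<^sup>2 - 1)"
  have r: "r * r = z * z - 1"
    unfolding r_def by (metis power2_csqrt power2_eq_square)
  have t: "(z + r) * (z - r) = 1" by (simp add: algebra_simps r)
  then have nz: "z + r \<noteq> 0" by auto
  then have "exp (Ln (z + r)) = z + r" by simp
  moreover have "exp (- Ln (z + r)) = z - r"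
    using nz t by (simp add: exp_minus field_simps)
  ultimately have "cosh (Ln (z + r)) = z" by (simp add: cosh_field_def)
  then show ?thesis by blast
qed

lemma H_fin_growth:
  assumes "f \<in> H_fin"
  shows "\<exists>K\<ge>0. \<exists>N::nat. \<forall>r>1. \<forall>z. cmod z \<le> r \<longrightarrow> cmod (f z) \<le> exp (K * r ^ N)"
proof -
  obtain a C where a: "a \<ge> 0"
    and C: "\<And>r. r > 1 \<Longrightarrow> \<bar>ln (SUP z\<in>cball 0 r. cmod (f z))\<bar> \<le> C * r powr a"
    and hol: "f holomorphic_on UNIV"
    using assms unfolding H_fin_def finite_order_def by blast
  have "cmod (f z) \<le> exp (\<bar>C\<bar> * r ^ nat \<lceil>a\<rceil>)" if r: "r > 1" and z: "cmod z \<le> r" for r z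
  proof (cases "f z = 0")
    case False
    define S where "S = (SUP z\<in>cball 0 r. cmod (f z))"
    have "compact ((\<lambda>z. cmod (f z)) ` cball 0 r)"
      using hol by (intro compact_continuous_image continuous_on_norm holomorphic_on_imp_continuous_on)
        (auto intro: holomorphic_on_subset)
    then have le: "cmod (f z) \<le> S"
      unfolding S_def using z
      by (intro cSUP_upper) (auto intro: bounded_imp_bdd_above compact_imp_bounded)
    then have "S > 0" using False by (meson zero_less_norm_iff less_le_trans)
    then have "S = exp (ln S)" by simp
    also have "\<dots> \<le> exp (C * r powr a)" using C[OF r] by (simp add: S_def)
    also have "C * r powr a \<le> \<bar>C\<bar> * r powr (nat \<lceil>a\<rceil>)"
      using r a by (intro mult_mono powr_mono) (auto simp: of_nat_ceiling)
    also have "r powr (nat \<lceil>a\<rceil>) = r ^ nat \<lceil>a\<rceil>" using r by (simp add: powr_realpow)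
    finally show ?thesis using le by simp
  qed simp
  then have "0 \<le> \<bar>C\<bar> \<and> (\<forall>r>1. \<forall>z. cmod z \<le> r \<longrightarrow> cmod (f z) \<le> exp (\<bar>C\<bar> * r ^ nat \<lceil>a\<rceil>))"
    by simp
  then show ?thesis by blast
qed

text \<open>The Borel--Caratheodory estimate, via Schwarz for \<open>h / (2 M - h)\<close>.\<close>

lemma deriv_bound_by_Re:
  assumes hol: "G holomorphic_on ball s 1"
    and M: "\<And>w. w \<in> ball s 1 \<Longrightarrow> Re (G w) < M"
  shows "cmod (deriv G s) \<le> 2 * (M - Re (G s))"
proof -
  define m where "m = M - Re (G s)"
  have m: "m > 0" using M[of s] by (simp add: m_def)
  define h where "h w = G (s + w) - G s" for w
  define g where "g w = h w / (2 * m - h w)" for w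
  have Re: "Re (h w) < m" if "cmod w < 1" for w
    using M[of "s + w"] that by (simp add: h_def m_def dist_norm)
  have nz: "2 * m - h w \<noteq> 0" if "cmod w < 1" for w
  proof
    assume "2 * m - h w = 0"
    then have "Re (2 * m - h w) = 0" by simp
    then show False using Re[OF that] m by simp
  qed
  have holh: "h holomorphic_on ball 0 1"
    unfolding h_def
    by (intro holomorphic_intros holomorphic_on_compose_gen[OF _ hol, unfolded o_def])
       (auto simp: dist_norm)
  have holg: "g holomorphic_on ball 0 1"
    unfolding g_def using nz by (intro holomorphic_intros holh) auto
  have "cmod (g w) < 1" if "cmod w < 1" for w
  proof -
    \<comment> \<open>\<open>Re (h w) < m\<close> says that \<open>h w\<close> is closer to 0 than
      to \<open>2 * m\<close>.\<close>
    have "(cmod (h w))\<^sup>2 < (cmod (2 * m - h w))\<^sup>2"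
    proof -
      have "0 < 4 * (m * (m - Re (h w)))" using Re[OF that] m by simp
      then show ?thesis unfolding cmod_power2 by (simp add: power2_eq_square algebra_simps)
    qed
    then have "cmod (h w) < cmod (2 * m - h w)" by (rule power2_less_imp_less) simp
    then show ?thesis using nz[OF that] by (simp add: g_def norm_divide)
  qed
  then have le: "cmod (deriv g 0) \<le> 1"
    by (intro Schwarz_Lemma(2)[OF holg, of 0]) (auto simp: g_def h_def)
  have "(G has_field_derivative deriv G s) (at (0 + s))"
    using holomorphic_derivI[OF hol, of s] by simp
  then have "((\<lambda>w. G (s + w)) has_field_derivative deriv G s) (at 0)"
    unfolding DERIV_shift by (simp only: add.commute)
  then have dh: "(h has_field_derivative deriv G s) (at 0)"
    unfolding h_def by (auto intro!: derivative_eq_intros)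
  have "(g has_field_derivative deriv G s / (2 * m)) (at 0)"
    unfolding g_def
    by (rule derivative_eq_intros dh refl | use m in \<open>simp add: h_def field_simps\<close>)+
  then have "deriv g 0 = deriv G s / (2 * m)" by (rule DERIV_imp_deriv)
  with le have "cmod (deriv G s) / (2 * m) \<le> 1" using m by (simp add: norm_divide norm_mult)
  then show ?thesis using m by (simp add: field_simps m_def)
qed

lemma poly_growth: "\<exists>C. \<forall>z. 1 \<le> cmod z \<longrightarrow> cmod (poly P z) \<le> C * cmod z ^ degree P"
proof -
  have "cmod (poly P z) \<le> (\<Sum>i\<le>degree P. cmod (coeff P i)) * cmod z ^ degree P" if "1 \<le> cmod z" for z
  proof -
    have "cmod (poly P z) \<le> (\<Sum>i\<le>degree P. cmod (coeff P i * z ^ i))"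
      unfolding poly_altdef by (rule norm_sum)
    also have "\<dots> \<le> (\<Sum>i\<le>degree P. cmod (coeff P i) * cmod z ^ degree P)"
      unfolding norm_mult norm_power using that
      by (intro sum_mono mult_left_mono power_increasing) auto
    finally show ?thesis by (simp add: sum_distrib_right)
  qed
  then show ?thesis by blast
qed

lemma entire_poly_growth:
  fixes f :: "complex \<Rightarrow> complex"
  assumes "f holomorphic_on UNIV" "\<And>z. A \<le> cmod z \<Longrightarrow> cmod (f z) \<le> B * cmod z ^ n"
  shows "\<exists>p. f = poly p"
proof -
  define p where "p = (\<Sum>k\<le>n. monom ((deriv ^^ k) f 0 / fact k) k)"
  have "f z = poly p z" for z
    using Liouville_polynomial[OF assms, where ?\<xi> = z] by (simp add: p_def poly_sum poly_monom)
  then show ?thesis by blast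
qed

section \<open>The differential system of a Pell solution\<close>

locale pell_entire =
  fixes X Y :: "complex \<Rightarrow> complex"
  assumes holX: "X holomorphic_on UNIV" and holY: "Y holomorphic_on UNIV"
    and pell: "\<And>z. X z * X z - (z * z - 1) * (Y z * Y z) = 1"
begin

lemma dX: "(X has_field_derivative deriv X z) (at z)"
  using holX by (simp add: holomorphic_derivI)

lemma dY: "(Y has_field_derivative deriv Y z) (at z)"
  using holY by (simp add: holomorphic_derivI)

text \<open>With \<open>U\<close> as below and \<open>z = cosh s\<close>, this is
  \<open>U'(s) * U(- s)\<close>, which is the logarithmic derivative of \<open>U\<close> because
  \<open>U(s) * U(- s) = 1\<close>. The terms with an odd power of \<open>sinh s\<close> cancel by
  \<open>pell_deriv\<close>, which leaves an entire function of \<open>z\<close>.\<close>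

definition q :: "complex \<Rightarrow> complex" where
  "q z = (z * z - 1) * (X z * deriv Y z - deriv X z * Y z) + z * X z * Y z"

lemma pell_deriv: "X z * deriv X z = (z * z - 1) * (Y z * deriv Y z) + z * (Y z * Y z)"
proof -
  have "((\<lambda>z. X z * X z - (z * z - 1) * (Y z * Y z)) has_field_derivative
      (deriv X z * X z + deriv X z * X z
       - ((1 * z + 1 * z) * (Y z * Y z) + (deriv Y z * Y z + deriv Y z * Y z) * (z * z - 1)))) (at z)"
    by (auto intro!: derivative_eq_intros dX dY)
  moreover have "(\<lambda>z. X z * X z - (z * z - 1) * (Y z * Y z)) = (\<lambda>z. 1)"
    by (rule ext) (rule pell)
  ultimately have "((\<lambda>z. 1) has_field_derivative
      (deriv X z * X z + deriv X z * X z
       - ((1 * z + 1 * z) * (Y z * Y z) + (deriv Y z * Y z + deriv Y z * Y z) * (z * z - 1)))) (at z)"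
    by (simp only:)
  then have "deriv X z * X z + deriv X z * X z
       - ((1 * z + 1 * z) * (Y z * Y z) + (deriv Y z * Y z + deriv Y z * Y z) * (z * z - 1)) = 0"
    by (rule DERIV_unique[OF _ DERIV_const])
  then have "2 * (X z * deriv X z - ((z * z - 1) * (Y z * deriv Y z) + z * (Y z * Y z))) = 0"
    by (simp add: algebra_simps)
  then show ?thesis by (metis mult_eq_0_iff zero_neq_numeral right_minus_eq)
qed

text \<open>The factor 1 is inserted in the form of Pell's equation. Together with
  \<open>dY_eq\<close> this is a linear differential system for \<open>X\<close> and
  \<open>Y\<close>, whose coefficients are polynomials as soon as \<open>q\<close> is one.\<close>

lemma dX_eq: "deriv X z = q z * Y z"
proof -
  have "q z * Y z = X z * ((z * z - 1) * (Y z * deriv Y z) + z * (Y z * Y z))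
      - deriv X z * ((z * z - 1) * (Y z * Y z))"
    by (simp add: q_def algebra_simps)
  also have "\<dots> = deriv X z * (X z * X z - (z * z - 1) * (Y z * Y z))"
    unfolding pell_deriv[symmetric] by (simp add: algebra_simps)
  finally show ?thesis by (simp add: pell)
qed

lemma dY_eq: "z * Y z + (z * z - 1) * deriv Y z = q z * X z"
proof -
  have "q z * X z = (z * z - 1) * deriv Y z * (X z * X z) - (z * z - 1) * Y z * (X z * deriv X z)
     + z * Y z * (X z * X z)"
    by (simp add: q_def algebra_simps)
  also have "\<dots> = ((z * z - 1) * deriv Y z + z * Y z) * (X z * X z - (z * z - 1) * (Y z * Y z))"
    unfolding pell_deriv by (simp add: algebra_simps)
  finally show ?thesis by (simp add: pell)
qed

text \<open>The factor \<open>X + sqrt (z\<^sup>2 - 1) * Y\<close> of the Pell form, made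
  single-valued by \<open>z = cosh s\<close>.\<close>

definition U :: "complex \<Rightarrow> complex" where
  "U s = X (cosh s) + sinh s * Y (cosh s)"

lemma sinh_sq: "sinh s * sinh s = cosh s * cosh s - (1 :: complex)"
  using hyperbolic_pythagoras[of s] by (simp add: power2_eq_square algebra_simps)

lemma U_minus: "U s * U (- s) = 1"
proof -
  have "U s * U (- s) = X (cosh s) * X (cosh s) - (sinh s * sinh s) * (Y (cosh s) * Y (cosh s))"
    by (simp add: U_def algebra_simps)
  then show ?thesis using pell[of "cosh s"] by (simp only: sinh_sq)
qed

lemma dU: "(U has_field_derivative q (cosh s) * U s) (at s)"
proof -
  have *: "((\<lambda>s. X (cosh s)) has_field_derivative deriv X (cosh s) * sinh s) (at s)"
    "((\<lambda>s. Y (cosh s)) has_field_derivative deriv Y (cosh s) * sinh s) (at s)"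
    by (rule DERIV_chain2[OF dX] DERIV_chain2[OF dY]; auto intro!: derivative_eq_intros)+
  have "(U has_field_derivative deriv X (cosh s) * sinh s
     + (cosh s * Y (cosh s) + deriv Y (cosh s) * sinh s * sinh s)) (at s)"
    unfolding U_def by (rule derivative_eq_intros * refl | simp)+
  moreover have "deriv X (cosh s) * sinh s
     + (cosh s * Y (cosh s) + deriv Y (cosh s) * sinh s * sinh s)
     = deriv X (cosh s) * sinh s
     + (cosh s * Y (cosh s) + (sinh s * sinh s) * deriv Y (cosh s))"
    by (simp add: algebra_simps)
  moreover have "\<dots> = q (cosh s) * U s"
    unfolding dX_eq sinh_sq dY_eq U_def by (simp add: algebra_simps)
  ultimately show ?thesis by simp
qed

lemma q_hol: "q holomorphic_on UNIV"
  unfolding q_def by (intro holomorphic_intros holX holY) auto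

lemma U_holo: "U holomorphic_on UNIV"
  using dU by (auto simp: holomorphic_on_def field_differentiable_def)

lemma growth_q:
  assumes gX: "\<And>r z. r > 1 \<Longrightarrow> cmod z \<le> r \<Longrightarrow> cmod (X z) \<le> exp (K * r ^ N)"
    and gY: "\<And>r z. r > 1 \<Longrightarrow> cmod z \<le> r \<Longrightarrow> cmod (Y z) \<le> exp (K * r ^ N)"
    and K: "K \<ge> 0"
  shows "\<exists>p. q = poly p"
proof -
  have nz: "U s \<noteq> 0" for s using U_minus[of s] by auto
  obtain G where G: "G holomorphic_on UNIV" "\<And>s. exp (G s) = U s"
    using holomorphic_logarithm_exists[of UNIV U 0] U_holo nz by auto
  have dG: "deriv G s = q (cosh s)" for s
  proof -
    have "(G has_field_derivative deriv G s) (at s)"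
      using G(1) by (simp add: holomorphic_derivI)
    then have "((\<lambda>s. exp (G s)) has_field_derivative exp (G s) * deriv G s) (at s)"
      by (auto intro!: derivative_eq_intros)
    then have "(U has_field_derivative U s * deriv G s) (at s)" by (simp add: G(2))
    from DERIV_unique[OF this dU] show ?thesis using nz by simp
  qed
  \<comment> \<open>The estimate of \<open>U\<close> has the logarithm \<open>r + K * r ^ N\<close>,
    where \<open>r\<close> comes from \<open>1 + r \<le> exp r\<close>; \<open>K + 2\<close> instead
    of \<open>K + 1\<close> makes the bound strict, as \<open>deriv_bound_by_Re\<close>
    requires.\<close>
  define B where "B r = (K + 2) * r ^ Suc N" for r :: real
  have cs: "cmod (cosh s) \<le> exp \<bar>Re s\<bar>" "cmod (sinh s) \<le> exp \<bar>Re s\<bar>" for s :: complex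
  proof -
    have e: "cmod (exp s) \<le> exp \<bar>Re s\<bar>" "cmod (exp (-s)) \<le> exp \<bar>Re s\<bar>" by auto
    have "cmod (exp s + exp (- s)) \<le> 2 * exp \<bar>Re s\<bar>"
      using norm_triangle_ineq[of "exp s" "exp (-s)"] e by linarith
    then show "cmod (cosh s) \<le> exp \<bar>Re s\<bar>" by (simp add: cosh_field_def norm_divide)
    have "cmod (exp s - exp (- s)) \<le> 2 * exp \<bar>Re s\<bar>"
      using norm_triangle_ineq4[of "exp s" "exp (-s)"] e by linarith
    then show "cmod (sinh s) \<le> exp \<bar>Re s\<bar>" by (simp add: sinh_field_def norm_divide)
  qed
  have UB: "cmod (U s) < exp (B r)" if r: "r > 1" "exp \<bar>Re s\<bar> \<le> r" for s r
  proof -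
    have c: "cmod (cosh s) \<le> r" "cmod (sinh s) \<le> r" using cs[of s] r by linarith+
    have "cmod (U s) \<le> exp (K * r ^ N) + r * exp (K * r ^ N)"
      unfolding U_def using gX[OF r(1) c(1)] gY[OF r(1) c(1)] c(2) r
      by (intro order_trans[OF norm_triangle_ineq] add_mono)
         (auto simp: norm_mult intro!: mult_mono)
    also have "\<dots> = (1 + r) * exp (K * r ^ N)" by (simp add: algebra_simps)
    also have "\<dots> \<le> exp r * exp (K * r ^ N)"
      by (intro mult_right_mono exp_ge_add_one_self) auto
    also have "\<dots> = exp (r + K * r ^ N)" by (simp add: exp_add)
    also have "\<dots> < exp (B r)"
    proof -
      have "r ^ N \<le> r ^ Suc N" "r \<le> r ^ Suc N"
        using r power_increasing[of 1 "Suc N" r] by (auto intro: power_increasing)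
      then have "r + K * r ^ N \<le> r ^ Suc N + K * r ^ Suc N"
        using K by (intro add_mono mult_left_mono)
      also have "\<dots> < B r" using r by (simp add: B_def algebra_simps)
      finally show ?thesis by simp
    qed
    finally show ?thesis .
  qed
  have ReG: "Re (G s) < B r" if "r > 1" "exp \<bar>Re s\<bar> \<le> r" for s r
    using UB[OF that] unfolding G(2)[symmetric] by simp
  \<comment> \<open>The lower bound is the upper bound at \<open>- s\<close>, because
    \<open>U(s) * U(- s) = 1\<close>.\<close>
  have ReG': "Re (G s) > - B r" if "r > 1" "exp \<bar>Re s\<bar> \<le> r" for s r
  proof -
    have "exp (Re (G s) + Re (G (- s))) = cmod (exp (G s) * exp (G (- s)))"
      by (simp add: norm_mult exp_add)
    also have "\<dots> = 1" by (simp add: G(2) U_minus)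
    finally have "Re (G s) + Re (G (- s)) = 0" by simp
    moreover have "Re (G (- s)) < B r" using that by (intro ReG) auto
    ultimately show ?thesis by linarith
  qed
  \<comment> \<open>The bounds depend on \<open>s\<close> only through its real part, which changes
    by less than 1 on the unit disc.\<close>
  have qb: "cmod (q (cosh s)) \<le> 4 * B (exp (\<bar>Re s\<bar> + 1))" for s
  proof -
    define r where "r = exp (\<bar>Re s\<bar> + 1)"
    have r: "r > 1" by (simp add: r_def)
    have "Re (G w) < B r" if "w \<in> ball s 1" for w
    proof (rule ReG[OF r])
      have "\<bar>Re (w - s)\<bar> \<le> cmod (w - s)" by (rule abs_Re_le_cmod)
      then have "\<bar>Re w\<bar> \<le> \<bar>Re s\<bar> + 1" using that by (simp add: dist_norm norm_minus_commute)
      then show "exp \<bar>Re w\<bar> \<le> r" by (simp add: r_def)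
    qed
    then have "cmod (deriv G s) \<le> 2 * (B r - Re (G s))"
      using G(1) by (intro deriv_bound_by_Re) (auto intro: holomorphic_on_subset)
    moreover have "Re (G s) > - B r" by (intro ReG' r) (simp add: r_def)
    ultimately show ?thesis by (simp add: dG r_def)
  qed
  have "cmod (q z) \<le> (4 * (K + 2) * (3 * exp 1) ^ Suc N) * cmod z ^ Suc N" if z: "1 \<le> cmod z" for z
  proof -
    obtain s where s: "cosh s = z" using cosh_surj by blast
    \<comment> \<open>This returns from \<open>s\<close> to \<open>z\<close>:
      \<open>exp \<bar>Re s\<bar>\<close> is at most a multiple of \<open>cmod (cosh s)\<close>, so
      the bound for \<open>q\<close> is a power of \<open>cmod z\<close>.\<close>
    have "exp \<bar>Re s\<bar> - exp (- \<bar>Re s\<bar>) \<le> cmod (exp s + exp (- s))"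
      using norm_diff_ineq[of "exp s" "exp (- s)"] norm_diff_ineq[of "exp (- s)" "exp s"]
      by (cases "Re s \<ge> 0") (simp_all add: add.commute)
    also have "\<dots> = 2 * cmod z" using s by (auto simp: cosh_field_def norm_divide)
    finally have "exp \<bar>Re s\<bar> \<le> 2 * cmod z + 1"
      using exp_le_one_iff[of "- \<bar>Re s\<bar>"] by linarith
    with z have e: "exp \<bar>Re s\<bar> \<le> 3 * cmod z" by linarith
    have "exp (\<bar>Re s\<bar> + 1) ^ Suc N \<le> (3 * exp 1 * cmod z) ^ Suc N"
      using e by (intro power_mono) (auto simp: exp_add)
    then have "4 * B (exp (\<bar>Re s\<bar> + 1)) \<le> 4 * ((K + 2) * (3 * exp 1 * cmod z) ^ Suc N)"
      unfolding B_def using K by (intro mult_left_mono) auto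
    also have "\<dots> = (4 * (K + 2) * (3 * exp 1) ^ Suc N) * cmod z ^ Suc N"
      by (simp only: power_mult_distrib mult.assoc)
    finally show ?thesis using qb[of s] s by simp
  qed
  then show ?thesis by (rule entire_poly_growth[OF q_hol])
qed

text \<open>Differentiate \<open>X' = p Y\<close>, multiply by \<open>(z\<^sup>2 - 1) p\<close>, and
  eliminate \<open>Y\<close> and \<open>Y'\<close> with \<open>dX_eq\<close> and
  \<open>dY_eq\<close>. The result is \<open>(z\<^sup>2 - 1) p X'' + (z p - (z\<^sup>2 - 1) p') X' -
  p\<^sup>3 X = 0\<close>, with nonzero leading coefficient because
  \<open>p \<noteq> 0\<close>.\<close>

lemma holonomic_X:
  assumes "q = poly p" "p \<noteq> 0"
  shows "holonomic X"
proof -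
  define F where "F = fps_expansion X 0"
  have F: "X has_fps_expansion F"
    unfolding F_def using holX by (intro has_fps_expansion_fps_expansion[of UNIV]) auto
  define P :: "nat \<Rightarrow> complex poly" where "P = (\<lambda>i. if i = 0 then - (p * p * p) else
     if i = 1 then [:0, 1:] * p - [:-1, 0, 1:] * pderiv p else [:-1, 0, 1:] * p)"
  have fp: "poly r has_fps_expansion fps_of_poly r" for r
    by (simp add: has_fps_expansion_def)
  have 1: "(\<lambda>z. poly (P 0) z * X z + poly (P 1) z * deriv X z + poly (P 2) z * deriv (deriv X) z)
     has_fps_expansion (fps_of_poly (P 0) * F + fps_of_poly (P 1) * fps_deriv F
       + fps_of_poly (P 2) * fps_deriv (fps_deriv F))"
    by (intro has_fps_expansion_add has_fps_expansion_mult fp has_fps_expansion_deriv F)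
  have ddX: "deriv (deriv X) z = poly (pderiv p) z * Y z + q z * deriv Y z" for z
  proof (rule DERIV_imp_deriv)
    have "(\<lambda>z. q z * Y z) = deriv X" by (rule ext) (simp add: dX_eq)
    moreover have "((\<lambda>z. q z * Y z) has_field_derivative poly (pderiv p) z * Y z + deriv Y z * q z) (at z)"
      unfolding assms(1) by (rule derivative_intros poly_DERIV dY)+
    ultimately show "(deriv X has_field_derivative poly (pderiv p) z * Y z + q z * deriv Y z) (at z)"
      by (simp add: mult.commute)
  qed
  have "poly (P 0) z * X z + poly (P 1) z * deriv X z + poly (P 2) z * deriv (deriv X) z = 0" for z
  proof -
    have "poly (P 0) z = - (q z * q z * q z)"
      "poly (P 1) z = z * q z - (z * z - 1) * poly (pderiv p) z"
      "poly (P 2) z = (z * z - 1) * q z"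
      by (simp_all add: P_def assms(1) algebra_simps)
    then have "poly (P 0) z * X z + poly (P 1) z * deriv X z + poly (P 2) z * deriv (deriv X) z =
       q z * q z * (z * Y z + (z * z - 1) * deriv Y z) - q z * q z * (q z * X z)"
      unfolding ddX dX_eq by (simp only: ) (simp add: algebra_simps)
    then show ?thesis by (simp add: dY_eq)
  qed
  with 1 have "(\<lambda>z. 0) has_fps_expansion (fps_of_poly (P 0) * F + fps_of_poly (P 1) * fps_deriv F
       + fps_of_poly (P 2) * fps_deriv (fps_deriv F))" by simp
  then have "fps_of_poly (P 0) * F + fps_of_poly (P 1) * fps_deriv F
       + fps_of_poly (P 2) * fps_deriv (fps_deriv F) = 0"
    using fps_expansion_unique_complex has_fps_expansion_0 by blast
  then have "(\<Sum>i\<le>2. fps_of_poly (P i) * (fps_deriv ^^ i) F) = 0"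
    by (simp add: numeral_2_eq_2)
  moreover have "P 2 \<noteq> 0" using assms(2) by (simp add: P_def del: mult_pCons_left)
  ultimately show ?thesis
    unfolding holonomic_def holonomic_fps_def F_def[symmetric]
    by (intro exI[of _ 2] conjI exI[of _ P]) auto
qed

end

section \<open>Classification of the Pell solutions\<close>

text \<open>For \<open>p \<noteq> 0\<close> and \<open>n = degree P\<close>, the first equation
  gives \<open>degree p + degree R = n - 1\<close> and the second
  \<open>degree p + n \<le> degree R + 1\<close>; so \<open>p\<close> is a constant \<open>c\<close>
  and \<open>degree R = n - 1\<close>. Comparing leading coefficients \<open>x\<close> of
  \<open>P\<close> and \<open>y\<close> of \<open>R\<close> gives \<open>n x = c y\<close> and
  \<open>n y = c x\<close>, hence \<open>c\<^sup>2 = n\<^sup>2\<close>.\<close>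

lemma poly_pell_degree:
  fixes P R p :: "complex poly"
  assumes P: "P \<noteq> 0" and 1: "pderiv P = p * R"
    and 2: "[:0, 1:] * R + [:-1, 0, 1:] * pderiv R = p * P"
  shows "\<exists>n::int. p = [:of_int n:]"
proof (cases "p = 0")
  case False
  have R: "R \<noteq> 0"
  proof
    assume "R = 0"
    with 2 have "p * P = 0" by simp
    with False P show False by simp
  qed
  define n where "n = degree P"
  have "pderiv P \<noteq> 0" using 1 False R by simp
  then have n: "n > 0" by (simp add: n_def pderiv_eq_0_iff)
  have dR: "degree p + degree R = n - 1"
    using arg_cong[OF 1, of degree] False R by (simp add: degree_mult_eq degree_pderiv n_def)
  have "degree ([:0, 1:] * R) \<le> Suc (degree R)"
    by (rule order_trans[OF degree_mult_le]) simp
  moreover have "degree ([:-1, 0, 1:] * pderiv R) \<le> Suc (degree R)"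
  proof (cases "degree R = 0")
    case True
    then have "pderiv R = 0" by (simp add: pderiv_eq_0_iff)
    then show ?thesis by simp
  next
    case False
    then show ?thesis using degree_mult_le[of "[:-1, 0, 1:]" "pderiv R"]
      by (simp add: degree_pderiv)
  qed
  ultimately have "degree (p * P) \<le> Suc (degree R)"
    unfolding 2[symmetric] by (rule degree_add_le)
  then have "degree p + n \<le> Suc (degree R)" using False P by (simp add: degree_mult_eq n_def)
  with dR n have dp: "degree p = 0" and dR: "degree R = n - 1" by linarith+
  obtain c where c: "p = [:c:]" using dp by (rule degree_eq_zeroE)
  obtain m where m: "n = Suc m" using n by (cases n) auto
  have a: "of_nat n * coeff P n = c * coeff R m"
    using arg_cong[OF 1, of "\<lambda>p. coeff p m"] by (simp add: c coeff_pderiv m)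
  have b: "coeff R m + of_nat m * coeff R m = c * coeff P n"
  proof -
    have "coeff ([:0, 1:] * R) n = coeff R m" by (simp add: m)
    moreover have "coeff ([:-1, 0, 1:] * pderiv R) n = of_nat m * coeff R m"
    proof -
      have "coeff R (Suc n) = 0" using dR m by (intro coeff_eq_0) simp
      moreover have "coeff (pderiv R) n = 0"
        using \<open>coeff R (Suc n) = 0\<close> by (simp add: coeff_pderiv)
      ultimately show ?thesis by (cases m) (simp_all add: m coeff_pderiv)
    qed
    ultimately show ?thesis using arg_cong[OF 2, of "\<lambda>p. coeff p n"] by (simp add: c)
  qed
  have b': "of_nat n * coeff R m = c * coeff P n" using b by (simp add: m algebra_simps)
  have "of_nat n * of_nat n * coeff P n = c * c * coeff P n"
  proof -
    have "of_nat n * of_nat n * coeff P n = c * (of_nat n * coeff R m)"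
      unfolding mult.assoc a by (simp only: mult.left_commute)
    then show ?thesis by (simp add: b')
  qed
  moreover have "coeff P n \<noteq> 0" using P by (simp add: n_def)
  ultimately have "(c - of_nat n) * (c + of_nat n) = 0" by (simp add: algebra_simps)
  then have "c = of_nat n \<or> c = - of_nat n" by (auto simp: add_eq_0_iff)
  then have "c = of_int (int n) \<or> c = of_int (- int n)" by simp
  then show ?thesis using c by blast
qed (auto intro: exI[of _ 0])

lemma const_if_deriv_0:
  fixes f :: "complex \<Rightarrow> complex"
  assumes "\<And>z. (f has_field_derivative 0) (at z)"
  shows "\<exists>c. \<forall>z. f z = c"
  using has_field_derivative_zero_constant[of UNIV f] assms by auto

text \<open>For \<open>cmod z \<ge> 2\<close> the factor \<open>z * z - 1\<close> has modulus at
  least 1, so Pell's equation bounds \<open>Y\<close> by \<open>X\<close>.\<close>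

lemma (in pell_entire) Y_poly:
  assumes "X = poly P" shows "\<exists>R. Y = poly R"
proof -
  obtain C where C: "\<And>z. 1 \<le> cmod z \<Longrightarrow> cmod (poly P z) \<le> C * cmod z ^ degree P"
    using poly_growth by blast
  have "cmod (Y z) \<le> (\<bar>C\<bar> + 1) * cmod z ^ degree P" if z: "2 \<le> cmod z" for z
  proof -
    have "4 \<le> cmod z * cmod z" using z mult_mono[of 2 "cmod z" 2 "cmod z"] by simp
    then have "1 \<le> cmod (z * z) - cmod 1" by (simp add: norm_mult)
    then have z1: "1 \<le> cmod (z * z - 1)" using norm_triangle_ineq2[of "z * z" 1] by linarith
    have "cmod (Y z) * cmod (Y z) \<le> cmod (z * z - 1) * (cmod (Y z) * cmod (Y z))"
      using mult_right_mono[OF z1, of "cmod (Y z) * cmod (Y z)"] by simp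
    also have "\<dots> = cmod (X z * X z - 1)"
    proof -
      have "X z * X z - 1 = (z * z - 1) * (Y z * Y z)" using pell[of z] by (simp add: algebra_simps)
      then show ?thesis by (simp only: norm_mult)
    qed
    also have "\<dots> \<le> cmod (X z) * cmod (X z) + 1"
      using norm_triangle_ineq4[of "X z * X z" 1] by (simp add: norm_mult)
    also have "\<dots> \<le> (cmod (X z) + 1) * (cmod (X z) + 1)" by (simp add: algebra_simps)
    finally have "cmod (Y z) \<le> cmod (X z) + 1"
      by (metis abs_norm_cancel abs_of_nonneg norm_ge_zero add_nonneg_nonneg zero_le_one
          abs_le_square_iff power2_eq_square)
    also have "\<dots> \<le> \<bar>C\<bar> * cmod z ^ degree P + 1 * cmod z ^ degree P"
    proof (intro add_mono)
      have "C * cmod z ^ degree P \<le> \<bar>C\<bar> * cmod z ^ degree P" by (intro mult_right_mono) auto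
      then show "cmod (X z) \<le> \<bar>C\<bar> * cmod z ^ degree P" using C[of z] z assms by simp
    qed (use z in simp)
    finally show ?thesis by (simp add: algebra_simps)
  qed
  then show ?thesis by (rule entire_poly_growth[OF holY])
qed

lemma (in pell_entire) poly_solution:
  assumes "X = poly P" "q = poly p" "X 1 = 1"
  shows "\<exists>n::int. Y 1 = of_int n \<and> (\<forall>s. U s = exp (of_int n * s))"
proof -
  obtain R where R: "Y = poly R" using Y_poly[OF assms(1)] by blast
  have dP: "deriv X z = poly (pderiv P) z" "deriv Y z = poly (pderiv R) z" for z
    unfolding assms(1) R by (rule DERIV_imp_deriv[OF poly_DERIV])+
  have "P \<noteq> 0" using assms(1,3) by auto
  moreover have "poly (pderiv P) z = poly (p * R) z" for z
  proof -
    have "deriv X z = poly p z * Y z" using dX_eq[of z] by (simp only: fun_cong[OF assms(2)])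
    then show ?thesis unfolding dP by (simp add: R)
  qed
  then have "pderiv P = p * R" by (intro poly_ext)
  moreover have "poly ([:0, 1:] * R + [:-1, 0, 1:] * pderiv R) z = poly (p * P) z" for z
  proof -
    have "z * Y z + (z * z - 1) * deriv Y z = poly p z * X z"
      using dY_eq[of z] by (simp only: fun_cong[OF assms(2)])
    then show ?thesis unfolding dP by (simp add: R assms(1) algebra_simps)
  qed
  then have "[:0, 1:] * R + [:-1, 0, 1:] * pderiv R = p * P" by (intro poly_ext)
  ultimately obtain n :: int where n: "p = [:of_int n:]" using poly_pell_degree by blast
  then have q: "q z = of_int n" for z by (simp add: assms(2))
  \<comment> \<open>At the point 1 the derivative term of \<open>dY_eq\<close> is multiplied by
    0.\<close>
  have Y1: "Y 1 = of_int n" using dY_eq[of 1] by (simp add: q assms(3))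
  have "((\<lambda>s. U s * exp (- (of_int n * s))) has_field_derivative 0) (at s)" for s
  proof -
    have "((\<lambda>s. U s * exp (- (of_int n * s))) has_field_derivative
      of_int n * U s * exp (- (of_int n * s)) + exp (- (of_int n * s)) * - of_int n * U s) (at s)"
      using dU[of s] unfolding q by (auto intro!: derivative_eq_intros)
    then show ?thesis by (simp add: algebra_simps)
  qed
  then obtain c where c: "\<And>s. U s * exp (- (of_int n * s)) = c"
    using const_if_deriv_0 by blast
  have "U 0 = 1" by (simp add: U_def assms(3))
  with c[of 0] have "c = 1" by simp
  with c have "U s = exp (of_int n * s)" for s
    by (metis exp_minus_inverse mult.assoc mult.commute mult_1 exp_minus)
  with Y1 show ?thesis by blast
qed

lemma pell_classification:
  assumes A: "A \<subseteq> H_fin" "{f \<in> A. holonomic f} = range poly"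
    and XY: "X \<in> A" "Y \<in> A"
    and pell: "\<And>z. X z * X z - (z * z - 1) * (Y z * Y z) = 1" and X1: "X 1 = 1"
  shows "\<exists>n::int. Y 1 = of_int n \<and>
     (\<forall>s. X (cosh s) + sinh s * Y (cosh s) = exp (of_int n * s))"
proof -
  interpret pell_entire X Y
    by unfold_locales (use A(1) XY pell in \<open>auto simp: H_fin_def\<close>)
  obtain K N where K: "K \<ge> 0" "\<And>r z. r > 1 \<Longrightarrow> cmod z \<le> r \<Longrightarrow> cmod (X z) \<le> exp (K * r ^ N)"
    using H_fin_growth[of X] A(1) XY by blast
  obtain K' N' where K': "K' \<ge> 0" "\<And>r z. r > 1 \<Longrightarrow> cmod z \<le> r \<Longrightarrow> cmod (Y z) \<le> exp (K' * r ^ N')"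
    using H_fin_growth[of Y] A(1) XY by blast
  have le: "exp (k * r ^ m) \<le> exp (max K K' * r ^ max N N')"
    if "r > 1" "k \<le> max K K'" "m \<le> max N N'" "k \<ge> 0" for r k m
    unfolding exp_le_cancel_iff using that by (intro mult_mono power_increasing) auto
  have "\<exists>p. q = poly p"
  proof (rule growth_q)
    show "max K K' \<ge> 0" using K by simp
    show "cmod (X z) \<le> exp (max K K' * r ^ max N N')" if "r > 1" "cmod z \<le> r" for r z
      using order_trans[OF K(2)[OF that] le[of r K N]] that K(1) by simp
    show "cmod (Y z) \<le> exp (max K K' * r ^ max N N')" if "r > 1" "cmod z \<le> r" for r z
      using order_trans[OF K'(2)[OF that] le[of r K' N']] that K'(1) by simp
  qed
  then obtain p where p: "q = poly p" by blast
  have "\<exists>P. X = poly P"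
  proof (cases "p = 0")
    case True
    \<comment> \<open>For \<open>p = 0\<close> the equation of \<open>holonomic_X\<close>
      degenerates, but \<open>X' = q Y\<close> vanishes and \<open>X\<close> is constant.\<close>
    then have "(X has_field_derivative 0) (at z)" for z
      using dX[of z] by (simp add: dX_eq p)
    then obtain c where "\<And>z. X z = c" using const_if_deriv_0 by blast
    then have "X = poly [:c:]" by auto
    then show ?thesis by blast
  next
    case False
    then have "X \<in> range poly" using holonomic_X[OF p] XY A(2) by blast
    then show ?thesis by blast
  qed
  then show ?thesis using poly_solution[OF _ p X1] unfolding U_def by blast
qed

text \<open>These are the Chebyshev polynomials of the first and second kind. The induction step is
  multiplication by \<open>exp s = cosh s + sinh s\<close>, and negative \<open>n\<close> are
  reached by the substitution of \<open>- s\<close> for \<open>s\<close>, which changes the sign of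
  \<open>R\<close>.\<close>

lemma pell_exists:
  "\<exists>P R. (\<forall>s. poly P (cosh s) + sinh s * poly R (cosh s) = exp (of_int n * s)) \<and>
     poly P 1 = 1 \<and> poly R 1 = (of_int n :: complex)"
proof -
  have nat: "\<exists>P R. (\<forall>s. poly P (cosh s) + sinh s * poly R (cosh s) = exp (of_nat n * s)) \<and>
     poly P 1 = 1 \<and> poly R 1 = (of_nat n :: complex)" for n
  proof (induction n)
    case 0
    show ?case by (rule exI[of _ 1], rule exI[of _ 0]) simp
  next
    case (Suc n)
    then obtain P R :: "complex poly" where PR: "\<And>s. poly P (cosh s) + sinh s * poly R (cosh s)
        = exp (of_nat n * s)"
      "poly P 1 = 1" "poly R 1 = of_nat n" by blast
    have "poly ([:0, 1:] * P + [:-1, 0, 1:] * R) (cosh s) + sinh s * poly (P + [:0, 1:] * R) (cosh s)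
      = exp (of_nat (Suc n) * s)" for s
    proof -
      have "poly ([:0, 1:] * P + [:-1, 0, 1:] * R) (cosh s) + sinh s * poly (P + [:0, 1:] * R) (cosh s)
        = cosh s * poly P (cosh s) + (cosh s * cosh s - 1) * poly R (cosh s)
          + sinh s * poly P (cosh s) + sinh s * cosh s * poly R (cosh s)"
        by (simp add: algebra_simps)
      also have "cosh s * cosh s - 1 = sinh s * sinh s"
        using hyperbolic_pythagoras[of s] by (simp add: power2_eq_square algebra_simps)
      also have "cosh s * poly P (cosh s) + (sinh s * sinh s) * poly R (cosh s)
          + sinh s * poly P (cosh s) + sinh s * cosh s * poly R (cosh s)
        = (cosh s + sinh s) * (poly P (cosh s) + sinh s * poly R (cosh s))"
        by (simp add: algebra_simps)
      also have "\<dots> = exp s * exp (of_nat n * s)" by (simp add: PR cosh_plus_sinh)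
      finally show ?thesis by (simp add: exp_add[symmetric] algebra_simps)
    qed
    moreover have "poly ([:0, 1:] * P + [:-1, 0, 1:] * R) 1 = 1"
      "poly (P + [:0, 1:] * R) 1 = of_nat (Suc n)" by (simp_all add: PR)
    ultimately show ?case by blast
  qed
  show ?thesis
  proof (cases "n \<ge> 0")
    case True
    then show ?thesis using nat[of "nat n"] by simp
  next
    case False
    then obtain m where m: "n = - int m" by (metis int_cases2 of_nat_0_le_iff)
    obtain P R :: "complex poly" where PR: "\<And>s. poly P (cosh s) + sinh s * poly R (cosh s)
        = exp (of_nat m * s)"
      "poly P 1 = 1" "poly R 1 = of_nat m" using nat[of m] by blast
    have "poly P (cosh s) + sinh s * poly (- R) (cosh s) = exp (of_int n * s)" for s
      using PR(1)[of "- s"] by (simp add: m)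
    then show ?thesis using PR m by (intro exI[of _ P] exI[of _ "- R"]) auto
  qed
qed

lemma cosh_sinh_pell:
  fixes X Y :: "complex \<Rightarrow> complex"
  assumes "\<And>s. X (cosh s) + sinh s * Y (cosh s) = exp (c * s)"
  shows "X z * X z - (z * z - 1) * (Y z * Y z) = 1"
proof -
  obtain s where s: "cosh s = z" using cosh_surj by blast
  have "X z + sinh s * Y z = exp (c * s)" "X z - sinh s * Y z = exp (- (c * s))"
    using assms[of s] assms[of "- s"] by (simp_all add: s)
  then have "(X z + sinh s * Y z) * (X z - sinh s * Y z) = 1"
    by (simp add: exp_minus)
  moreover have "sinh s * sinh s = z * z - 1"
    using hyperbolic_pythagoras[of s] by (simp add: power2_eq_square algebra_simps s)
  moreover have "(X z + sinh s * Y z) * (X z - sinh s * Y z)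
      = X z * X z - (sinh s * sinh s) * (Y z * Y z)"
    by (simp add: algebra_simps)
  ultimately show ?thesis by simp
qed

text \<open>With a primitive cube root of unity \<open>w\<close>, the equation says that three
  linear forms in \<open>f\<close> and \<open>g\<close> have product 1, so none has a zero. The
  quotient \<open>h\<close> of two of them omits 0, and it omits \<open>1 + w\<close> because of the
  third; so it is constant by little Picard.\<close>

lemma fermat_cubic_const:
  assumes f: "f holomorphic_on UNIV" and g: "g holomorphic_on UNIV"
    and eq: "\<And>z::complex. f z ^ 3 + g z ^ 3 = (1::complex)"
  shows "\<exists>c. f = (\<lambda>_. c)"
proof -
  define w where "w = cis (2 * pi / 3)"
  have "2 * pi / 3 + 2 * pi / 3 + 2 * pi / 3 = 2 * pi" by simp
  then have wcube: "w ^ 3 = 1" unfolding w_def power3_eq_cube cis_mult by (simp only: cis_2pi)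
  have w1: "w \<noteq> 1"
  proof
    assume "w = 1"
    then have "cos (2 * pi / 3) = 1" unfolding w_def by (metis cis.simps(1) one_complex.simps(1))
    then show False by (simp add: cos_120)
  qed
  have "w ^ 3 - 1 = (w - 1) * (1 + w + w * w)" by (simp add: algebra_simps power3_eq_cube)
  with wcube w1 have w: "1 + w + w * w = 0" by simp
  have w3: "w * w * w = 1" using wcube by (simp add: power3_eq_cube)
  have fac: "(f z + g z) * (f z + w * g z) * (f z + w * w * g z) = 1" for z
  proof -
    have "(f z + g z) * (f z + w * g z) * (f z + w * w * g z)
      = f z ^ 3 + (1 + w + w * w) * (f z * f z * g z) + w * (1 + w + w * w) * (f z * g z * g z)
        + w * w * w * g z ^ 3"
      by (simp add: algebra_simps power3_eq_cube)
    then show ?thesis by (simp add: w w3 eq)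
  qed
  have nz: "f z + g z \<noteq> 0" "f z + w * g z \<noteq> 0" "f z + w * w * g z \<noteq> 0" for z
    using fac[of z] by auto
  define h where "h z = (f z + w * g z) / (f z + g z)" for z
  have h: "h holomorphic_on UNIV" unfolding h_def using nz by (intro holomorphic_intros f g) auto
  have h0: "h z \<noteq> 0" for z using nz by (simp add: h_def)
  \<comment> \<open>\<open>h z = 1 + w\<close> means \<open>w * f z + g z = 0\<close>, and this is
    the third linear form up to the factor \<open>w * w\<close>.\<close>
  have h1: "h z \<noteq> 1 + w" for z
  proof
    assume "h z = 1 + w"
    then have "f z + w * g z = (1 + w) * (f z + g z)" using nz(1)[of z]
        by (simp add: h_def field_simps)
    then have "w * f z + g z = 0" by (simp add: algebra_simps)
    then have "w * w * (w * f z + g z) = 0" by simp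
    moreover have "w * w * (w * f z + g z) = (w * w * w) * f z + w * w * g z"
      by (simp add: algebra_simps)
    ultimately have "f z + w * w * g z = 0" by (simp add: w3)
    with nz show False by blast
  qed
  have "0 \<noteq> 1 + w" using w by auto
  moreover have "range h \<inter> {0, 1 + w} = {}"
  proof (rule equals0I)
    fix t assume "t \<in> range h \<inter> {0, 1 + w}"
    then obtain z where "h z = 0 \<or> h z = 1 + w" by auto
    then show False using h0[of z] h1[of z] by blast
  qed
  ultimately obtain c where c: "h = (\<lambda>_. c)" using little_Picard[OF h] by blast
  \<comment> \<open>All three factors are constant multiples of \<open>f + g\<close>, whose cube is therefore constant.\<close>
  define s where "s z = f z + g z" for z
  have s: "s holomorphic_on UNIV" unfolding s_def by (intro holomorphic_intros f g)
  have 1: "f z + w * g z = c * s z" for z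
    using fun_cong[OF c, of z] nz(1)[of z] by (simp add: h_def s_def field_simps)
  have 2: "f z + w * w * g z = - (w + w * w * c) * s z" for z
  proof -
    have "f z + w * w * g z = - (w * s z + w * w * (f z + w * g z)) + (1 + w + w * w) * f z
        + w * (1 + w + w * w) * g z"
      by (simp add: s_def algebra_simps)
    then show ?thesis unfolding 1 w by (simp add: algebra_simps)
  qed
  have cube: "s z ^ 3 * (c * - (w + w * w * c)) = 1" for z
    using fac[of z] unfolding 1 2 s_def[symmetric] by (simp add: power3_eq_cube algebra_simps)
  then have k: "c * - (w + w * w * c) \<noteq> 0" by (metis mult_zero_right zero_neq_one)
  have s0: "s z \<noteq> 0" for z using cube[of z] by auto
  have "(s has_field_derivative 0) (at z)" for z
  proof -
    have ds: "(s has_field_derivative deriv s z) (at z)"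
      using s by (simp add: holomorphic_derivI)
    have "((\<lambda>z. s z ^ 3) has_field_derivative 3 * s z ^ 2 * deriv s z) (at z)"
      by (rule derivative_eq_intros ds refl | simp)+
    moreover have "(\<lambda>z. s z ^ 3) = (\<lambda>z. 1 / (c * - (w + w * w * c)))"
      using cube k by (auto simp: nonzero_eq_divide_eq)
    ultimately have "3 * s z ^ 2 * deriv s z = 0" by (metis DERIV_const DERIV_unique)
    then show ?thesis using ds s0 by simp
  qed
  then obtain d where d: "\<And>z. s z = d" using const_if_deriv_0 by blast
  have "f z = (w - c) / (w - 1) * d" for z
  proof -
    have "(w - 1) * f z = w * s z - (f z + w * g z)" by (simp add: s_def algebra_simps)
    also have "\<dots> = (w - c) * d" unfolding 1 d by (simp add: algebra_simps)
    finally show ?thesis using w1 by (simp add: field_simps)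
  qed
  then show ?thesis by (intro exI[of _ "(w - c) / (w - 1) * d"]) (rule ext)
qed

section \<open>Positive existential relations over a ring of functions\<close>

fun sub_term :: "(nat \<Rightarrow> lz_term) \<Rightarrow> lz_term \<Rightarrow> lz_term" where
  "sub_term \<sigma> TZero = TZero"
| "sub_term \<sigma> TOne = TOne"
| "sub_term \<sigma> TZ = TZ"
| "sub_term \<sigma> (TVar i) = \<sigma> i"
| "sub_term \<sigma> (TAdd s t) = TAdd (sub_term \<sigma> s) (sub_term \<sigma> t)"
| "sub_term \<sigma> (TMul s t) = TMul (sub_term \<sigma> s) (sub_term \<sigma> t)"

lemma eval_sub_term: "eval_term v (sub_term \<sigma> t) = eval_term (\<lambda>i. eval_term v (\<sigma> i)) t"
  by (induction t) simp_all

definition term_fun :: "((nat \<Rightarrow> cfun) \<Rightarrow> cfun) \<Rightarrow> bool" where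
  "term_fun F \<longleftrightarrow> (\<exists>t. \<forall>v. F v = eval_term v t)"

lemma term_fun_var: "term_fun (\<lambda>v. v i)"
  unfolding term_fun_def by (rule exI[of _ "TVar i"]) simp

lemma term_fun_0: "term_fun (\<lambda>v. 0)"
  unfolding term_fun_def by (rule exI[of _ TZero]) simp

lemma term_fun_1: "term_fun (\<lambda>v. 1)"
  unfolding term_fun_def by (rule exI[of _ TOne]) simp

lemma term_fun_z: "term_fun (\<lambda>v z. z)"
  unfolding term_fun_def by (rule exI[of _ TZ]) simp

lemma term_fun_add: "term_fun F \<Longrightarrow> term_fun G \<Longrightarrow> term_fun (\<lambda>v. F v + G v)"
  unfolding term_fun_def by (metis eval_term.simps(5))

lemma term_fun_mult: "term_fun F \<Longrightarrow> term_fun G \<Longrightarrow> term_fun (\<lambda>v. F v * G v)"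
  unfolding term_fun_def by (metis eval_term.simps(6))

lemma term_fun_if: "(P \<Longrightarrow> term_fun F) \<Longrightarrow> (\<not> P \<Longrightarrow> term_fun G) \<Longrightarrow> term_fun (\<lambda>v. if P then F v else G v)"
  by (cases P) auto

lemmas term_fun_rules
    = term_fun_var term_fun_0 term_fun_1 term_fun_z term_fun_add term_fun_mult term_fun_if

definition eqs_hold :: "(nat \<Rightarrow> cfun) \<Rightarrow> (lz_term \<times> lz_term) list \<Rightarrow> bool" where
  "eqs_hold v E \<longleftrightarrow> (\<forall>(s, t)\<in>set E. eval_term v s = eval_term v t)"

definition sub_eqs :: "(nat \<Rightarrow> lz_term) \<Rightarrow> (lz_term \<times> lz_term) list \<Rightarrow> (lz_term \<times> lz_term) list" where
  "sub_eqs \<sigma> = map (\<lambda>(s, t). (sub_term \<sigma> s, sub_term \<sigma> t))"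

lemma eqs_hold_sub: "eqs_hold v (sub_eqs \<sigma> E) \<longleftrightarrow> eqs_hold (\<lambda>i. eval_term v (\<sigma> i)) E"
  by (auto simp: eqs_hold_def sub_eqs_def eval_sub_term)

lemma eqs_hold_append: "eqs_hold v (E @ E') \<longleftrightarrow> eqs_hold v E \<and> eqs_hold v E'"
  by (auto simp: eqs_hold_def)

text \<open>A plain list of equations, without disjunctions, so that it translates both into a
  formula and into a system of polynomial equations. Disjunctions have been absorbed into
  polynomials by \<open>diophantine_disj\<close>.\<close>

definition pe_rel :: "cfun set \<Rightarrow> ((nat \<Rightarrow> cfun) \<Rightarrow> bool) \<Rightarrow> bool" where
  "pe_rel A R \<longleftrightarrow> (\<exists>m E. \<forall>v. (\<forall>i. v i \<in> A) \<longrightarrow>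
     (R v \<longleftrightarrow> (\<exists>u. (\<forall>i. u i \<in> A) \<and> eqs_hold (glue m u v) E)))"

lemma pe_rel_I:
  "(\<And>v. (\<And>i. v i \<in> A) \<Longrightarrow> R v \<longleftrightarrow> (\<exists>u. (\<forall>i. u i \<in> A) \<and> eqs_hold (glue m u v) E)) \<Longrightarrow> pe_rel A R"
  unfolding pe_rel_def by blast

lemma pe_rel_E:
  assumes "pe_rel A R"
  obtains m E where "\<And>v. (\<And>i. v i \<in> A) \<Longrightarrow> R v \<longleftrightarrow> (\<exists>u. (\<forall>i. u i \<in> A) \<and> eqs_hold (glue m u v) E)"
  using assms unfolding pe_rel_def by blast

lemma pe_rel_eq_nonempty:
  assumes "term_fun F" "term_fun G" and A: "A \<noteq> {}"
  shows "pe_rel A (\<lambda>v. F v = G v)"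
proof -
  obtain s t where "\<And>v. F v = eval_term v s" "\<And>v. G v = eval_term v t"
    using assms unfolding term_fun_def by metis
  then show ?thesis using A by (intro pe_rel_I[of _ _ 0 "[(s, t)]"]) (auto simp: eqs_hold_def)
qed

lemma pe_rel_conj:
  assumes "pe_rel A R1" "pe_rel A R2"
  shows "pe_rel A (\<lambda>v. R1 v \<and> R2 v)"
proof -
  obtain m E where R: "\<And>v. (\<And>i. v i \<in> A) \<Longrightarrow> R1 v \<longleftrightarrow> (\<exists>u. (\<forall>i. u i \<in> A) \<and> eqs_hold (glue m u v) E)"
    using assms(1) by (auto elim: pe_rel_E)
  obtain m' E' where R': "\<And>v. (\<And>i. v i \<in> A) \<Longrightarrow> R2 v \<longleftrightarrow> (\<exists>u. (\<forall>i. u i \<in> A)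
      \<and> eqs_hold (glue m' u v) E')"
    using assms(2) by (auto elim: pe_rel_E)
  define \<sigma> where "\<sigma> = (\<lambda>i. if i < m then TVar i else TVar (i + m'))"
  define \<sigma>' where "\<sigma>' = (\<lambda>i. TVar (i + m))"
  have e: "(\<lambda>i. eval_term (glue (m + m') u v) (\<sigma> i)) = glue m u v" for u v
    by (auto simp: \<sigma>_def glue_def)
  have e': "(\<lambda>i. eval_term (glue (m + m') u v) (\<sigma>' i)) = glue m' (\<lambda>i. u (i + m)) v" for u v
    by (auto simp: \<sigma>'_def glue_def)
  show ?thesis
  proof (rule pe_rel_I[of _ _ "m + m'" "sub_eqs \<sigma> E @ sub_eqs \<sigma>' E'"])
    fix v :: "nat \<Rightarrow> cfun" assume v: "\<And>i. v i \<in> A"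
    show "R1 v \<and> R2 v \<longleftrightarrow> (\<exists>u. (\<forall>i. u i \<in> A) \<and>
        eqs_hold (glue (m + m') u v) (sub_eqs \<sigma> E @ sub_eqs \<sigma>' E'))" (is "_ \<longleftrightarrow> ?R")
      unfolding R[OF v] R'[OF v] eqs_hold_append eqs_hold_sub e e'
    proof
      assume "(\<exists>u. (\<forall>i. u i \<in> A) \<and> eqs_hold (glue m u v) E) \<and>
        (\<exists>u. (\<forall>i. u i \<in> A) \<and> eqs_hold (glue m' u v) E')"
      then obtain u u' where u: "\<forall>i. u i \<in> A" "\<forall>i. u' i \<in> A"
        "eqs_hold (glue m u v) E" "eqs_hold (glue m' u' v) E'" by blast
      define w where "w = glue m u u'"
      have 1: "glue m w v = glue m u v" "(\<lambda>i. w (i + m)) = u'" and 2: "\<forall>i. w i \<in> A"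
        using u by (auto simp: w_def glue_def)
      show "\<exists>u. (\<forall>i. u i \<in> A) \<and> eqs_hold (glue m u v) E \<and>
        eqs_hold (glue m' (\<lambda>i. u (i + m)) v) E'"
        by (rule exI[of _ w]) (simp only: 1, intro conjI 2 u)
    next
      assume "\<exists>u. (\<forall>i. u i \<in> A) \<and> eqs_hold (glue m u v) E \<and>
        eqs_hold (glue m' (\<lambda>i. u (i + m)) v) E'"
      then obtain u where u: "\<forall>i. u i \<in> A" "eqs_hold (glue m u v) E"
        "eqs_hold (glue m' (\<lambda>i. u (i + m)) v) E'" by blast
      show "(\<exists>u. (\<forall>i. u i \<in> A) \<and> eqs_hold (glue m u v) E) \<and>
        (\<exists>u. (\<forall>i. u i \<in> A) \<and> eqs_hold (glue m' u v) E')"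
        by (intro conjI, rule exI[of _ u], simp add: u, rule exI[of _ "\<lambda>i. u (i + m)"], simp add: u)
    qed
  qed
qed

lemma pe_rel_ex:
  assumes "pe_rel A (\<lambda>v. P (v 0) (\<lambda>i. v (Suc i)))"
  shows "pe_rel A (\<lambda>v. \<exists>x\<in>A. P x v)"
proof -
  obtain m E where R: "\<And>v. (\<And>i. v i \<in> A) \<Longrightarrow>
      P (v 0) (\<lambda>i. v (Suc i)) \<longleftrightarrow> (\<exists>u. (\<forall>i. u i \<in> A) \<and> eqs_hold (glue m u v) E)"
    using assms by (auto elim: pe_rel_E)
  show ?thesis
  proof (rule pe_rel_I[of _ _ "Suc m" E])
    fix v :: "nat \<Rightarrow> cfun" assume v: "\<And>i. v i \<in> A"
    have P: "P x v \<longleftrightarrow> (\<exists>u. (\<forall>i. u i \<in> A) \<and> eqs_hold (glue m u (case_nat x v)) E)" if "x \<in> A" for x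
      using R[of "case_nat x v"] v that by (simp split: nat.splits)
    show "(\<exists>x\<in>A. P x v) \<longleftrightarrow> (\<exists>u. (\<forall>i. u i \<in> A) \<and> eqs_hold (glue (Suc m) u v) E)"
    proof
      assume "\<exists>x\<in>A. P x v"
      then obtain x u where u: "x \<in> A" "\<forall>i. u i \<in> A" "eqs_hold (glue m u (case_nat x v)) E"
        using P by blast
      have "glue m u (case_nat x v) = glue (Suc m) (u(m := x)) v"
        by (subst glue_Suc[symmetric]) (auto simp: glue_def)
      moreover have "\<forall>i. (u(m := x)) i \<in> A" using u by auto
      ultimately show "\<exists>u. (\<forall>i. u i \<in> A) \<and> eqs_hold (glue (Suc m) u v) E" using u by metis
    next
      assume "\<exists>u. (\<forall>i. u i \<in> A) \<and> eqs_hold (glue (Suc m) u v) E"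
      then show "\<exists>x\<in>A. P x v" unfolding glue_Suc[symmetric] using P by blast
    qed
  qed
qed

section \<open>Natural numbers as constant functions\<close>

definition const_fun :: "complex \<Rightarrow> cfun" where "const_fun c = (\<lambda>_. c)"

lemma const_fun_arith:
  "const_fun a + const_fun b = const_fun (a + b)" "const_fun a * const_fun b = const_fun (a * b)" "0
      = const_fun 0" "1 = const_fun 1"
  by (auto simp: const_fun_def fun_eq_iff)

lemma const_fun_inject: "const_fun a = const_fun b \<longleftrightarrow> a = b"
  by (auto simp: const_fun_def fun_eq_iff)

lemma term_fun_nat: "term_fun (\<lambda>v. const_fun (of_nat n))"
proof (induction n)
  case 0
  show ?case using term_fun_0 by (simp add: const_fun_arith)
next
  case (Suc n)
  show ?case using term_fun_add[OF Suc term_fun_1] by (simp add: const_fun_arith add.commute)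
qed

text \<open>Nothing is claimed about \<open>R'\<close> away from natural constants; quantified
  variables are confined to them in \<open>nat_pe_rel_ex\<close>.\<close>

definition nat_pe_rel :: "cfun set \<Rightarrow> ((nat \<Rightarrow> nat) \<Rightarrow> bool) \<Rightarrow> bool" where
  "nat_pe_rel A R \<longleftrightarrow> (\<exists>R'. pe_rel A R' \<and> (\<forall>x. R x \<longleftrightarrow> R' (\<lambda>i. const_fun (of_nat (x i)))))"

lemma polyfun_term_fun:
  "polyfun F \<Longrightarrow> \<exists>F'. term_fun F' \<and> (\<forall>x. F' (\<lambda>i. const_fun (of_nat (x i)))
      = const_fun (of_nat (F x)))"
proof (induction rule: polyfun.induct)
  case (polyfun_var i)
  show ?case by (rule exI[of _ "\<lambda>v. v i"]) (simp add: term_fun_var)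
next
  case (polyfun_const c)
  show ?case by (rule exI[of _ "\<lambda>v. const_fun (of_nat c)"]) (simp add: term_fun_nat)
next
  case (polyfun_add F G)
  then obtain F' G' where "term_fun F'" "term_fun G'" "\<And>x. F' (\<lambda>i. const_fun (of_nat (x i)))
      = const_fun (of_nat (F x))"
    "\<And>x. G' (\<lambda>i. const_fun (of_nat (x i))) = const_fun (of_nat (G x))" by blast
  then show ?case
    by (intro exI[of _ "\<lambda>v. F' v + G' v"] conjI term_fun_add allI) (simp_all only: const_fun_arith(1) of_nat_add)
next
  case (polyfun_mult F G)
  then obtain F' G' where "term_fun F'" "term_fun G'" "\<And>x. F' (\<lambda>i. const_fun (of_nat (x i)))
      = const_fun (of_nat (F x))"
    "\<And>x. G' (\<lambda>i. const_fun (of_nat (x i))) = const_fun (of_nat (G x))" by blast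
  then show ?case
    by (intro exI[of _ "\<lambda>v. F' v * G' v"] conjI term_fun_mult allI) (simp_all only: const_fun_arith(2) of_nat_mult)
qed

locale poly_ring =
  fixes A :: "cfun set"
  assumes subring: "is_subring A" and polys: "range poly \<subseteq> A"
begin

lemma closed: "0 \<in> A" "1 \<in> A" "f \<in> A \<Longrightarrow> g \<in> A \<Longrightarrow> f + g \<in> A" "f \<in> A \<Longrightarrow> g \<in> A \<Longrightarrow> f * g \<in> A"
  using subring by (auto simp: is_subring_def)

lemma poly_in: "poly p \<in> A"
  using polys by blast

lemma z_in: "(\<lambda>z. z) \<in> A"
proof -
  have "poly [:0, 1:] = (\<lambda>z::complex. z)" by auto
  then show ?thesis using poly_in by metis
qed

lemma const_fun_in: "const_fun c \<in> A"
proof -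
  have "poly [:c:] = const_fun c" by (auto simp: const_fun_def)
  then show ?thesis using poly_in by metis
qed

lemma eval_in: "(\<And>i. v i \<in> A) \<Longrightarrow> eval_term v t \<in> A"
  by (induction t) (auto simp: closed z_in)

lemma term_fun_in: "term_fun F \<Longrightarrow> (\<And>i. v i \<in> A) \<Longrightarrow> F v \<in> A"
  unfolding term_fun_def using eval_in by metis

lemma pe_rel_eq: "term_fun F \<Longrightarrow> term_fun G \<Longrightarrow> pe_rel A (\<lambda>v. F v = G v)"
  using pe_rel_eq_nonempty closed(1) by blast

lemma pe_rel_subst:
  assumes "pe_rel A R" and S: "\<And>i. term_fun (S i)"
  shows "pe_rel A (\<lambda>v. R (\<lambda>i. S i v))"
proof -
  obtain m E where R: "\<And>v. (\<And>i. v i \<in> A) \<Longrightarrow> R v \<longleftrightarrow> (\<exists>u. (\<forall>i. u i \<in> A) \<and> eqs_hold (glue m u v) E)"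
    using assms(1) by (auto elim: pe_rel_E)
  obtain \<sigma> where \<sigma>: "\<And>i v. S i v = eval_term v (\<sigma> i)" using S unfolding term_fun_def by metis
  define \<tau> where "\<tau> = (\<lambda>i. if i < m then TVar i else sub_term (\<lambda>j. TVar (j + m)) (\<sigma> (i - m)))"
  have e: "(\<lambda>i. eval_term (glue m u v) (\<tau> i)) = glue m u (\<lambda>i. S i v)" for u v
    by (auto simp: \<tau>_def glue_def eval_sub_term \<sigma>)
  show ?thesis
    using R[of "\<lambda>i. S i v" for v] term_fun_in[OF S]
    by (intro pe_rel_I[of _ _ m "sub_eqs \<tau> E"]) (simp add: eqs_hold_sub e)
qed

lemma nat_pe_rel_I: "pe_rel A R' \<Longrightarrow> (\<And>x. R x \<longleftrightarrow> R' (\<lambda>i. const_fun (of_nat (x i)))) \<Longrightarrow> nat_pe_rel A R"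
  unfolding nat_pe_rel_def by blast

lemma nat_pe_rel_eq:
  assumes "polyfun F" "polyfun G" shows "nat_pe_rel A (\<lambda>v. F v = G v)"
proof -
  obtain F' G' where FG: "term_fun F'" "term_fun G'" "\<And>x. F' (\<lambda>i. const_fun (of_nat (x i)))
      = const_fun (of_nat (F x))"
    "\<And>x. G' (\<lambda>i. const_fun (of_nat (x i))) = const_fun (of_nat (G x))"
        using polyfun_term_fun assms by metis
  then show ?thesis by (intro nat_pe_rel_I[OF pe_rel_eq[OF FG(1,2)]]) (simp add: const_fun_inject)
qed

lemma nat_pe_rel_conj:
  assumes "nat_pe_rel A R" "nat_pe_rel A S" shows "nat_pe_rel A (\<lambda>v. R v \<and> S v)"
proof -
  obtain R' S' where "pe_rel A R'" "pe_rel A S'" "\<And>x. R x \<longleftrightarrow> R' (\<lambda>i. const_fun (of_nat (x i)))"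
    "\<And>x. S x \<longleftrightarrow> S' (\<lambda>i. const_fun (of_nat (x i)))" using assms unfolding nat_pe_rel_def by metis
  then show ?thesis by (intro nat_pe_rel_I[OF pe_rel_conj[of A R' S']]) auto
qed

lemma nat_pe_rel_subst:
  assumes "nat_pe_rel A R" "\<And>i. polyfun (S i)" shows "nat_pe_rel A (\<lambda>v. R (\<lambda>i. S i v))"
proof -
  obtain R' where R: "pe_rel A R'" "\<And>x. R x \<longleftrightarrow> R' (\<lambda>i. const_fun (of_nat (x i)))"
    using assms unfolding nat_pe_rel_def by metis
  obtain S' where S: "\<And>i. term_fun (S' i)" "\<And>i x. S' i (\<lambda>i. const_fun (of_nat (x i)))
      = const_fun (of_nat (S i x))"
    using polyfun_term_fun[OF assms(2)] by metis
  show ?thesis by (intro nat_pe_rel_I[OF pe_rel_subst[of R' S']] R S) (simp add: R(2) S(2))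
qed

end

text \<open>The congruences modulo \<open>z - 1\<close> say \<open>X(1) = 1\<close> and \<open>Y(1) = f(1)\<close>.\<close>

definition pell_pair :: "cfun set \<Rightarrow> cfun \<Rightarrow> cfun \<Rightarrow> cfun \<Rightarrow> bool" where
  "pell_pair A f X Y \<longleftrightarrow> X * X + Y * Y = 1 + (\<lambda>z. z) * (\<lambda>z. z) * (Y * Y)
     \<and> (\<exists>W\<in>A. X + W = 1 + (\<lambda>z. z) * W) \<and> (\<exists>V\<in>A. Y + V = f + (\<lambda>z. z) * V)"

text \<open>The Pell pair makes \<open>f(1)\<close> an integer, and the cubic equation makes
  \<open>f\<close> constant. Every constant passes the cubic test, because complex numbers have cube
  roots.\<close>

definition is_int_const :: "cfun set \<Rightarrow> cfun \<Rightarrow> bool" where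
  "is_int_const A f \<longleftrightarrow> (\<exists>g\<in>A. f * f * f + g * g * g = 1) \<and> (\<exists>X\<in>A. \<exists>Y\<in>A. pell_pair A f X Y)"

text \<open>Here \<open>c = 1 / b\<close>, so that \<open>a = cosh t\<close> and \<open>s = sinh t\<close> for \<open>b = exp t\<close>; modulo \<open>z - a\<close> the
  function \<open>X + s Y\<close> is then \<open>X(cosh t) + sinh t Y(cosh t) = exp (n t)\<close>.\<close>

definition exp_rel :: "cfun set \<Rightarrow> cfun \<Rightarrow> cfun \<Rightarrow> cfun \<Rightarrow> bool" where
  "exp_rel A b n p \<longleftrightarrow> (\<exists>X\<in>A. \<exists>Y\<in>A. pell_pair A n X Y \<and> (\<exists>c\<in>A. b * c = 1 \<and>
     (\<exists>a\<in>A. \<exists>s\<in>A. a + s = b \<and> a = s + c \<and> (\<exists>g\<in>A. X + s * Y + a * g = p + (\<lambda>z. z) * g))))"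

text \<open>An integer \<open>n\<close> is nonnegative if and only if \<open>2\<^sup>n\<close> is an integer.\<close>

definition is_nat_const :: "cfun set \<Rightarrow> cfun \<Rightarrow> bool" where
  "is_nat_const A f \<longleftrightarrow> is_int_const A f \<and> (\<exists>p\<in>A. is_int_const A p \<and> exp_rel A (1 + 1) f p)"

lemma poly_root_quotient:
  fixes p :: "complex poly"
  assumes "poly p a = 0" shows "\<exists>r. \<forall>z. poly p z = (z - a) * poly r z"
proof -
  obtain r where "p = [:- a, 1:] * r" using assms by (auto simp: poly_eq_0_iff_dvd dvd_def)
  then have "poly p z = (z - a) * poly r z" for z by (simp only: poly_mult) simp
  then show ?thesis by blast
qed

lemma complex_cube_root: "\<exists>w. w * w * w = (x :: complex)"
proof (cases "x = 0")
  case False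
  have "exp (Ln x / 3) * exp (Ln x / 3) * exp (Ln x / 3) = exp (Ln x / 3 + Ln x / 3 + Ln x / 3)"
    by (simp only: exp_add)
  also have "\<dots> = x" using False by simp
  finally show ?thesis by blast
qed auto

lemma exp_int_Ln: "b \<noteq> 0 \<Longrightarrow> exp (of_int n * Ln b) = b powi n"
  using complex_powr_of_int[of b n] by (simp add: powr_def)

context poly_ring
begin

lemma pe_rel_pell_pair:
  "term_fun F \<Longrightarrow> term_fun G \<Longrightarrow> term_fun H \<Longrightarrow> pe_rel A (\<lambda>v. pell_pair A (F v) (G v) (H v))"
proof -
  assume FGH: "term_fun F" "term_fun G" "term_fun H"
  have "pe_rel A (\<lambda>v. pell_pair A (v 0) (v 1) (v 2))"
    unfolding pell_pair_def by (intro pe_rel_ex pe_rel_conj pe_rel_eq term_fun_rules)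
  from pe_rel_subst[OF this, of "\<lambda>i. if i = 0 then F else if i = 1 then G else H"] FGH show ?thesis
    by simp
qed

lemma pe_rel_int_const: "term_fun F \<Longrightarrow> pe_rel A (\<lambda>v. is_int_const A (F v))"
proof -
  assume F: "term_fun F"
  have "pe_rel A (\<lambda>v. is_int_const A (v 0))"
    unfolding is_int_const_def
        by (intro pe_rel_ex pe_rel_conj pe_rel_pell_pair pe_rel_eq term_fun_rules)
  from pe_rel_subst[OF this, of "\<lambda>i. F"] F show ?thesis by simp
qed

lemma pe_rel_exp_rel:
  "term_fun F \<Longrightarrow> term_fun G \<Longrightarrow> term_fun H \<Longrightarrow> pe_rel A (\<lambda>v. exp_rel A (F v) (G v) (H v))"
proof -
  assume FGH: "term_fun F" "term_fun G" "term_fun H"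
  have "pe_rel A (\<lambda>v. exp_rel A (v 0) (v 1) (v 2))"
    unfolding exp_rel_def by (intro pe_rel_ex pe_rel_conj pe_rel_pell_pair pe_rel_eq term_fun_rules)
  from pe_rel_subst[OF this, of "\<lambda>i. if i = 0 then F else if i = 1 then G else H"] FGH show ?thesis
    by simp
qed

lemma pe_rel_nat_const: "pe_rel A (\<lambda>v. is_nat_const A (v i))"
  unfolding is_nat_const_def
      by (intro pe_rel_ex pe_rel_conj pe_rel_int_const pe_rel_exp_rel term_fun_rules)

end

section \<open>Integers, exponentials and natural numbers inside the ring\<close>

locale finite_order_ring = poly_ring +
  assumes fin: "A \<subseteq> H_fin" and hol: "{f \<in> A. holonomic f} = range poly"
begin

lemma pell_pair_imp:
  assumes "X \<in> A" "Y \<in> A" "pell_pair A f X Y"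
  shows "\<exists>n::int. f 1 = of_int n \<and> (\<forall>s. X (cosh s) + sinh s * Y (cosh s) = exp (of_int n * s))"
proof -
  have "X z * X z + Y z * Y z = 1 + z * z * (Y z * Y z)" for z
    using assms(3) unfolding pell_pair_def by (auto dest: fun_cong[of _ _ z])
  then have pell: "X z * X z - (z * z - 1) * (Y z * Y z) = 1" for z
    by (simp add: algebra_simps)
  obtain W V where "X + W = 1 + (\<lambda>z. z) * W" "Y + V = f + (\<lambda>z. z) * V"
    using assms(3) unfolding pell_pair_def by blast
  then have "X 1 = 1" "Y 1 = f 1" by (auto dest: fun_cong[of _ _ 1])
  then show ?thesis using pell_classification[OF fin hol assms(1,2) pell] by simp
qed

lemma pell_pair_exists:
  "\<exists>P R. pell_pair A (const_fun (of_int n)) (poly P) (poly R) \<and>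
     (\<forall>s. poly P (cosh s) + sinh s * poly R (cosh s) = exp (of_int n * s))"
proof -
  obtain P R :: "complex poly" where PR: "\<And>s. poly P (cosh s) + sinh s * poly R (cosh s)
      = exp (of_int n * s)"
    "poly P 1 = 1" "poly R 1 = of_int n" using pell_exists by blast
  obtain W where W: "\<And>z. poly (P - [:1:]) z = (z - 1) * poly W z"
    using poly_root_quotient[of "P - [:1:]" 1] PR by auto
  obtain V where V: "\<And>z. poly (R - [:of_int n:]) z = (z - 1) * poly V z"
    using poly_root_quotient[of "R - [:of_int n:]" 1] PR by auto
  have "pell_pair A (const_fun (of_int n)) (poly P) (poly R)"
    unfolding pell_pair_def
  proof (intro conjI)
    show "poly P * poly P + poly R * poly R = 1 + (\<lambda>z. z) * (\<lambda>z. z) * (poly R * poly R)"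
      using cosh_sinh_pell[of "poly P" "poly R", OF PR(1)] by (auto simp: fun_eq_iff algebra_simps)
    show "\<exists>W\<in>A. poly P + W = 1 + (\<lambda>z. z) * W"
      using W by (intro bexI[OF _ poly_in[of W]]) (auto simp: fun_eq_iff algebra_simps)
    show "\<exists>V\<in>A. poly R + V = const_fun (of_int n) + (\<lambda>z. z) * V"
      using V by (intro bexI[OF _ poly_in[of V]]) (auto simp: fun_eq_iff const_fun_def algebra_simps)
  qed
  with PR show ?thesis by blast
qed

lemma is_int_const_iff:
  assumes "f \<in> A" shows "is_int_const A f \<longleftrightarrow> (\<exists>n::int. f = const_fun (of_int n))"
proof
  assume f: "is_int_const A f"
  then obtain g where g: "g \<in> A" "f * f * f + g * g * g = 1" unfolding is_int_const_def by blast
  have "f z ^ 3 + g z ^ 3 = 1" for z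
    using fun_cong[OF g(2), of z] by (simp add: power3_eq_cube)
  moreover have "f holomorphic_on UNIV" "g holomorphic_on UNIV"
    using assms g fin by (auto simp: H_fin_def)
  ultimately obtain c where "f = (\<lambda>_. c)" using fermat_cubic_const by blast
  then have c: "f = const_fun c" by (simp add: const_fun_def)
  obtain n :: int where "f 1 = of_int n" using f pell_pair_imp unfolding is_int_const_def by blast
  then show "\<exists>n::int. f = const_fun (of_int n)" using c by (auto simp: const_fun_def)
next
  assume "\<exists>n::int. f = const_fun (of_int n)"
  then obtain n :: int where n: "f = const_fun (of_int n)" by blast
  obtain w :: complex where "w * w * w = 1 - of_int n * of_int n * of_int n"
    using complex_cube_root by blast
  then have "f * f * f + const_fun w * const_fun w * const_fun w = 1"
      by (simp add: n const_fun_def fun_eq_iff)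
  then show "is_int_const A f" unfolding is_int_const_def n
    using pell_pair_exists[of n] const_fun_in poly_in by blast
qed

lemma exp_rel_iff:
  assumes b: "b \<noteq> 0"
  shows "exp_rel A (const_fun b) (const_fun (of_int n)) (const_fun p) \<longleftrightarrow> p = b powi n"
proof
  assume "exp_rel A (const_fun b) (const_fun (of_int n)) (const_fun p)"
  then obtain X Y c a s g where XY: "X \<in> A" "Y \<in> A" "pell_pair A (const_fun (of_int n)) X Y"
    and e: "const_fun b * c = 1" "a + s = const_fun b" "a = s + c" "X + s * Y + a * g
        = const_fun p + (\<lambda>z. z) * g"
    unfolding exp_rel_def by blast
  obtain m :: int where "const_fun (of_int n) 1 = (of_int m :: complex)"
    and U: "\<And>s. X (cosh s) + sinh s * Y (cosh s) = exp (of_int m * s)"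
    using pell_pair_imp[OF XY] by blast
  then have m: "m = n" by (simp add: const_fun_def)
  define t where "t = Ln b"
  have t: "exp t = b" "exp (- t) = 1 / b" using b by (simp_all add: t_def exp_minus field_simps)
  have "c z = 1 / b" for z using fun_cong[OF e(1), of z] b by (simp add: const_fun_def field_simps)
  then have sum: "a z + s z = b" "a z - s z = 1 / b" for z
    using fun_cong[OF e(2), of z] fun_cong[OF e(3), of z] by (simp_all add: const_fun_def)
  have "a z = ((a z + s z) + (a z - s z)) / 2" "s z = ((a z + s z) - (a z - s z)) / 2" for z
    by simp_all
  then have as: "a z = cosh t" "s z = sinh t" for z
    unfolding sum by (simp_all add: cosh_field_def sinh_field_def t)
  \<comment> \<open>At the point \<open>cosh t\<close> the two terms with \<open>g\<close>
    cancel.\<close>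
  have "p = X (cosh t) + sinh t * Y (cosh t)"
    using fun_cong[OF e(4), of "cosh t"] by (simp add: as const_fun_def)
  then show "p = b powi n" using exp_int_Ln[OF b, of n] by (simp add: U m t_def)
next
  assume p: "p = b powi n"
  obtain P R where PR: "pell_pair A (const_fun (of_int n)) (poly P) (poly R)"
    "\<And>s. poly P (cosh s) + sinh s * poly R (cosh s) = exp (of_int n * s)"
    using pell_pair_exists by blast
  define t where "t = Ln b"
  have t: "exp t = b" "exp (- t) = 1 / b" using b by (simp_all add: t_def exp_minus field_simps)
  \<comment> \<open>This root lets \<open>z - cosh t\<close> be split off; the quotient serves as
    the witness \<open>g\<close>.\<close>
  have "poly (P + [:sinh t:] * R - [:p:]) (cosh t) = 0"
    using PR(2)[of t] exp_int_Ln[OF b, of n] by (simp add: t_def p)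
  then obtain r where r: "\<And>z. poly (P + [:sinh t:] * R - [:p:]) z = (z - cosh t) * poly r z"
    using poly_root_quotient by blast
  show "exp_rel A (const_fun b) (const_fun (of_int n)) (const_fun p)"
    unfolding exp_rel_def
  proof (intro bexI conjI)
    show "pell_pair A (const_fun (of_int n)) (poly P) (poly R)" by fact
    show "const_fun b * const_fun (1 / b) = 1" using b by (simp add: const_fun_arith)
    show "const_fun (cosh t) + const_fun (sinh t) = const_fun b"
        by (simp add: const_fun_arith(1) cosh_plus_sinh t)
    have "cosh t = sinh t + 1 / b" by (simp add: cosh_field_def sinh_field_def t field_simps)
    then show "const_fun (cosh t) = const_fun (sinh t) + const_fun (1 / b)"
        by (simp only: const_fun_arith(1))
    show "poly P + const_fun (sinh t) * poly R + const_fun (cosh t) * poly r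
        = const_fun p + (\<lambda>z. z) * poly r"
      using r by (auto simp: fun_eq_iff const_fun_def algebra_simps)
  qed (rule poly_in const_fun_in)+
qed

lemma is_nat_const_iff:
  assumes "f \<in> A" shows "is_nat_const A f \<longleftrightarrow> (\<exists>n::nat. f = const_fun (of_nat n))"
proof
  have two: "1 + 1 = const_fun 2" by (simp add: const_fun_def fun_eq_iff)
  assume f: "is_nat_const A f"
  then obtain n :: int where n: "f = const_fun (of_int n)"
    using is_int_const_iff[OF assms] unfolding is_nat_const_def by blast
  from f obtain p where p: "p \<in> A" "is_int_const A p" "exp_rel A (1 + 1) f p"
      unfolding is_nat_const_def by blast
  obtain k :: int where k: "p = const_fun (of_int k)" using is_int_const_iff p by blast
  have e: "of_int k = (2 :: complex) powi n" using p(3) exp_rel_iff[of 2 n]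
      unfolding k n two by simp
  have "n \<ge> 0"
  proof (rule ccontr)
    assume "\<not> n \<ge> 0"
    then obtain m where m: "n = - int (Suc m)" by (metis int_cases not_le of_nat_0_le_iff)
    have "of_int k * (2 :: complex) ^ Suc m = 1"
      unfolding e m power_int_minus power_int_of_nat by simp
    then have "of_int (k * 2 ^ Suc m) = (of_int 1 :: complex)" by simp
    then have "k * 2 ^ Suc m = 1" by (simp only: of_int_eq_iff)
    then have "2 dvd (1 :: int)" by (metis dvd_mult dvd_power zero_less_Suc)
    then show False by simp
  qed
  then show "\<exists>n::nat. f = const_fun (of_nat n)" using n by (intro exI[of _ "nat n"]) simp
next
  have two: "1 + 1 = const_fun 2" by (simp add: const_fun_def fun_eq_iff)
  assume "\<exists>n::nat. f = const_fun (of_nat n)"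
  then obtain n :: nat where n: "f = const_fun (of_nat n)" by blast
  then have n': "f = const_fun (of_int (int n))" by simp
  have "is_int_const A (const_fun (of_int (2 ^ n)))" using is_int_const_iff const_fun_in by blast
  moreover have "exp_rel A (1 + 1) f (const_fun (of_int (2 ^ n)))"
    unfolding two n' by (subst exp_rel_iff) auto
  moreover have "is_int_const A f" using is_int_const_iff[OF assms] n' by blast
  ultimately show "is_nat_const A f" unfolding is_nat_const_def using const_fun_in by blast
qed

text \<open>Quantifiers of the ring range over all of \<open>A\<close>, so the quantified function
  is required to satisfy \<open>is_nat_const\<close>.\<close>

lemma nat_pe_rel_ex:
  assumes "nat_pe_rel A (\<lambda>v. P (v 0) (\<lambda>i. v (Suc i)))"
  shows "nat_pe_rel A (\<lambda>v. \<exists>x. P x v)"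
proof -
  obtain R' where R': "pe_rel A R'"
    "\<And>v. P (v 0) (\<lambda>i. v (Suc i)) \<longleftrightarrow> R' (\<lambda>i. const_fun (of_nat (v i)))"
    using assms unfolding nat_pe_rel_def by blast
  have P: "P x v \<longleftrightarrow> R' (case_nat (const_fun (of_nat x)) (\<lambda>i. const_fun (of_nat (v i))))" for x v
  proof -
    have "(\<lambda>i. const_fun (of_nat (case_nat x v i)))
        = case_nat (const_fun (of_nat x)) (\<lambda>i. const_fun (of_nat (v i)))"
      by (auto split: nat.splits)
    then show ?thesis using R'(2)[of "case_nat x v"] by simp
  qed
  have "case_nat (v 0) (\<lambda>i. v (Suc i)) = v" for v :: "nat \<Rightarrow> cfun" by (auto split: nat.splits)
  then have "pe_rel A (\<lambda>v. \<exists>f\<in>A. is_nat_const A f \<and> R' (case_nat f v))"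
    by (intro pe_rel_ex pe_rel_conj pe_rel_nat_const) (simp add: R'(1))
  moreover have "(\<exists>x. P x v) \<longleftrightarrow> (\<exists>f\<in>A. is_nat_const A f
      \<and> R' (case_nat f (\<lambda>i. const_fun (of_nat (v i)))))" for v
    unfolding P using is_nat_const_iff const_fun_in by metis
  ultimately show ?thesis by (intro nat_pe_rel_I) auto
qed

text \<open>The base is a successor because \<open>exp_rel\<close> describes powers of nonzero
  constants only.\<close>

lemma nat_pe_rel_exp:
  assumes "polyfun F" "polyfun G" "polyfun H"
  shows "nat_pe_rel A (\<lambda>v. F v = Suc (G v) ^ H v)"
proof -
  have "f = Suc g ^ h \<longleftrightarrow> exp_rel A (const_fun (of_nat g) + 1) (const_fun (of_nat h)) (const_fun (of_nat f))" for f g h :: nat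
  proof -
    have c: "const_fun (of_nat g) + 1 = const_fun (of_nat g + 1)"
        by (simp add: const_fun_def fun_eq_iff)
    have nz: "of_nat g + 1 \<noteq> (0 :: complex)" by (metis of_nat_Suc of_nat_neq_0 add.commute)
    have "exp_rel A (const_fun (of_nat g) + 1) (const_fun (of_int (int h))) (const_fun (of_nat f))
      \<longleftrightarrow> of_nat f = (of_nat (Suc g) :: complex) ^ h"
      unfolding c exp_rel_iff[OF nz] power_int_of_nat by (simp add: add.commute)
    also have "\<dots> \<longleftrightarrow> f = Suc g ^ h" by (metis of_nat_power of_nat_eq_iff)
    finally show ?thesis by simp
  qed
  then have "nat_pe_rel A (\<lambda>v. v 0 = Suc (v 1) ^ v 2)"
    by (rule nat_pe_rel_I[OF pe_rel_exp_rel[OF term_fun_add[OF term_fun_var term_fun_1] term_fun_var term_fun_var]])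
  from nat_pe_rel_subst[OF this, of "\<lambda>i. if i = 0 then F else if i
      = 1 then G else H"] assms show ?thesis
    by simp
qed

section \<open>Arithmetic relations obtained from exponentiation\<close>

lemma nat_pe_rel_le: "polyfun F \<Longrightarrow> polyfun G \<Longrightarrow> nat_pe_rel A (\<lambda>v. F v \<le> G v)"
  unfolding le_iff_add
  by (intro nat_pe_rel_ex nat_pe_rel_eq polyfun_add polyfun_var) (erule polyfun_shift)+

lemma nat_pe_rel_less: "polyfun F \<Longrightarrow> polyfun G \<Longrightarrow> nat_pe_rel A (\<lambda>v. F v < G v)"
  unfolding less_eq_Suc_le by (intro nat_pe_rel_le polyfun_Suc)

lemma nat_pe_rel_choose:
  assumes "polyfun F" "polyfun G" "polyfun H"
  shows "nat_pe_rel A (\<lambda>v. F v = (G v choose H v))"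
proof -
  \<comment> \<open>\<open>choose_digit\<close> in base \<open>Suc w\<close>, which exceeds
    \<open>w = 2 ^ n\<close>. Bases are written as successors to suit \<open>nat_pe_rel_exp\<close>,
    and \<open>div\<close> and \<open>mod\<close> are spelled out by quotients and
    remainders.\<close>
  have "f = (n choose k) \<longleftrightarrow> (\<exists>w X U q d r. w = Suc 1 ^ n \<and> U = Suc w ^ k \<and> X = Suc (Suc w) ^ n
      \<and> X = q * U + d \<and> d < U \<and> q = r * Suc w + f \<and> f < Suc w)" for f n k :: nat
  proof -
    define w where "w = Suc 1 ^ n"
    define U where "U = Suc w ^ k"
    define X where "X = Suc (Suc w) ^ n"
    have c: "(n choose k) = X div U mod Suc w"
      unfolding X_def U_def by (rule choose_digit[symmetric]) (simp add: w_def numeral_2_eq_2)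
    have "f = X div U mod Suc w \<longleftrightarrow> (\<exists>q d r. X = q * U + d \<and> d < U \<and> q = r * Suc w + f \<and> f < Suc w)"
    proof
      assume f: "f = X div U mod Suc w"
      have "U > 0" by (simp add: U_def)
      then have "X = (X div U) * U + X mod U \<and> X mod U < U \<and>
        X div U = (X div U div Suc w) * Suc w + f \<and> f < Suc w"
        unfolding f by (simp only: div_mult_mod_eq mod_less_divisor zero_less_Suc simp_thms)
      then show "\<exists>q d r. X = q * U + d \<and> d < U \<and> q = r * Suc w + f \<and> f < Suc w" by blast
    next
      assume "\<exists>q d r. X = q * U + d \<and> d < U \<and> q = r * Suc w + f \<and> f < Suc w"
      then obtain q d r where *: "X = q * U + d" "d < U" "q = r * Suc w + f" "f < Suc w" by blast
      have "X div U = q" using *(1,2) by (simp add: div_mult_self3)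
      then show "f = X div U mod Suc w" unfolding *(3)
        using *(4) by (simp only: mod_mult_self3 mod_less)
    qed
    then show ?thesis unfolding c by (simp add: w_def[symmetric] U_def[symmetric] X_def[symmetric])
        (metis w_def U_def X_def One_nat_def)
  qed
  then have "nat_pe_rel A (\<lambda>v. v 0 = (v 1 choose v 2))"
    by (simp only:) (intro nat_pe_rel_ex nat_pe_rel_conj nat_pe_rel_eq nat_pe_rel_exp nat_pe_rel_less polyfun_rules)
  from nat_pe_rel_subst[OF this, of "\<lambda>i. if i = 0 then F else if i
      = 1 then G else H"] assms show ?thesis
    by simp
qed

lemma nat_pe_rel_fact:
  assumes "polyfun F" "polyfun G"
  shows "nat_pe_rel A (\<lambda>v. F v = fact (G v))"
proof -
  \<comment> \<open>\<open>fact_quotient\<close> with the least admissible argument, written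
    \<open>Suc r\<close> so that it can be the base of a power.\<close>
  have "f = fact n \<longleftrightarrow> (\<exists>r P C d. Suc r = Suc n ^ (n + 3) \<and> P = Suc r ^ n \<and> C = (Suc r choose n)
      \<and> P = f * C + d \<and> d < C)" for f n :: nat
  proof -
    obtain r where r: "Suc r = Suc n ^ (n + 3)"
        by (metis not0_implies_Suc power_not_zero nat.simps(3))
    define C where "C = (Suc r choose n)"
    have c: "fact n = Suc r ^ n div C"
      unfolding C_def using fact_quotient[of n "Suc r"] r by simp
    have "n \<le> Suc n ^ (n + 3)"
      using less_exp[of n] power_mono[of 2 "Suc n" n] power_increasing[of n "n + 3" "Suc n"]
      by (cases n) (auto intro: order_trans[OF _ self_le_power])
    then have C: "C > 0" unfolding C_def r[symmetric] by simp
    have "f = Suc r ^ n div C \<longleftrightarrow> (\<exists>d. Suc r ^ n = f * C + d \<and> d < C)"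
    proof
      assume "f = Suc r ^ n div C"
      then have "Suc r ^ n = f * C + Suc r ^ n mod C \<and> Suc r ^ n mod C < C"
        using C by (simp only: div_mult_mod_eq mod_less_divisor simp_thms)
      then show "\<exists>d. Suc r ^ n = f * C + d \<and> d < C" by blast
    next
      assume "\<exists>d. Suc r ^ n = f * C + d \<and> d < C"
      then obtain d where "Suc r ^ n = f * C + d" "d < C" by blast
      then show "f = Suc r ^ n div C" by (simp only: div_mult_self3 div_less)
    qed
    moreover have "Suc r' = Suc n ^ (n + 3) \<longleftrightarrow> r' = r" for r' using r by auto
    ultimately show ?thesis unfolding c C_def by simp
  qed
  then have "nat_pe_rel A (\<lambda>v. v 0 = fact (v 1))"
    by (simp only:) (intro nat_pe_rel_ex nat_pe_rel_conj nat_pe_rel_eq nat_pe_rel_exp nat_pe_rel_less nat_pe_rel_choose polyfun_rules)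
  from nat_pe_rel_subst[OF this, of "\<lambda>i. if i = 0 then F else G"] assms show ?thesis
    by simp
qed

end

section \<open>Davis normal form inside the ring\<close>

context finite_order_ring
begin

lemma nat_pe_rel_exs:
  assumes "nat_pe_rel A S" shows "nat_pe_rel A (\<lambda>v. \<exists>a. S (glue m a v))"
proof (induction m)
  case 0
  then show ?case using assms by simp
next
  case (Suc m)
  have "(\<exists>a. S (glue (Suc m) a v)) \<longleftrightarrow> (\<exists>x a. S (glue m a (case_nat x v)))" for v
  proof
    assume "\<exists>x a. S (glue m a (case_nat x v))"
    then obtain x a where "S (glue m a (case_nat x v))" by blast
    moreover have "glue m a (case_nat x v) = glue (Suc m) (a(m := x)) v"
      by (subst glue_Suc[symmetric]) (auto simp: glue_def)
    ultimately show "\<exists>a. S (glue (Suc m) a v)" by metis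
  qed (metis glue_Suc)
  moreover have "case_nat (v 0) (\<lambda>i. v (Suc i)) = v" for v :: "nat \<Rightarrow> nat"
    by (auto split: nat.splits)
  then have "nat_pe_rel A (\<lambda>v. \<exists>x a. S (glue m a (case_nat x v)))"
    by (intro nat_pe_rel_ex) (simp add: Suc)
  ultimately show ?case by simp
qed

lemma nat_pe_rel_all_less: "(\<And>j. nat_pe_rel A (R j)) \<Longrightarrow> nat_pe_rel A (\<lambda>v. \<forall>j<m::nat. R j v)"
proof (induction m)
  case 0
  then show ?case using nat_pe_rel_eq[OF polyfun_const polyfun_const, of 0 0] by simp
next
  case (Suc m)
  have "(\<forall>j<Suc m. R j v) \<longleftrightarrow> (\<forall>j<m. R j v) \<and> R m v" for v
    by (auto simp: less_Suc_eq)
  then show ?case using nat_pe_rel_conj[OF Suc.IH[OF Suc.prems] Suc.prems[of m]] by simp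
qed

lemma cong_nat_iff_add: "[a = b] (mod n) \<longleftrightarrow> (\<exists>c d. a + c * n = b + d * n)" for a b n :: nat
proof
  assume "[a = b] (mod n)"
  then show "\<exists>c d. a + c * n = b + d * n"
    by (metis cong_iff_lin_nat add.commute mult.commute)
next
  assume "\<exists>c d. a + c * n = b + d * n"
  then obtain c d where "a + c * n = b + d * n" by blast
  then have "(a + c * n) mod n = (b + d * n) mod n" by simp
  then show "[a = b] (mod n)" by (simp add: cong_def)
qed

lemma nat_pe_rel_davis:
  assumes "davis R" shows "nat_pe_rel A R"
proof -
  obtain Q where Q: "diophantine Q" "\<And>v. R v \<longleftrightarrow> (\<exists>y. \<forall>k\<le>y. Q (case_nat y (case_nat k v)))"
    using assms by (auto elim: davis_E)
  obtain m F G where FG: "polyfun F" "polyfun G"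
    and Qw: "\<And>w. Q w \<longleftrightarrow> (\<exists>u. F (glue m u w) = G (glue m u w))"
    using Q(1) unfolding diophantine_def by metis
  \<comment> \<open>The list \<open>w\<close> consists of \<open>a\<close> (length
    \<open>m\<close>), \<open>M\<close>, \<open>T\<close>, \<open>b\<close>, \<open>y\<close> and
    then the parameters. The substitution \<open>s\<close> arranges it as
    \<open>b, ..., b, y, y\<close> followed by the parameters, for the size bound; \<open>t\<close>
    as \<open>a, y, M\<close> followed by the parameters, for the congruence. Two entries replace
    four, whence the shift \<open>i + 2\<close>.\<close>
  define s where "s = (\<lambda>i (w::nat\<Rightarrow>nat). if i < m then w (m + 2)
     else if i = m \<or> i = m + 1 then w (m + 3) else w (i + 2))"
  define t where "t = (\<lambda>i (w::nat\<Rightarrow>nat). if i < m then w i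
     else if i = m then w (m + 3) else if i = m + 1 then w m else w (i + 2))"
  have st: "polyfun (s i)" "polyfun (t i)" for i
    unfolding s_def t_def by (intro polyfun_if polyfun_var)+
  define F1 F2 G1 G2 where "F1 w = F (\<lambda>i. s i w)" and "F2 w = F (\<lambda>i. t i w)"
    and "G1 w = G (\<lambda>i. s i w)" and "G2 w = G (\<lambda>i. t i w)" for w
  have polyfun: "polyfun F1" "polyfun F2" "polyfun G1" "polyfun G2"
    unfolding F1_def F2_def G1_def G2_def
    using polyfun_subst[OF FG(1), of s, OF st(1)] polyfun_subst[OF FG(1), of t, OF st(2)]
      polyfun_subst[OF FG(2), of s, OF st(1)] polyfun_subst[OF FG(2), of t, OF st(2)] by simp_all
  define S where "S w \<longleftrightarrow>
      Suc (w (m + 3)) * (F1 w + G1 w + w (m + 2) + Suc (w (m + 3)) + 3) \<le> w (m + 1)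
    \<and> (\<exists>h. h = fact (w (m + 1)) \<and> (\<exists>d. Suc (w m) = h * d))
    \<and> (\<exists>N. N = (w m choose Suc (w (m + 3))) \<and> (\<exists>c d. F2 w + c * N = G2 w + d * N)
        \<and> (\<forall>j<m. \<exists>c. c = (w j choose w (m + 2)) \<and> (\<exists>d. c = N * d)))" for w
  have "nat_pe_rel A S"
    unfolding S_def
    by (intro nat_pe_rel_conj nat_pe_rel_ex nat_pe_rel_all_less nat_pe_rel_eq nat_pe_rel_le nat_pe_rel_fact nat_pe_rel_choose polyfun_rules
        polyfun_subst[OF polyfun(1)] polyfun_subst[OF polyfun(2)] polyfun_subst[OF polyfun(3)] polyfun_subst[OF polyfun(4)])
  then have "nat_pe_rel A (\<lambda>v. \<exists>a. S (glue m a v))" by (rule nat_pe_rel_exs)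
  moreover have "case_nat (v 0) (case_nat (v (Suc 0)) (case_nat (v (Suc (Suc 0)))
      (case_nat (v (Suc (Suc (Suc 0)))) (\<lambda>i. v (Suc (Suc (Suc (Suc i)))))))) = v"
          for v :: "nat \<Rightarrow> nat"
    by (auto split: nat.splits)
  ultimately have "nat_pe_rel A (\<lambda>v. \<exists>y b T M. \<exists>a. S (glue m a
      (case_nat M (case_nat T (case_nat b (case_nat y v))))))"
    by (intro nat_pe_rel_ex) simp
  moreover have "(\<exists>b T M a. S (glue m a (case_nat M (case_nat T (case_nat b (case_nat y v))))))
    \<longleftrightarrow> (\<forall>k\<le>y. Q (case_nat y (case_nat k v)))" for y v
  proof -
    have "S (glue m a (case_nat M (case_nat T (case_nat b (case_nat y v))))) \<longleftrightarrow>
      Suc y * (F (glue m (\<lambda>_. b) (case_nat y (case_nat y v)))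
        + G (glue m (\<lambda>_. b) (case_nat y (case_nat y v))) + b + Suc y + 3) \<le> T
       \<and> fact T dvd Suc M
       \<and> [F (glue m a (case_nat y (case_nat M v))) = G (glue m a (case_nat y (case_nat M v)))]
           (mod (M choose Suc y))
       \<and> (\<forall>j<m. (M choose Suc y) dvd (a j choose b))" for b T M a
    proof -
      define w where "w = glue m a (case_nat M (case_nat T (case_nat b (case_nat y v))))"
      have w: "w m = M" "w (m + 1) = T" "w (m + 2) = b" "w (m + 3) = y"
        "\<And>j. j < m \<Longrightarrow> w j = a j" "\<And>i. w (m + 4 + i) = v i"
        by (simp_all add: w_def glue_def numeral_eq_Suc)
      have "s i w = glue m (\<lambda>_. b) (case_nat y (case_nat y v)) i
          \<and> t i w = glue m a (case_nat y (case_nat M v)) i" for i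
      proof -
        consider "i < m" | "i = m" | "i = m + 1" | k where "i = m + 2 + k"
          by (metis le_Suc_ex less_Suc_eq not_le add_2_eq_Suc' Suc_eq_plus1)
        then show ?thesis
        proof cases
          case (4 k)
          have "i + 2 = m + 4 + k" using 4 by simp
          then have "w (i + 2) = v k" using w(6)[of k] by (simp only:)
          then show ?thesis by (simp add: s_def t_def glue_def 4)
        qed (use w in \<open>simp_all add: s_def t_def glue_def\<close>)
      qed
      then have "(\<lambda>i. s i w) = glue m (\<lambda>_. b) (case_nat y (case_nat y v))"
        "(\<lambda>i. t i w) = glue m a (case_nat y (case_nat M v))" by blast+
      then show ?thesis
        unfolding w_def[symmetric] S_def F1_def F2_def G1_def G2_def cong_nat_iff_add dvd_def
        using w by simp
    qed
    then show ?thesis unfolding Qw bounded_quantifier_elim[OF FG] by simp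
  qed
  ultimately show ?thesis unfolding Q(2) by simp
qed

end

section \<open>Diagonalisation\<close>

fun conj_eqs :: "(lz_term \<times> lz_term) list \<Rightarrow> lz_matrix" where
  "conj_eqs [] = Eq TZero TZero"
| "conj_eqs ((s, t) # E) = And (Eq s t) (conj_eqs E)"

definition vars_eqs :: "(lz_term \<times> lz_term) list \<Rightarrow> nat set" where
  "vars_eqs E = (\<Union>(s, t)\<in>set E. vars_term s \<union> vars_term t)"

lemma holds_conj_eqs: "holds_matrix v (conj_eqs E) \<longleftrightarrow> eqs_hold v E"
  by (induction E rule: conj_eqs.induct) (auto simp: eqs_hold_def)

lemma vars_conj_eqs: "vars_matrix (conj_eqs E) = vars_eqs E"
  by (induction E rule: conj_eqs.induct) (auto simp: vars_eqs_def)

lemma vars_sub_term: "vars_term (sub_term \<sigma> t) = (\<Union>i\<in>vars_term t. vars_term (\<sigma> i))"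
  by (induction t) auto

lemma eval_term_cong: "(\<And>i. i \<in> vars_term t \<Longrightarrow> v i = w i) \<Longrightarrow> eval_term v t = eval_term w t"
  by (induction t) auto

lemma eqs_hold_cong:
  assumes "\<And>i. i \<in> vars_eqs E \<Longrightarrow> v i = w i" shows "eqs_hold v E = eqs_hold w E"
proof -
  have "eval_term v s = eval_term w s \<and> eval_term v t = eval_term w t" if "(s, t) \<in> set E" for s t
    using that assms by (intro conjI eval_term_cong) (auto simp: vars_eqs_def)
  then show ?thesis unfolding eqs_hold_def
      by (metis (mono_tags, lifting) case_prod_conv case_prodI2 case_prodE)
qed

lemma eqs_hold_Cons:
  "eqs_hold v ((s, t) # E) \<longleftrightarrow> eval_term v s = eval_term v t \<and> eqs_hold v E"
  unfolding eqs_hold_def list.set by blast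

text \<open>Renumbering: all parameters are identified with variable 0, and the witnesses become the
  variables from 1 to \<open>m\<close>.\<close>

lemma pe_rel_eqs:
  assumes "pe_rel A R" "A \<noteq> {}"
  shows "\<exists>m E. vars_eqs E \<subseteq> {..m} \<and>
    (\<forall>f\<in>A. R (\<lambda>_. f) \<longleftrightarrow> (\<exists>w. (\<forall>i. w i \<in> A) \<and> w 0 = f \<and> eqs_hold w E))"
proof -
  obtain m E where R: "\<And>v. (\<And>i. v i \<in> A) \<Longrightarrow> R v \<longleftrightarrow> (\<exists>u. (\<forall>i. u i \<in> A) \<and> eqs_hold (glue m u v) E)"
    using assms(1) by (auto elim: pe_rel_E)
  define \<sigma> where "\<sigma> = (\<lambda>i. if i < m then TVar (Suc i) else TVar 0)"
  have e: "(\<lambda>i. eval_term w (\<sigma> i)) = glue m (\<lambda>i. w (Suc i)) (\<lambda>_. w 0)" for w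
    by (auto simp: \<sigma>_def glue_def)
  have "vars_eqs (sub_eqs \<sigma> E) \<subseteq> {..m}"
    by (auto simp: vars_eqs_def sub_eqs_def vars_sub_term \<sigma>_def split: if_splits)
  moreover have "R (\<lambda>_. f) \<longleftrightarrow> (\<exists>w. (\<forall>i. w i \<in> A) \<and> w 0 = f \<and> eqs_hold w (sub_eqs \<sigma> E))"
    if f: "f \<in> A" for f
    unfolding R[of "\<lambda>_. f", OF f] eqs_hold_sub e
  proof
    assume "\<exists>u. (\<forall>i. u i \<in> A) \<and> eqs_hold (glue m u (\<lambda>_. f)) E"
    then obtain u where "\<forall>i. u i \<in> A" "eqs_hold (glue m u (\<lambda>_. f)) E" by blast
    then show "\<exists>w. (\<forall>i. w i \<in> A) \<and> w 0 = f \<and> eqs_hold (glue m (\<lambda>i. w (Suc i)) (\<lambda>_. w 0)) E"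
      using f by (intro exI[of _ "case_nat f u"]) (auto split: nat.splits)
  next
    assume "\<exists>w. (\<forall>i. w i \<in> A) \<and> w 0 = f \<and> eqs_hold (glue m (\<lambda>i. w (Suc i)) (\<lambda>_. w 0)) E"
    then obtain w where "\<forall>i. w i \<in> A" "w 0 = f" "eqs_hold (glue m (\<lambda>i. w (Suc i)) (\<lambda>_. w 0)) E"
      by blast
    then show "\<exists>u. (\<forall>i. u i \<in> A) \<and> eqs_hold (glue m u (\<lambda>_. f)) E"
      by (intro exI[of _ "\<lambda>i. w (Suc i)"]) simp
  qed
  ultimately show ?thesis by blast
qed

primrec numeral_term :: "nat \<Rightarrow> lz_term" where
  "numeral_term 0 = TZero"
| "numeral_term (Suc n) = TAdd TOne (numeral_term n)"

lemma eval_numeral_term: "eval_term v (numeral_term n) = const_fun (of_nat n)"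
  by (induction n) (auto simp: const_fun_def fun_eq_iff)

lemma vars_numeral_term: "vars_term (numeral_term n) = {}"
  by (induction n) auto

text \<open>The diagonal formula has to mention the code of a numeral for its own number. That code
  obeys a recursion on \<open>n\<close>, here unrolled with \<open>beta\<close>; the tags 0, 1 and 4
  are those of \<open>TZero\<close>, \<open>TOne\<close> and \<open>TAdd\<close>.\<close>

lemma numeral_term_code_iff: "y = term_code (numeral_term n) \<longleftrightarrow>
  (\<exists>c d. beta c d 0 = prod_encode (0, 0) \<and>
     (\<forall>i<n. beta c d (Suc i) = prod_encode (4, prod_encode (prod_encode (1, 0), beta c d i))) \<and>
     y = beta c d n)"
proof
  assume y: "y = term_code (numeral_term n)"
  obtain c d where cd: "\<And>i. i < Suc n \<Longrightarrow> beta c d i = term_code (numeral_term i)"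
    using beta_exists[of "Suc n" "\<lambda>i. term_code (numeral_term i)"] by blast
  have "beta c d 0 = prod_encode (0, 0)" "y = beta c d n"
    "\<forall>i<n. beta c d (Suc i) = prod_encode (4, prod_encode (prod_encode (1, 0), beta c d i))"
    using cd y by simp_all
  then show "\<exists>c d. beta c d 0 = prod_encode (0, 0) \<and>
     (\<forall>i<n. beta c d (Suc i) = prod_encode (4, prod_encode (prod_encode (1, 0), beta c d i))) \<and>
     y = beta c d n"
    by blast
next
  assume "\<exists>c d. beta c d 0 = prod_encode (0, 0) \<and>
     (\<forall>i<n. beta c d (Suc i) = prod_encode (4, prod_encode (prod_encode (1, 0), beta c d i))) \<and>
     y = beta c d n"
  then obtain c d where *: "beta c d 0 = prod_encode (0, 0)" "y = beta c d n"
    "\<forall>i<n. beta c d (Suc i)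
        = prod_encode (4, prod_encode (prod_encode (1, 0), beta c d i))" by blast
  have "i \<le> n \<Longrightarrow> beta c d i = term_code (numeral_term i)" for i
    by (induction i) (use * in simp_all)
  then show "y = term_code (numeral_term n)" using *(2) by simp
qed

lemma davis_numeral_term_code: "davis (\<lambda>v. v i = term_code (numeral_term (v j)))"
proof -
  have "y = term_code (numeral_term n) \<longleftrightarrow>
  (\<exists>c d. (\<exists>b. b = beta c d 0 \<and> b = prod_encode (0, 0)) \<and>
     (\<forall>i<n. \<exists>b b' e. b = beta c d i \<and> b' = beta c d (Suc i) \<and> e
         = prod_encode (prod_encode (1, 0), b) \<and>
        b' = prod_encode (4, e)) \<and>
     y = beta c d n)" for y n
    unfolding numeral_term_code_iff by simp
  then show ?thesis
    by (simp only:) (intro davis_ex davis_conj davis_ball davis_eq davis_beta davis_pair polyfun_rules)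
qed

section \<open>Translation of equations into integer polynomials\<close>

lemma eval_zpoly_apply: "eval_zpoly v p z = (\<Sum>m\<leftarrow>p. eval_monomial v m z)"
  by (induction p) (simp_all add: eval_zpoly_def)

definition eval_int_poly :: "int poly \<Rightarrow> complex \<Rightarrow> complex" where
  "eval_int_poly c z = poly (map_poly of_int c) z"

lemma eval_int_poly_pCons: "eval_int_poly (pCons a p) z = of_int a + z * eval_int_poly p z"
  by (simp add: eval_int_poly_def map_poly_pCons)

lemma eval_int_poly_0: "eval_int_poly 0 z = 0"
  by (simp add: eval_int_poly_def)

lemma eval_int_poly_add: "eval_int_poly (p + q) z = eval_int_poly p z + eval_int_poly q z"
  by (induction p q rule: poly_induct2) (simp_all add: eval_int_poly_pCons eval_int_poly_0 algebra_simps)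

lemma eval_int_poly_smult: "eval_int_poly (Polynomial.smult a p) z = of_int a * eval_int_poly p z"
  by (induction p) (simp_all add: eval_int_poly_pCons eval_int_poly_0 algebra_simps)

lemma eval_int_poly_mult: "eval_int_poly (p * q) z = eval_int_poly p z * eval_int_poly q z"
  by (induction p) (simp_all add: eval_int_poly_pCons eval_int_poly_0 eval_int_poly_add
      eval_int_poly_smult algebra_simps)

text \<open>Exponent lists are read as padded with zeros, so that monomials in different numbers of
  variables can be multiplied.\<close>

definition exponent :: "nat list \<Rightarrow> nat \<Rightarrow> nat" where
  "exponent e i = (if i < length e then e ! i else 0)"

lemma eval_monomial_exponent:
  assumes "length e \<le> N"
  shows "eval_monomial v (c, e) z = eval_int_poly c z * (\<Prod>i<N. v i z ^ exponent e i)"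
proof -
  have "(\<Prod>i<N. v i z ^ exponent e i) = (\<Prod>i<length e. v i z ^ exponent e i)"
    using assms by (intro prod.mono_neutral_right) (auto simp: exponent_def)
  also have "\<dots> = (\<Prod>i<length e. v i z ^ (e ! i))"
    by (intro prod.cong) (auto simp: exponent_def)
  finally show ?thesis by (simp add: eval_monomial_def eval_int_poly_def)
qed

fun monomial_mult :: "int poly \<times> nat list \<Rightarrow> int poly \<times> nat list \<Rightarrow> int poly \<times> nat list" where
  "monomial_mult (c, e) (c', e') =
     (c * c', map (\<lambda>i. exponent e i + exponent e' i) [0..<max (length e) (length e')])"

lemma eval_monomial_mult:
  "eval_monomial v (monomial_mult a b) z = eval_monomial v a z * eval_monomial v b z"
proof -
  obtain c e c' e' where ab: "a = (c, e)" "b = (c', e')" by fastforce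
  define N where "N = max (length e) (length e')"
  have "eval_monomial v (monomial_mult a b) z = eval_int_poly (c * c') z *
     (\<Prod>i<N. v i z ^ exponent (map (\<lambda>i. exponent e i + exponent e' i) [0..<N]) i)"
    by (simp add: ab N_def eval_monomial_exponent[of _ "max (length e) (length e')"])
  also have "(\<Prod>i<N. v i z ^ exponent (map (\<lambda>i. exponent e i + exponent e' i) [0..<N]) i)
     = (\<Prod>i<N. v i z ^ exponent e i * v i z ^ exponent e' i)"
    by (intro prod.cong) (auto simp: exponent_def[of "map _ _"] power_add)
  finally show ?thesis
    by (simp add: ab eval_monomial_exponent[of _ N] N_def eval_int_poly_mult prod.distrib)
qed

definition zrep :: "((nat \<Rightarrow> cfun) \<Rightarrow> cfun) \<Rightarrow> bool" where
  "zrep F \<longleftrightarrow> (\<exists>p. \<forall>v z. eval_zpoly v p z = F v z)"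

lemma zrep_const: "zrep (\<lambda>v z. eval_int_poly c z)"
  unfolding zrep_def
  by (rule exI[of _ "[(c, [])]"]) (simp add: eval_zpoly_apply eval_monomial_def eval_int_poly_def)

lemma zrep_add: "zrep F \<Longrightarrow> zrep G \<Longrightarrow> zrep (\<lambda>v z. F v z + G v z)"
proof -
  assume "zrep F" "zrep G"
  then obtain p q where "\<And>v z. eval_zpoly v p z = F v z" "\<And>v z. eval_zpoly v q z = G v z"
    unfolding zrep_def by blast
  then have "eval_zpoly v (p @ q) z = F v z + G v z" for v z
    by (simp add: eval_zpoly_apply)
  then show ?thesis unfolding zrep_def by blast
qed

lemma zrep_mult: "zrep F \<Longrightarrow> zrep G \<Longrightarrow> zrep (\<lambda>v z. F v z * G v z)"
proof -
  assume "zrep F" "zrep G"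
  then obtain p q where pq: "\<And>v z. eval_zpoly v p z = F v z" "\<And>v z. eval_zpoly v q z = G v z"
    unfolding zrep_def by blast
  have "(\<Sum>b\<leftarrow>q. eval_monomial v (monomial_mult a b) z)
      = eval_monomial v a z * (\<Sum>b\<leftarrow>q. eval_monomial v b z)"
    for v z a by (simp add: eval_monomial_mult sum_list_const_mult)
  then have "eval_zpoly v (concat (map (\<lambda>a. map (monomial_mult a) q) p)) z
      = eval_zpoly v p z * eval_zpoly v q z"
    for v z by (induction p) (simp_all add: eval_zpoly_apply comp_def algebra_simps)
  then show ?thesis unfolding zrep_def using pq by metis
qed

lemma zrep_term: "zrep (\<lambda>v. eval_term v t)"
proof (induction t)
  case TZero
  show ?case using zrep_const[of 0] by (simp add: eval_int_poly_0 zero_fun_def)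
next
  case TOne
  show ?case using zrep_const[of "[:1:]"]
      by (simp add: eval_int_poly_0 eval_int_poly_pCons one_fun_def)
next
  case TZ
  show ?case using zrep_const[of "[:0, 1:]"] by (simp add: eval_int_poly_0 eval_int_poly_pCons)
next
  case (TVar j)
  have "(\<Prod>i<Suc j. v i z ^ ((replicate j 0 @ [1]) ! i)) = v j z" for v :: "nat \<Rightarrow> cfun" and z
    by (simp add: nth_append)
  then have "eval_zpoly v [([:1:], replicate j 0 @ [1])] z = v j z" for v z
    by (simp add: eval_zpoly_apply eval_monomial_def map_poly_pCons)
  then show ?case unfolding zrep_def by (metis eval_term.simps(4))
next
  case (TAdd s t)
  then show ?case using zrep_add by (simp add: plus_fun_def)
next
  case (TMul s t)
  then show ?case using zrep_mult by (simp add: times_fun_def)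
qed

lemma zpoly_of_eq: "\<exists>p. \<forall>v. eval_zpoly v p = 0 \<longleftrightarrow> eval_term v s = eval_term v t"
proof -
  have "zrep (\<lambda>v z. eval_term v s z + eval_int_poly [:-1:] z * eval_term v t z)"
    by (intro zrep_add zrep_mult zrep_const zrep_term)
  then obtain p where "\<And>v z. eval_zpoly v p z
      = eval_term v s z + eval_int_poly [:-1:] z * eval_term v t z"
    unfolding zrep_def by blast
  then have "eval_zpoly v p z = eval_term v s z - eval_term v t z" for v z
    by (simp add: eval_int_poly_pCons eval_int_poly_0)
  then show ?thesis by (intro exI[of _ p]) (simp add: fun_eq_iff)
qed

lemma zpolys_of_eqs: "\<exists>S. \<forall>v. (\<forall>p\<in>set S. eval_zpoly v p = 0) \<longleftrightarrow> eqs_hold v E"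
proof (induction E)
  case Nil
  show ?case by (rule exI[of _ "[]"]) (simp add: eqs_hold_def)
next
  case (Cons e E)
  obtain s t where e: "e = (s, t)" by (cases e)
  obtain S where "\<And>v. (\<forall>p\<in>set S. eval_zpoly v p = 0) \<longleftrightarrow> eqs_hold v E" using Cons by blast
  moreover obtain p where p: "\<And>v. eval_zpoly v p = 0 \<longleftrightarrow> eval_term v s = eval_term v t"
    using zpoly_of_eq by blast
  moreover have "(\<forall>r\<in>set (p # S). eval_zpoly v r = 0) \<longleftrightarrow>
      eval_zpoly v p = 0 \<and> (\<forall>r\<in>set S. eval_zpoly v r = 0)" for v
    unfolding list.set by blast
  ultimately show ?case unfolding e eqs_hold_Cons by (intro exI[of _ "p # S"] allI) (simp only:)
qed

text \<open>The equation \<open>y\<^sub>0 + 1 - (n + 1) = 0\<close>: the constant coefficient of \<open>y\<^sub>0 - n\<close> would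
  have an empty coefficient list for \<open>n = 0\<close>.\<close>

definition value_zpoly :: "nat \<Rightarrow> zpoly" where
  "value_zpoly n = [([:1:], [1]), ([:1:], []), ([:- int (Suc n):], [])]"

lemma eval_value_zpoly: "eval_zpoly v (value_zpoly n) = 0 \<longleftrightarrow> v 0 = const_fun (of_nat n)"
proof -
  have "eval_zpoly v (value_zpoly n) z = v 0 z - of_nat n" for z
    by (simp add: value_zpoly_def eval_zpoly_apply eval_monomial_def map_poly_pCons)
  then show ?thesis by (simp add: fun_eq_iff const_fun_def)
qed

text \<open>Since \<open>int_encode (- int (Suc n))\<close> is \<open>Suc (2 * n)\<close>, the code
  depends on \<open>n\<close> only through a polynomial inside nested pairings, which is directly of
  Davis form.\<close>

lemma value_zpoly_code:
  "list_encode (map monomial_code (value_zpoly n)) = Suc (prod_encode (monomial_code ([:1:], [1]),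
     Suc (prod_encode (monomial_code ([:1:], []), Suc (prod_encode (prod_encode (Suc (prod_encode
       (Suc (2 * n), 0)), 0), 0))))))"
  by (simp add: value_zpoly_def monomial_code_def int_encode_def sum_encode_def)

section \<open>Definability of the integers and undecidability\<close>

context finite_order_ring
begin

lemma nonempty: "A \<noteq> {}"
  using closed(1) by blast

lemma int_definable: "pos_ex_definable A int_constants"
proof -
  have pe_rel: "pe_rel A (\<lambda>v. is_int_const A (v 0))" by (intro pe_rel_int_const term_fun_var)
  obtain m E where E: "vars_eqs E \<subseteq> {..m}"
    "\<forall>f\<in>A. is_int_const A f \<longleftrightarrow> (\<exists>w. (\<forall>i. w i \<in> A) \<and> w 0 = f \<and> eqs_hold w E)"
    using pe_rel_eqs[OF pe_rel nonempty] by (elim exE conjE) (rule that)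
  note E = E(1) bspec[OF E(2)]
  define F where "F = Exists [1..<Suc m] (conj_eqs E)"
  have free: "free_vars F \<subseteq> {0}" using E(1) by (force simp: F_def vars_conj_eqs)
  have holds: "holds A (\<lambda>_. f) F \<longleftrightarrow> is_int_const A f" if f: "f \<in> A" for f
  proof
    assume "holds A (\<lambda>_. f) F"
    then obtain w where w: "\<forall>i\<in>set [1..<Suc m]. w i \<in> A" "\<forall>i. i \<notin> set [1..<Suc m] \<longrightarrow> w i = f"
      "eqs_hold w E" unfolding F_def holds.simps holds_conj_eqs by blast
    have "w i \<in> A" for i using w(1,2) f by (cases "i \<in> set [1..<Suc m]") (blast, simp)
    moreover have "w 0 = f" using w(2) by simp
    ultimately show "is_int_const A f" using E(2)[OF f] w(3) by blast
  next
    assume "is_int_const A f"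
    then obtain w where w: "\<forall>i. w i \<in> A" "w 0 = f" "eqs_hold w E" using E(2)[OF f] by blast
    \<comment> \<open>\<open>holds\<close> prescribes the value \<open>f\<close> outside the
      quantified variables. The variables of \<open>E\<close> are at most \<open>m\<close> and
      \<open>w 0 = f\<close>, so this change does not affect \<open>E\<close>.\<close>
    define u where "u i = (if i \<in> {1..m} then w i else f)" for i
    have "eqs_hold u E = eqs_hold w E"
      using E(1) w(2) by (intro eqs_hold_cong) (auto simp: u_def not_less_eq_eq)
    then show "holds A (\<lambda>_. f) F"
      unfolding F_def holds.simps holds_conj_eqs using w
      by (intro exI[of _ u]) (auto simp: u_def)
  qed
  have sub: "int_constants \<subseteq> A"
    using const_fun_in by (auto simp: int_constants_def const_fun_def)
  have int: "is_int_const A f \<longleftrightarrow> f \<in> int_constants" if "f \<in> A" for f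
    unfolding is_int_const_iff[OF that] int_constants_def by (auto simp: const_fun_def)
  have "f \<in> int_constants \<longleftrightarrow> f \<in> A \<and> holds A (\<lambda>_. f) F" for f
    using sub int[of f] holds[of f] by (cases "f \<in> A") auto
  then have "int_constants = {f \<in> A. holds A (\<lambda>_. f) F}" by auto
  then show ?thesis unfolding pos_ex_definable_def using free by (intro exI[of _ F] conjI)
qed

lemma davis_eqs:
  assumes "davis R"
  shows "\<exists>m E. vars_eqs E \<subseteq> {..m} \<and>
    (\<forall>n. R (\<lambda>_. n) \<longleftrightarrow> (\<exists>w. (\<forall>i. w i \<in> A) \<and> w 0 = const_fun (of_nat n) \<and> eqs_hold w E))"
proof -
  obtain R' where R': "pe_rel A R'" "\<And>x. R x \<longleftrightarrow> R' (\<lambda>i. const_fun (of_nat (x i)))"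
    using nat_pe_rel_davis[OF assms] unfolding nat_pe_rel_def by blast
  obtain m E where "vars_eqs E \<subseteq> {..m}"
    "\<forall>f\<in>A. R' (\<lambda>_. f) \<longleftrightarrow> (\<exists>w. (\<forall>i. w i \<in> A) \<and> w 0 = f \<and> eqs_hold w E)"
    using pe_rel_eqs[OF R'(1) nonempty] by (elim exE conjE) (rule that)
  then show ?thesis unfolding R'(2)
    by (intro exI[of _ E] exI[of _ m] conjI allI) (assumption, rule bspec[OF _ const_fun_in])
qed

text \<open>The relation "\<open>D\<close> returns 0 on the formula with number \<open>n\<close>
  after the equation of variable 0 with the numeral \<open>n\<close> has been added" is a system of
  equations \<open>E\<close> in the ring. Adding to \<open>E\<close> the equation with its own
  number yields a sentence that is true if and only if \<open>D\<close> rejects it.\<close>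

lemma undecidable_theory: "\<not> decidable formula_code pe_sentences (pe_theory A)"
proof
  assume "decidable formula_code pe_sentences (pe_theory A)"
  then obtain D where D: "\<And>F. F \<in> pe_sentences \<Longrightarrow>
      rec_eval D [formula_code F] (if F \<in> pe_theory A then 1 else 0)"
    unfolding decidable_def by blast
  define k where "k = term_code (TVar 0)"
  \<comment> \<open>The code of the formula obtained from list code \<open>l\<close> and matrix code
    \<open>m\<close> by putting variable 0 in front of the quantified ones and conjoining the
    equation with the numeral \<open>n\<close>; the tags are 1 for \<open>And\<close> and 0 for
    \<open>Eq\<close>.\<close>
  define S where "S l m n = prod_encode (Suc (prod_encode (0, l)), prod_encode (1,
      prod_encode (prod_encode (0, prod_encode (k, term_code (numeral_term n))), m)))" for l m n
  \<comment> \<open>Each pairing receives its own variable, because \<open>davis_pair\<close> takes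
    polynomials as arguments.\<close>
  have "davis (\<lambda>v. \<exists>l m t e1 e2 e3 e4 h c. v 0 = prod_encode (l, m) \<and> t
      = term_code (numeral_term (v 0))
      \<and> e1 = prod_encode (k, t) \<and> e2 = prod_encode (0, e1) \<and> e3 = prod_encode (e2, m)
      \<and> e4 = prod_encode (1, e3) \<and> h = prod_encode (0, l) \<and> c = prod_encode (Suc h, e4)
      \<and> rec_eval D [c] 0)"
    by (intro davis_ex davis_conj davis_pair davis_numeral_term_code davis_rec_eval polyfun_rules)
  then have "davis (\<lambda>v. \<exists>l m. v 0 = prod_encode (l, m) \<and> rec_eval D [S l m (v 0)] 0)"
    by (simp add: S_def)
  from davis_eqs[OF this] obtain m E where E: "vars_eqs E \<subseteq> {..m}"
    "\<And>n. (\<exists>l m. n = prod_encode (l, m) \<and> rec_eval D [S l m n] 0) \<longleftrightarrow>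
      (\<exists>w. (\<forall>i. w i \<in> A) \<and> w 0 = const_fun (of_nat n) \<and> eqs_hold w E)" by blast
  define l where "l = list_encode [1..<Suc m]"
  define p where "p = matrix_code (conj_eqs E)"
  \<comment> \<open>\<open>n\<close> is the code of \<open>Exists [1..<Suc m] (conj_eqs E)\<close>,
    in which variable 0 is still unquantified. Numbering this formula and not \<open>F\<close>
    avoids a circular definition.\<close>
  define n where "n = prod_encode (l, p)"
  define F where "F = Exists (0 # [1..<Suc m]) (And (Eq (TVar 0) (numeral_term n)) (conj_eqs E))"
  have "formula_code F = S l p n"
    by (simp add: F_def S_def k_def l_def p_def del: upt_Suc)
  moreover have sent: "F \<in> pe_sentences"
    using E(1) by (force simp: F_def pe_sentences_def vars_conj_eqs vars_numeral_term)
  moreover have "F \<in> pe_theory A \<longleftrightarrow> rec_eval D [S l p n] 0"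
  proof -
    have "holds A (\<lambda>_. 0) F \<longleftrightarrow> (\<exists>w. (\<forall>i. w i \<in> A) \<and> w 0 = const_fun (of_nat n) \<and> eqs_hold w E)"
    proof
      assume "holds A (\<lambda>_. 0) F"
      then obtain w where w: "\<forall>i\<in>set (0 # [1..<Suc m]). w i \<in> A"
        "\<forall>i. i \<notin> set (0 # [1..<Suc m]) \<longrightarrow> w i = 0" "w 0 = const_fun (of_nat n)" "eqs_hold w E"
        unfolding F_def holds.simps holds_matrix.simps holds_conj_eqs eval_numeral_term eval_term.simps
        by blast
      have "w i \<in> A" for i
        using w(1,2) closed(1) by (cases "i \<in> set (0 # [1..<Suc m])") (blast, simp)
      with w show "\<exists>w. (\<forall>i. w i \<in> A) \<and> w 0 = const_fun (of_nat n) \<and> eqs_hold w E" by blast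
    next
      assume "\<exists>w. (\<forall>i. w i \<in> A) \<and> w 0 = const_fun (of_nat n) \<and> eqs_hold w E"
      then obtain w where w: "\<forall>i. w i \<in> A" "w 0 = const_fun (of_nat n)" "eqs_hold w E" by blast
      \<comment> \<open>The sentence is evaluated at the zero assignment, so variables above
        \<open>m\<close> must be 0.\<close>
      define u where "u i = (if i \<le> m then w i else 0)" for i
      have "eqs_hold u E = eqs_hold w E"
        using E(1) by (intro eqs_hold_cong) (auto simp: u_def)
      then show "holds A (\<lambda>_. 0) F"
        unfolding F_def holds.simps holds_matrix.simps holds_conj_eqs eval_numeral_term eval_term.simps
        using w by (intro exI[of _ u]) (auto simp: u_def const_fun_in)
    qed
    also have "\<dots> \<longleftrightarrow> rec_eval D [S l p n] 0"
      unfolding E(2)[symmetric] by (auto simp: n_def)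
    finally show ?thesis using sent by (simp add: pe_theory_def)
  qed
  ultimately show False using D[OF sent] rec_eval_deterministic by (metis zero_neq_one)
qed

text \<open>The same diagonal argument for systems: \<open>n\<close> is the code of the system
  \<open>S\<close>, and the equation setting variable 0 to \<open>n\<close> is put in front of
  \<open>S\<close>. By the form of \<open>list_encode\<close> the code of the longer system is a
  pairing with \<open>n\<close>. All variables count as unknowns, so no list of quantifiers has to
  be coded.\<close>

lemma undecidable_systems: "\<not> decidable system_code UNIV (solvable_systems A)"
proof
  assume "decidable system_code UNIV (solvable_systems A)"
  then obtain D where D: "\<And>S. rec_eval D [system_code S] (if S \<in> solvable_systems A then 1 else 0)"
    unfolding decidable_def by blast
  define a b where "a = monomial_code ([:1:], [1])" and "b = monomial_code ([:1:], [])"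
  have "davis (\<lambda>v. \<exists>e1 e2 e3 e4 e5 e6. e1 = prod_encode (Suc (2 * v 0), 0) \<and> e2
      = prod_encode (Suc e1, 0)
      \<and> e3 = prod_encode (e2, 0) \<and> e4 = prod_encode (b, Suc e3) \<and> e5 = prod_encode (a, Suc e4)
      \<and> e6 = prod_encode (Suc e5, v 0) \<and> rec_eval D [Suc e6] 0)"
    by (intro davis_ex davis_conj davis_pair davis_rec_eval polyfun_rules)
  then have "davis (\<lambda>v. rec_eval D [Suc (prod_encode (list_encode (map monomial_code (value_zpoly (v 0))), v 0))] 0)"
    by (simp add: value_zpoly_code a_def b_def)
  from davis_eqs[OF this] obtain m E where
    E: "\<And>n. rec_eval D [Suc (prod_encode (list_encode (map monomial_code (value_zpoly n)), n))] 0 \<longleftrightarrow>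
      (\<exists>w. (\<forall>i. w i \<in> A) \<and> w 0 = const_fun (of_nat n) \<and> eqs_hold w E)" by blast
  obtain S where S: "\<And>v. (\<forall>p\<in>set S. eval_zpoly v p = 0) \<longleftrightarrow> eqs_hold v E"
    using zpolys_of_eqs by blast
  define n where "n = system_code S"
  have "value_zpoly n # S \<in> solvable_systems A \<longleftrightarrow> rec_eval D [system_code (value_zpoly n # S)] 0"
  proof -
    have "system_code (value_zpoly n # S) =
      Suc (prod_encode (list_encode (map monomial_code (value_zpoly n)), n))"
      by (simp add: system_code_def n_def)
    then show ?thesis using E[of n] S by (simp add: solvable_systems_def eval_value_zpoly)
  qed
  then show False
    using D[of "value_zpoly n # S"] rec_eval_deterministic[of D _ 0 1] by (simp split: if_splits)
qed

end

theorem theorem1p1: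
  fixes A :: "(complex \<Rightarrow> complex) set"
  assumes "is_subring A"
    and "range poly \<subseteq> A"
    and "A \<subseteq> H_fin"
    and "{f \<in> A. holonomic f} = range poly"
  shows "pos_ex_definable A int_constants
       \<and> \<not> decidable formula_code pe_sentences (pe_theory A)
       \<and> \<not> decidable system_code UNIV (solvable_systems A)"
proof -
  interpret finite_order_ring A
    by unfold_locales (use assms in auto)
  show ?thesis
    using int_definable undecidable_theory undecidable_systems by blast
qed

end
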